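(* Let $G$ be a graph with no $K_5\setminus e$ minor. Then the cut polytope $\mathrm{Cut}^\square(G)$ is normal.
   Context: All graphs are finite, without loops or multiple edges. For a graph $G$ on the vertex set $[n]=\{1,\dots,n\}$ with edge set $E$ and for $S\subset[n]$, let $\delta_G(S)\in\mathbb{R}^E$ be the $0/1$ vector with $\delta_G(S)_{ij}=1$ if $|S\cap\{i,j\}|=1$ and $\delta_G(S)_{ij}=0$ otherwise, for $ij\in E$. Let $A_G=\{\delta_G(S)\mid S\subset[n]\}\subset\mathbb{Z}^E$. The cut polytope $\mathrm{Cut}^\square(G)$ is the convex hull of $A_G$. Let $X_G=\left\{\binom{\mathbf{a}}{1} \mid \mathbf{a}\in A_G\right\}\subset\mathbb{Z}^{E+1}$ (each vector of $A_G$ with an extra last coordinate $1$ appended), and let $\mathbb{Z}(X_G)$, $\mathbb{Q}_+(X_G)$, $\mathbb{Z}_+(X_G)$ denote the sets of all linear combinations of elements of $X_G$ with coefficients that are, respectively, integers, nonnegative rationals, nonnegative integers. The cut polytope $\mathrm{Cut}^\square(G)$ is called normal if $\mathbb{Z}_+(X_G)=\mathbb{Z}(X_G)\cap\mathbb{Q}_+(X_G)$. $K_5\setminus e$ is the graph obtained from the complete graph $K_5$ on 5 vertices by deleting one edge. *)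

theory Defs
  imports "HOL-Analysis.Analysis"
begin

section \<open>Graphs and minors\<close>

record 'a graph =
  verts :: "'a set"
  edges :: "'a set set"

definition simple_graph :: "'a graph \<Rightarrow> bool" where
  "simple_graph G \<longleftrightarrow>
     finite (verts G) \<and> (\<forall>e\<in>edges G. e \<subseteq> verts G \<and> card e = 2)"

definition complete_graph :: "'a set \<Rightarrow> 'a graph" where
  "complete_graph V = \<lparr>verts = V, edges = {e. e \<subseteq> V \<and> card e = 2}\<rparr>"

definition delete_edge :: "'a graph \<Rightarrow> 'a set \<Rightarrow> 'a graph" where
  "delete_edge G e = \<lparr>verts = verts G, edges = edges G - {e}\<rparr>"

definition delete_vertex :: "'a graph \<Rightarrow> 'a \<Rightarrow> 'a graph" where
  "delete_vertex G v = \<lparr>verts = verts G - {v}, edges = {e \<in> edges G. v \<notin> e}\<rparr>"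

text \<open>Contraction of the edge \<open>uv\<close>: the vertex \<open>v\<close> is identified with \<open>u\<close>, and the merged
  vertex keeps the name \<open>u\<close>.  The image of \<open>uv\<close> itself is a singleton and is discarded;
  parallel edges coincide as sets.\<close>

definition contract_edge :: "'a graph \<Rightarrow> 'a \<Rightarrow> 'a \<Rightarrow> 'a graph" where
  "contract_edge G u v =
     \<lparr>verts = verts G - {v},
      edges = {e \<in> (\<lambda>e. (\<lambda>x. if x = v then u else x) ` e) ` edges G. card e = 2}\<rparr>"

inductive reduces_to :: "'a graph \<Rightarrow> 'a graph \<Rightarrow> bool" for G :: "'a graph" where
  refl: "reduces_to G G"
| delete_edge: "reduces_to G H \<Longrightarrow> e \<in> edges H \<Longrightarrow> reduces_to G (delete_edge H e)"
| delete_vertex: "reduces_to G H \<Longrightarrow> v \<in> verts H \<Longrightarrow> reduces_to G (delete_vertex H v)"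
| contract_edge: "reduces_to G H \<Longrightarrow> {u, v} \<in> edges H \<Longrightarrow> reduces_to G (contract_edge H u v)"

definition graph_isomorphic :: "'a graph \<Rightarrow> 'b graph \<Rightarrow> bool" where
  "graph_isomorphic G H \<longleftrightarrow>
     (\<exists>f. bij_betw f (verts G) (verts H) \<and> edges H = (\<lambda>e. f ` e) ` edges G)"

definition has_minor :: "'a graph \<Rightarrow> 'b graph \<Rightarrow> bool" where
  "has_minor G K \<longleftrightarrow> (\<exists>H. reduces_to G H \<and> graph_isomorphic H K)"

definition K5_minus_edge :: "nat graph" where
  "K5_minus_edge = delete_edge (complete_graph {1..5}) {4, 5}"


section \<open>Cut polytopes\<close>

text \<open>For a graph \<open>G\<close> with vertices in a finite type \<open>'v\<close>, the space of real vectors indexed by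
  \<open>edges G\<close> is realised as the coordinate subspace of \<open>real ^ 'v set\<close> whose coordinates
  outside \<open>edges G\<close> vanish.\<close>

definition cut_vector :: "'v::finite graph \<Rightarrow> 'v set \<Rightarrow> real ^ 'v set" where
  "cut_vector G S = (\<chi> e. if e \<in> edges G \<and> card (S \<inter> e) = 1 then 1 else 0)"

definition cut_vectors :: "'v::finite graph \<Rightarrow> (real ^ 'v set) set" where
  "cut_vectors G = {cut_vector G S | S. S \<subseteq> verts G}"

definition cut_polytope :: "'v::finite graph \<Rightarrow> (real ^ 'v set) set" where
  "cut_polytope G = convex hull cut_vectors G"

definition lifted_cut_vectors :: "'v::finite graph \<Rightarrow> ((real ^ 'v set) \<times> real) set" where
  "lifted_cut_vectors G = {(a, 1) | a. a \<in> cut_vectors G}"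

text \<open>Intended for finite \<open>X\<close>, as the sum is \<open>0\<close> otherwise.\<close>

definition combinations :: "real set \<Rightarrow> 'b::real_vector set \<Rightarrow> 'b set" where
  "combinations C X = {\<Sum>x\<in>X. c x *\<^sub>R x | c. \<forall>x\<in>X. c x \<in> C}"

text \<open>Normality of \<open>cut_polytope G\<close>; it is a condition on the generators \<open>cut_vectors G\<close> of the
  polytope, lifted to height \<open>1\<close>.\<close>

definition cut_polytope_normal :: "'v::finite graph \<Rightarrow> bool" where
  "cut_polytope_normal G \<longleftrightarrow>
     combinations \<nat> (lifted_cut_vectors G) =
     combinations \<int> (lifted_cut_vectors G) \<inter>
     combinations {q \<in> \<rat>. 0 \<le> q} (lifted_cut_vectors G)"

end

(* A point x of the lifted cone and lattice, at height t, extends to an integer function y on all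
   pairs of vertices which satisfies the triangle inequalities, has perimeter even and at most 2 t on
   every triangle: the pairs are added one at a time, and the bounds for a new value are lengths of
   walks, hence have the right parity.  It remains to write y, on the edges of G, as a sum of t cuts.
   On at most four vertices this can always be done, and as the cuts of a triangle are linearly
   independent at height 1, decompositions can be glued along cliques with at most three vertices
   once their terms are permuted and complemented.  So it suffices that a graph without K5 - e minor
   arises from graphs on at most four vertices by such clique sums (and deletion of edges).  In a
   minimal counterexample no separation of order at most three has both torsos K5 - e minor free.
   This makes it 3-connected and triangle-free, and leaves no 3-cut with two vertices on both sides.
   An induced nonseparating cycle C then has length 4, and the attachments to C of connected
   bipartitions of the rest force K_{3,3}, which is a clique sum of three copies of K_4. *)
theory Submission
  imports Defs
begin

text \<open>The integral and the nonnegative representation of a point agree on the edges of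
  \<open>G\<close> only. On other pairs the first may violate the triangle inequalities and the
  second need not be integral, so \<open>y\<close> has to be built afresh there. This is done before
  the graph is decomposed: one \<open>y\<close> then serves all torsos, whose clique edges may be
  new pairs. A torso remains in the class because it is a minor: disjoint connected sets are
  contracted onto the vertices of the separator until these are pairwise adjacent. Most of the graph
  theory is a search for such sets. Four vertices are the limit for the direct decomposition. On
  five, the path metric of K_{2,3} with t = 3 satisfies all conditions on \<open>y\<close> but
  violates the pentagonal inequality, so it is no sum of cuts. K_{3,3} is exceptional because a
  triangle added on one side creates K5 - e, so that the torsos leave the class; gluing, however,
  needs only that the final pieces are sums of cuts.\<close>

section \<open>Connected vertex sets\<close>

text \<open>Connectedness of the induced subgraph, stated through cuts instead of paths.\<close>

definition conn_set :: "('a \<Rightarrow> 'a \<Rightarrow> bool) \<Rightarrow> 'a set \<Rightarrow> bool" where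
  "conn_set E S \<longleftrightarrow> S \<noteq> {} \<and>
     (\<forall>A. A \<subseteq> S \<and> A \<noteq> {} \<and> A \<noteq> S \<longrightarrow> (\<exists>u\<in>A. \<exists>v\<in>S - A. E u v))"

definition touch :: "('a \<Rightarrow> 'a \<Rightarrow> bool) \<Rightarrow> 'a set \<Rightarrow> 'a set \<Rightarrow> bool" where
  "touch E A B \<longleftrightarrow> (\<exists>u\<in>A. \<exists>v\<in>B. E u v)"

definition is_comp :: "('a \<Rightarrow> 'a \<Rightarrow> bool) \<Rightarrow> 'a set \<Rightarrow> 'a set \<Rightarrow> bool" where
  "is_comp E S C \<longleftrightarrow> C \<subseteq> S \<and> conn_set E C \<and> (\<forall>u\<in>C. \<forall>v\<in>S - C. \<not> E u v)"

text \<open>Two readings occur. With \<open>L = V - Z\<close> this is the boundary of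
  \<open>Z\<close>; with \<open>L\<close> fixed it is the set of attachments of \<open>Z\<close> to
  \<open>L\<close>, monotone and additive in \<open>Z\<close>.\<close>

definition nbrs :: "('a \<Rightarrow> 'a \<Rightarrow> bool) \<Rightarrow> 'a set \<Rightarrow> 'a set \<Rightarrow> 'a set" where
  "nbrs E L Z = {v \<in> L. \<exists>z\<in>Z. E z v}"

lemma conn_set_nonempty: "conn_set E S \<Longrightarrow> S \<noteq> {}"
  by (simp add: conn_set_def)

lemma conn_setD: "conn_set E S \<Longrightarrow> A \<subseteq> S \<Longrightarrow> A \<noteq> {} \<Longrightarrow> A \<noteq> S \<Longrightarrow> \<exists>u\<in>A. \<exists>v\<in>S - A. E u v"
  by (simp add: conn_set_def)

lemma conn_setE:
  assumes "conn_set E S" "A \<subseteq> S" "A \<noteq> {}" "A \<noteq> S"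
  obtains u v where "u \<in> A" "v \<in> S" "v \<notin> A" "E u v"
  using conn_setD[OF assms] by blast

lemma conn_set_singleton [simp]: "conn_set E {x}"
  by (auto simp: conn_set_def)

lemma touch_sym: "symp E \<Longrightarrow> touch E A B \<Longrightarrow> touch E B A"
  unfolding touch_def by (meson sympD)

lemma touch_mono: "touch E A B \<Longrightarrow> A \<subseteq> A' \<Longrightarrow> B \<subseteq> B' \<Longrightarrow> touch E A' B'"
  unfolding touch_def by blast

lemma nbrs_mono: "Z \<subseteq> Z' \<Longrightarrow> nbrs E L Z \<subseteq> nbrs E L Z'"
  unfolding nbrs_def by blast

lemma nbrs_Un: "nbrs E L (Z \<union> Z') = nbrs E L Z \<union> nbrs E L Z'"
  unfolding nbrs_def by blast

lemma nbrs_subset: "nbrs E L Z \<subseteq> L"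
  unfolding nbrs_def by blast

lemma conn_set_Un:
  assumes "symp E" "conn_set E A" "conn_set E B" "A \<inter> B \<noteq> {} \<or> touch E A B"
  shows "conn_set E (A \<union> B)"
  unfolding conn_set_def
proof (intro conjI allI impI)
  show "A \<union> B \<noteq> {}" using assms(2) conn_set_nonempty by auto
next
  fix T assume T: "T \<subseteq> A \<union> B \<and> T \<noteq> {} \<and> T \<noteq> A \<union> B"
  have *: "\<exists>u\<in>T. \<exists>v\<in>(A \<union> B) - T. E u v" if "conn_set E D" "D \<subseteq> A \<union> B" "T \<inter> D \<noteq> {}" "\<not> D \<subseteq> T" for D
    using conn_setD[OF that(1), of "T \<inter> D"] that by blast
  have tBA: "touch E B A" if "touch E A B" using touch_sym[OF assms(1) that] .
  show "\<exists>u\<in>T. \<exists>v\<in>A \<union> B - T. E u v"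
  proof (cases "(T \<inter> A \<noteq> {} \<and> \<not> A \<subseteq> T) \<or> (T \<inter> B \<noteq> {} \<and> \<not> B \<subseteq> T)")
    case True then show ?thesis using *[OF assms(2)] *[OF assms(3)] by blast
  next
    case False
    then have "(A \<subseteq> T \<and> T \<inter> B = {}) \<or> (B \<subseteq> T \<and> T \<inter> A = {})" using T by blast
    then show ?thesis
    proof
      assume a: "A \<subseteq> T \<and> T \<inter> B = {}"
      have "A \<inter> B = {}" using a by blast
      then have "touch E A B" using assms(4) by blast
      then show ?thesis unfolding touch_def using a by blast
    next
      assume a: "B \<subseteq> T \<and> T \<inter> A = {}"
      have "A \<inter> B = {}" using a by blast
      then have "touch E B A" using assms(4) tBA by blast
      then show ?thesis unfolding touch_def using a by blast
    qed
  qed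
qed

lemma conn_set_insert:
  assumes "symp E" "conn_set E B" "touch E {x} B"
  shows "conn_set E (insert x B)"
  using conn_set_Un[OF assms(1) conn_set_singleton[of E x] assms(2)] assms(3) by simp

lemma conn_set_Union:
  assumes "\<And>A. A \<in> F \<Longrightarrow> conn_set E A \<and> s \<in> A" "F \<noteq> {}" "symp E"
  shows "conn_set E (\<Union>F)"
  unfolding conn_set_def
proof (intro conjI allI impI)
  show "\<Union>F \<noteq> {}" using assms by blast
next
  fix T assume T: "T \<subseteq> \<Union>F \<and> T \<noteq> {} \<and> T \<noteq> \<Union>F"
  have *: "\<exists>u\<in>T. \<exists>v\<in>\<Union>F - T. E u v" if "D \<in> F" "T \<inter> D \<noteq> {}" "\<not> D \<subseteq> T" for D
    using conn_setD[of E D "T \<inter> D"] assms(1)[OF that(1)] that by blast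
  show "\<exists>u\<in>T. \<exists>v\<in>\<Union>F - T. E u v"
  proof (cases "s \<in> T")
    case True
    then obtain D where "D \<in> F" "\<not> D \<subseteq> T" using T by blast
    then show ?thesis using * True assms(1) by blast
  next
    case False
    then obtain D where "D \<in> F" "T \<inter> D \<noteq> {}" using T by blast
    then show ?thesis using * False assms(1) by blast
  qed
qed

text \<open>The union of all connected subsets of \<open>S\<close> that contain \<open>s\<close> is
  connected and absorbs every vertex adjacent to it.\<close>

lemma is_comp_exists:
  assumes "symp E" "s \<in> S"
  obtains C where "is_comp E S C" "s \<in> C"
proof -
  define F where "F = {C. C \<subseteq> S \<and> conn_set E C \<and> s \<in> C}"
  have FI: "C \<in> F" if "C \<subseteq> S" "conn_set E C" "s \<in> C" for C using that by (simp add: F_def)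
  have ne: "{s} \<in> F" using assms by (simp add: F_def)
  have c: "conn_set E (\<Union>F)"
  proof (rule conn_set_Union[of F E s])
    show "conn_set E A \<and> s \<in> A" if "A \<in> F" for A using that by (simp add: F_def)
    show "F \<noteq> {}" using ne by blast
  qed (rule assms(1))
  have "\<not> E u v" if "u \<in> \<Union>F" "v \<in> S - \<Union>F" for u v
  proof
    assume "E u v"
    then have "touch E {v} (\<Union>F)" using sympD[OF assms(1)] that(1) unfolding touch_def by blast
    then have "conn_set E (insert v (\<Union>F))" by (rule conn_set_insert[OF assms(1) c])
    moreover have "insert v (\<Union>F) \<subseteq> S" using that(2) by (auto simp: F_def)
    moreover have "s \<in> insert v (\<Union>F)" using ne by blast
    ultimately have "insert v (\<Union>F) \<in> F" by (intro FI)
    then show False using that(2) by blast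
  qed
  moreover have "\<Union>F \<subseteq> S" by (auto simp: F_def)
  ultimately have comp: "is_comp E S (\<Union>F)" unfolding is_comp_def using c by simp
  have "s \<in> \<Union>F" using ne by blast
  with comp show ?thesis by (rule that)
qed

lemma is_compD:
  assumes "is_comp E S C"
  shows "C \<subseteq> S" "conn_set E C" "C \<noteq> {}" "u \<in> C \<Longrightarrow> v \<in> S \<Longrightarrow> v \<notin> C \<Longrightarrow> \<not> E u v"
  using assms by (auto simp: is_comp_def conn_set_def)

lemma is_comp_absorb:
  assumes "is_comp E S C" "conn_set E A" "A \<subseteq> S" "A \<inter> C \<noteq> {}"
  shows "A \<subseteq> C"
proof (rule ccontr)
  assume "\<not> A \<subseteq> C"
  then obtain u v where "u \<in> A \<inter> C" "v \<in> A - (A \<inter> C)" "E u v"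
    using conn_setD[OF assms(2), of "A \<inter> C"] assms(4) by blast
  then show False using is_compD(4)[OF assms(1), of u v] assms(3) by blast
qed

lemma is_comp_disjoint:
  assumes "is_comp E S C" "is_comp E S D" "C \<noteq> D"
  shows "C \<inter> D = {}"
proof (rule ccontr)
  assume n: "C \<inter> D \<noteq> {}"
  have "D \<subseteq> C" using is_comp_absorb[OF assms(1) is_compD(2,1)[OF assms(2)]] n by blast
  moreover have "C \<subseteq> D" by (rule is_comp_absorb[OF assms(2) is_compD(2,1)[OF assms(1)] n])
  ultimately show False using assms(3) by simp
qed

lemma two_comps:
  assumes "symp E" "S \<noteq> {}" "\<not> conn_set E S"
  obtains C D where "is_comp E S C" "is_comp E S D" "C \<inter> D = {}"
proof -
  obtain s where s: "s \<in> S" using assms by blast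
  obtain C where C: "is_comp E S C" "s \<in> C" using is_comp_exists[OF assms(1) s] .
  then have "C \<noteq> S" using assms(3) is_compD(2)[OF C(1)] by blast
  then obtain d where d: "d \<in> S" "d \<notin> C" using is_compD(1)[OF C(1)] by blast
  obtain D where D: "is_comp E S D" "d \<in> D" using is_comp_exists[OF assms(1) d(1)] .
  have "C \<noteq> D" using D d by blast
  then have "C \<inter> D = {}" using is_comp_disjoint[OF C(1) D(1)] by blast
  then show ?thesis by (rule that[OF C(1) D(1)])
qed

lemma comp_touch_core:
  assumes "symp E" "conn_set E X" "B \<subseteq> X" "B \<noteq> {}" "is_comp E (X - B) Y"
  shows "touch E Y B"
proof -
  have "Y \<subseteq> X - B" "Y \<noteq> {}" using is_compD(1,3)[OF assms(5)] by simp_all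
  then have h: "Y \<subseteq> X" "Y \<noteq> {}" "Y \<noteq> X" using assms(3,4) by blast+
  obtain u v where uv: "u \<in> Y" "v \<in> X" "v \<notin> Y" "E u v" by (rule conn_setE[OF assms(2) h])
  then have "v \<in> B" using is_compD(4)[OF assms(5), of u v] by blast
  then show ?thesis using uv unfolding touch_def by blast
qed

text \<open>If one side of a cut of \<open>X - Y\<close> misses \<open>B\<close>, it has an outgoing
  edge in \<open>X\<close>, which cannot end in the component \<open>Y\<close>. If the cut divides
  \<open>B\<close>, the connectedness of \<open>B\<close> supplies the edge.\<close>

lemma conn_set_minus_comp:
  assumes "symp E" "conn_set E X" "conn_set E B" "B \<subseteq> X" "is_comp E (X - B) Y"
  shows "conn_set E (X - Y)"
  unfolding conn_set_def
proof (intro conjI allI impI)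
  have Bd: "B \<inter> Y = {}" "B \<noteq> {}" using is_compD(1)[OF assms(5)] conn_set_nonempty[OF assms(3)] by blast+
  then show "X - Y \<noteq> {}" using assms(4) by blast
  fix A assume A: "A \<subseteq> X - Y \<and> A \<noteq> {} \<and> A \<noteq> X - Y"
  have noY: "\<not> E u v" if "u \<in> X - B - Y" "v \<in> Y" for u v
    using is_compD(4)[OF assms(5), of v u] that sympD[OF assms(1), of u v] by blast
  show "\<exists>u\<in>A. \<exists>v\<in>X - Y - A. E u v"
  proof -
    consider "A \<inter> B = {}" | "B \<subseteq> A" | "A \<inter> B \<noteq> {}" "\<not> B \<subseteq> A" by blast
    then show ?thesis
    proof cases
      case 1
      have h: "A \<subseteq> X" "A \<noteq> {}" "A \<noteq> X" using A 1 Bd assms(4) by blast+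
      obtain u v where uv: "u \<in> A" "v \<in> X" "v \<notin> A" "E u v" by (rule conn_setE[OF assms(2) h])
      then have "v \<notin> Y" using noY[of u v] A 1 by blast
      then show ?thesis using uv by blast
    next
      case 2
      let ?A = "X - Y - A"
      have h: "?A \<subseteq> X" "?A \<noteq> {}" "?A \<noteq> X" using A 2 Bd assms(4) by blast+
      obtain u v where uv: "u \<in> ?A" "v \<in> X" "v \<notin> ?A" "E u v" by (rule conn_setE[OF assms(2) h])
      then have "v \<notin> Y" using noY[of u v] 2 by blast
      then show ?thesis using uv sympD[OF assms(1) uv(4)] by blast
    next
      case 3
      then have h: "A \<inter> B \<subseteq> B" "A \<inter> B \<noteq> {}" "A \<inter> B \<noteq> B" by blast+
      obtain u v where uv: "u \<in> A \<inter> B" "v \<in> B" "v \<notin> A \<inter> B" "E u v" by (rule conn_setE[OF assms(3) h])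
      then show ?thesis using assms(4) Bd by blast
    qed
  qed
qed

section \<open>Connected bipartitions of a 2-connected set\<close>

text \<open>An extremal choice: among the vertices of \<open>D1\<close> other than \<open>y0\<close>
  with a neighbour outside, \<open>y\<close> maximises the component of \<open>y0\<close> in
  \<open>D1 - {y}\<close>. Another component would contain a further candidate \<open>u\<close>, and
  the component of \<open>y0\<close> in \<open>D1 - {u}\<close> would also contain
  \<open>y\<close>.\<close>

lemma two_connected_grow:
  assumes "finite X" "symp E" "\<And>x. x \<in> X \<Longrightarrow> conn_set E (X - {x})"
    and "D1 \<subseteq> X" "D1 \<noteq> X" "conn_set E D1" "y0 \<in> D1" "D1 \<noteq> {y0}"
  obtains y where "y \<in> D1" "y \<noteq> y0" "touch E {y} (X - D1)" "conn_set E (D1 - {y})"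
proof -
  define Cand where "Cand = {y \<in> D1 - {y0}. touch E {y} (X - D1)}"
  have h: "y0 \<in> X" "D1 - {y0} \<subseteq> X - {y0}" "D1 - {y0} \<noteq> {}" "D1 - {y0} \<noteq> X - {y0}" using assms(4,5,7,8) by blast+
  obtain u v where "u \<in> D1 - {y0}" "v \<in> X - {y0}" "v \<notin> D1 - {y0}" "E u v"
    by (rule conn_setE[OF assms(3)[OF h(1)] h(2-4)])
  then have "u \<in> Cand" unfolding Cand_def touch_def using assms(7) by blast
  then have ne: "Cand \<noteq> {}" by blast
  have fD: "finite D1" using assms(1,4) finite_subset by blast
  have fc: "finite Cand" unfolding Cand_def using fD by simp
  define K where "K y = (SOME C. is_comp E (D1 - {y}) C \<and> y0 \<in> C)" for y
  have K: "is_comp E (D1 - {y}) (K y) \<and> y0 \<in> K y" if "y \<in> Cand" for y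
  proof -
    have "y0 \<in> D1 - {y}" using that assms(7) by (auto simp: Cand_def)
    then obtain C where "is_comp E (D1 - {y}) C \<and> y0 \<in> C" using is_comp_exists[OF assms(2)] by metis
    then show ?thesis unfolding K_def by (rule someI)
  qed
  obtain y where y: "y \<in> Cand" "\<And>z. z \<in> Cand \<Longrightarrow> card (K z) \<le> card (K y)"
  proof -
    have "Max ((card \<circ> K) ` Cand) \<in> (card \<circ> K) ` Cand" using fc ne by simp
    then obtain y where "y \<in> Cand" "card (K y) = Max ((card \<circ> K) ` Cand)" by auto
    then show ?thesis using that[of y] fc by simp
  qed
  have "conn_set E (D1 - {y})"
  proof (rule ccontr)
    assume "\<not> ?thesis"
    have Kc: "is_comp E (D1 - {y}) (K y)" using K[OF y(1)] by blast
    have n: "K y \<noteq> D1 - {y}" using \<open>\<not> conn_set E (D1 - {y})\<close> is_compD(2)[OF Kc] by metis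
    let ?A = "D1 - {y} - K y"
    have Ksub: "K y \<subseteq> D1 - {y}" by (rule is_compD(1)[OF Kc])
    then have Ane: "?A \<noteq> {}" using n by blast
    have yX: "y \<in> X" "y \<in> D1" using y(1) assms(4) by (auto simp: Cand_def)
    have y0K: "y0 \<in> K y" using K[OF y(1)] by simp
    have y0y: "y0 \<noteq> y" using y0K Ksub by auto
    have "y0 \<in> X - {y}" "y0 \<notin> ?A" using y0K y0y assms(4,7) by auto
    then have h: "?A \<noteq> X - {y}" by metis
    have h1: "?A \<subseteq> X - {y}" using assms(4) by auto
    obtain u v where uv: "u \<in> ?A" "v \<in> X - {y}" "v \<notin> ?A" "E u v"
      by (rule conn_setE[OF assms(3)[OF yX(1)] h1 Ane h])
    have "v \<notin> K y" using is_compD(4)[OF Kc, of v u] uv(1) sympD[OF assms(2) uv(4)] by auto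
    then have "v \<in> X - D1" using uv(2,3) by auto
    then have "touch E {u} (X - D1)" using uv(4) by (auto simp: touch_def)
    moreover have "u \<in> D1" "u \<noteq> y0" using uv(1) y0K by auto
    ultimately have uC: "u \<in> Cand" by (simp add: Cand_def)
    have "{y} \<subseteq> D1" "{y} \<noteq> {}" using yX by auto
    from comp_touch_core[OF assms(2,6) this Kc] have "touch E (K y) {y}" .
    then have c1: "conn_set E (insert y (K y))"
      by (rule conn_set_insert[OF assms(2) is_compD(2)[OF Kc] touch_sym[OF assms(2)]])
    have "y \<noteq> u" "u \<notin> K y" using uv(1) by auto
    then have c2: "insert y (K y) \<subseteq> D1 - {u}" using Ksub yX(2) by blast
    have Ku: "is_comp E (D1 - {u}) (K u)" using K[OF uC] by simp
    have c3: "insert y (K y) \<inter> K u \<noteq> {}" using y0K K[OF uC] by auto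
    have "insert y (K y) \<subseteq> K u" by (rule is_comp_absorb[OF Ku c1 c2 c3])
    then have le: "card (insert y (K y)) \<le> card (K u)"
      by (rule card_mono[rotated]) (rule finite_subset[OF is_compD(1)[OF Ku]], simp add: fD)
    have "finite (K y)" by (rule finite_subset[OF Ksub]) (simp add: fD)
    moreover have "y \<notin> K y" using Ksub by auto
    ultimately have "card (insert y (K y)) = Suc (card (K y))" by simp
    then show False using y(2)[OF uC] le by linarith
  qed
  moreover have "y \<in> D1" "y \<noteq> y0" "touch E {y} (X - D1)" using y(1) by (simp_all add: Cand_def)
  ultimately show ?thesis by (intro that)
qed

text \<open>\<open>D\<close> is a smallest part with \<open>Q\<close> in a bipartition into
  connected parts. By \<open>two_connected_grow\<close> two of its vertices can be moved across with
  both parts remaining connected, so minimality destroys \<open>Q\<close>. In the applications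
  \<open>Q\<close> is a condition on attachments, and its loss tells what \<open>y\<close> and
  \<open>z\<close> contribute.\<close>

lemma minimal_split:
  assumes "finite X" "symp E" "\<And>x. x \<in> X \<Longrightarrow> conn_set E (X - {x})"
    and mono: "\<And>A B. Q A \<Longrightarrow> A \<subseteq> B \<Longrightarrow> Q B"
    and "x0 \<in> X" "Q (X - {x0})" and single: "\<And>x. x \<in> X \<Longrightarrow> \<not> Q {x}"
  obtains D y z where "D \<subseteq> X" "D \<noteq> X" "conn_set E D" "conn_set E (X - D)" "Q D"
    "y \<in> D" "z \<in> D" "y \<noteq> z" "touch E {y} (X - D)" "touch E {z} (X - D)"
    "conn_set E (D - {y})" "conn_set E (D - {z})" "\<not> Q (D - {y})" "\<not> Q (D - {z})"
proof -
  define R where "R D \<longleftrightarrow> D \<subseteq> X \<and> D \<noteq> X \<and> conn_set E D \<and> conn_set E (X - D) \<and> Q D" for D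
  have "X - (X - {x0}) = {x0}" "X - {x0} \<noteq> X" using assms(5) by blast+
  then have "R (X - {x0})" unfolding R_def using assms(3)[OF assms(5)] assms(6) by simp
  then have "\<exists>D. R D \<and> (\<forall>D'. R D' \<longrightarrow> card D \<le> card D')"
    by (rule ex_has_least_nat)
  then obtain D where D: "R D" "\<And>D'. R D' \<Longrightarrow> card D \<le> card D'" by metis
  have D': "D \<subseteq> X" "D \<noteq> X" "conn_set E D" "conn_set E (X - D)" "Q D" using D(1) by (auto simp: R_def)
  have fD: "finite D" using D'(1) assms(1) finite_subset by blast
  have step: "\<not> Q (D - {y})" if "y \<in> D" "touch E {y} (X - D)" "conn_set E (D - {y})" for y
  proof
    assume "Q (D - {y})"
    moreover have "X - (D - {y}) = insert y (X - D)" using that(1) D'(1) by auto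
    moreover have "conn_set E (insert y (X - D))" by (rule conn_set_insert[OF assms(2) D'(4) that(2)])
    ultimately have "R (D - {y})" unfolding R_def using that D' by auto
    then have "card D \<le> card (D - {y})" using D(2) by blast
    then show False using fD that(1) by (meson card_Diff1_less linorder_not_le)
  qed
  have ns: "D \<noteq> {x}" for x using D'(1,5) single[of x] by blast
  obtain y0 where y0: "y0 \<in> D" using conn_set_nonempty[OF D'(3)] by blast
  obtain y where y: "y \<in> D" "y \<noteq> y0" "touch E {y} (X - D)" "conn_set E (D - {y})"
    by (rule two_connected_grow[OF assms(1-3) D'(1-3) y0 ns])
  obtain z where z: "z \<in> D" "z \<noteq> y" "touch E {z} (X - D)" "conn_set E (D - {z})"
    by (rule two_connected_grow[OF assms(1-3) D'(1-3) y(1) ns])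
  have "y \<noteq> z" using z by simp
  then show ?thesis
    by (rule that[OF D' y(1) z(1) _ y(3) z(3) y(4) z(4) step[OF y(1,3,4)] step[OF z(1,3,4)]])
qed

section \<open>Minors given by branch sets\<close>

text \<open>Branch sets of a \<open>K5 - e\<close> minor. The missing edge joins \<open>D\<close> and \<open>F\<close>, which may
  nevertheless be adjacent.\<close>

definition k5e_model :: "('a \<Rightarrow> 'a \<Rightarrow> bool) \<Rightarrow> 'a set \<Rightarrow> 'a set \<Rightarrow> 'a set \<Rightarrow> 'a set \<Rightarrow> 'a set \<Rightarrow> bool" where
  "k5e_model E A B C D F \<longleftrightarrow>
     (\<forall>X\<in>{A, B, C, D, F}. conn_set E X) \<and>
     (A \<inter> B = {} \<and> A \<inter> C = {} \<and> A \<inter> D = {} \<and> A \<inter> F = {} \<and> B \<inter> C = {} \<and> B \<inter> D = {} \<and>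
     B \<inter> F = {} \<and> C \<inter> D = {} \<and> C \<inter> F = {} \<and> D \<inter> F = {}) \<and>
     touch E A B \<and> touch E A C \<and> touch E B C \<and>
     touch E D A \<and> touch E D B \<and> touch E D C \<and>
     touch E F A \<and> touch E F B \<and> touch E F C"

definition k5e :: "'a set \<Rightarrow> ('a \<Rightarrow> 'a \<Rightarrow> bool) \<Rightarrow> bool" where
  "k5e V E \<longleftrightarrow> (\<exists>A B C D F. A \<union> B \<union> C \<union> D \<union> F \<subseteq> V \<and> k5e_model E A B C D F)"

lemma k5eI:
  assumes "A \<union> B \<union> C \<union> D \<union> F \<subseteq> V"
    "conn_set E A" "conn_set E B" "conn_set E C" "conn_set E D" "conn_set E F"
    "A \<inter> B = {}" "A \<inter> C = {}" "A \<inter> D = {}" "A \<inter> F = {}" "B \<inter> C = {}" "B \<inter> D = {}"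
    "B \<inter> F = {}" "C \<inter> D = {}" "C \<inter> F = {}" "D \<inter> F = {}"
    "touch E A B" "touch E A C" "touch E B C"
    "touch E D A" "touch E D B" "touch E D C"
    "touch E F A" "touch E F B" "touch E F C"
  shows "k5e V E"
  unfolding k5e_def k5e_model_def
  by (rule exI[of _ A], rule exI[of _ B], rule exI[of _ C], rule exI[of _ D], rule exI[of _ F]) (use assms in simp)

text \<open>A cut either divides some \<open>\<phi> s\<close>, or it is induced by a cut of
  \<open>S\<close>.\<close>

lemma conn_set_blowup:
  assumes "symp E" "conn_set E1 S"
    and conn: "\<And>v. v \<in> S \<Longrightarrow> conn_set E (\<phi> v)"
    and edge: "\<And>u v. u \<in> S \<Longrightarrow> v \<in> S \<Longrightarrow> E1 u v \<Longrightarrow> touch E (\<phi> u) (\<phi> v)"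
  shows "conn_set E (\<Union>(\<phi> ` S))"
  unfolding conn_set_def
proof (intro conjI allI impI)
  obtain s where "s \<in> S" using conn_set_nonempty[OF assms(2)] by blast
  then show "\<Union>(\<phi> ` S) \<noteq> {}" using conn_set_nonempty[OF conn[of s]] by blast
next
  fix T assume T: "T \<subseteq> \<Union>(\<phi> ` S) \<and> T \<noteq> {} \<and> T \<noteq> \<Union>(\<phi> ` S)"
  show "\<exists>u\<in>T. \<exists>v\<in>\<Union>(\<phi> ` S) - T. E u v"
  proof (cases "\<exists>s\<in>S. \<phi> s \<inter> T \<noteq> {} \<and> \<not> \<phi> s \<subseteq> T")
    case True
    then obtain s where s: "s \<in> S" "\<phi> s \<inter> T \<noteq> {}" "\<not> \<phi> s \<subseteq> T" by blast
    then have h: "\<phi> s \<inter> T \<subseteq> \<phi> s" "\<phi> s \<inter> T \<noteq> {}" "\<phi> s \<inter> T \<noteq> \<phi> s" by blast+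
    obtain u v where "u \<in> \<phi> s \<inter> T" "v \<in> \<phi> s" "v \<notin> \<phi> s \<inter> T" "E u v"
      by (rule conn_setE[OF conn[OF s(1)] h])
    then show ?thesis using s(1) by blast
  next
    case False
    define S1 where "S1 = {s \<in> S. \<phi> s \<subseteq> T}"
    have S1: "s \<in> S1 \<longleftrightarrow> \<phi> s \<inter> T \<noteq> {}" if "s \<in> S" for s
      using False conn_set_nonempty[OF conn[OF that]] that unfolding S1_def by blast
    obtain t where "t \<in> T" using T by blast
    then obtain s where "s \<in> S" "t \<in> \<phi> s" using T by blast
    then have h2: "S1 \<noteq> {}" using S1[of s] \<open>t \<in> T\<close> by blast
    obtain t' where "t' \<in> \<Union>(\<phi> ` S)" "t' \<notin> T" using T by blast
    then have h3: "S1 \<noteq> S" unfolding S1_def by blast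
    have h1: "S1 \<subseteq> S" unfolding S1_def by blast
    obtain u v where uv: "u \<in> S1" "v \<in> S" "v \<notin> S1" "E1 u v" by (rule conn_setE[OF assms(2) h1 h2 h3])
    have "touch E (\<phi> u) (\<phi> v)" using edge[of u v] uv h1 by blast
    then obtain a b where ab: "a \<in> \<phi> u" "b \<in> \<phi> v" "E a b" unfolding touch_def by blast
    have "\<phi> u \<subseteq> T" using uv(1) unfolding S1_def by blast
    moreover have "\<phi> v \<inter> T = {}" using S1[OF uv(2)] uv(3) by blast
    ultimately show ?thesis using ab uv(2) by blast
  qed
qed

lemma touch_blowup:
  assumes "touch E1 A B"
    and edge: "\<And>u v. u \<in> A \<Longrightarrow> v \<in> B \<Longrightarrow> E1 u v \<Longrightarrow> touch E (\<phi> u) (\<phi> v)"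
  shows "touch E (\<Union>(\<phi> ` A)) (\<Union>(\<phi> ` B))"
proof -
  obtain u v where uv: "u \<in> A" "v \<in> B" "E1 u v" using assms(1) unfolding touch_def by blast
  show ?thesis by (rule touch_mono[OF edge[OF uv]]) (use uv in auto)
qed

text \<open>Transitivity of minors: the branch sets \<open>\<phi> v\<close> are united along the
  branch sets of the model in \<open>V1\<close>.\<close>

lemma k5e_minor:
  assumes "symp E" "k5e V1 E1"
    and conn: "\<And>v. v \<in> V1 \<Longrightarrow> conn_set E (\<phi> v)" and sub: "\<And>v. v \<in> V1 \<Longrightarrow> \<phi> v \<subseteq> V"
    and disj: "\<And>v w. v \<in> V1 \<Longrightarrow> w \<in> V1 \<Longrightarrow> v \<noteq> w \<Longrightarrow> \<phi> v \<inter> \<phi> w = {}"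
    and edge: "\<And>u v. u \<in> V1 \<Longrightarrow> v \<in> V1 \<Longrightarrow> E1 u v \<Longrightarrow> touch E (\<phi> u) (\<phi> v)"
  shows "k5e V E"
proof -
  obtain A B C D F where m: "A \<union> B \<union> C \<union> D \<union> F \<subseteq> V1" "k5e_model E1 A B C D F"
    using assms(2) unfolding k5e_def by blast
  have K: "A \<union> B \<union> C \<union> D \<union> F \<subseteq> V1"
    "conn_set E1 A" "conn_set E1 B" "conn_set E1 C" "conn_set E1 D" "conn_set E1 F"
    "A \<inter> B = {}" "A \<inter> C = {}" "A \<inter> D = {}" "A \<inter> F = {}" "B \<inter> C = {}" "B \<inter> D = {}"
    "B \<inter> F = {}" "C \<inter> D = {}" "C \<inter> F = {}" "D \<inter> F = {}"
    "touch E1 A B" "touch E1 A C" "touch E1 B C"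
    "touch E1 D A" "touch E1 D B" "touch E1 D C"
    "touch E1 F A" "touch E1 F B" "touch E1 F C"
    using m unfolding k5e_model_def by simp_all
  let ?U = "\<lambda>S. \<Union>(\<phi> ` S)"
  have s: "A \<subseteq> V1" "B \<subseteq> V1" "C \<subseteq> V1" "D \<subseteq> V1" "F \<subseteq> V1" using K(1) by blast+
  have c: "conn_set E (?U S)" if "conn_set E1 S" "S \<subseteq> V1" for S
    by (rule conn_set_blowup[OF assms(1) that(1)]) (use that(2) conn edge in blast)+
  have d: "?U S \<inter> ?U T = {}" if "S \<inter> T = {}" "S \<subseteq> V1" "T \<subseteq> V1" for S T
    using disj that by blast
  have t: "touch E (?U S) (?U T)" if "touch E1 S T" "S \<subseteq> V1" "T \<subseteq> V1" for S T
    by (rule touch_blowup[OF that(1)]) (use that(2,3) edge in blast)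
  show ?thesis
  proof (rule k5eI[of "?U A" "?U B" "?U C" "?U D" "?U F"])
    show "?U A \<union> ?U B \<union> ?U C \<union> ?U D \<union> ?U F \<subseteq> V" using sub s by blast
  qed (rule c d t; fact K s)+
qed

section \<open>Torsos as minors\<close>

text \<open>Restricted to one side of a separation with separator \<open>K\<close>, this is the
  torso.\<close>

definition add_clique :: "('a \<Rightarrow> 'a \<Rightarrow> bool) \<Rightarrow> 'a set \<Rightarrow> 'a \<Rightarrow> 'a \<Rightarrow> bool" where
  "add_clique E K u v \<longleftrightarrow> E u v \<or> (u \<in> K \<and> v \<in> K \<and> u \<noteq> v)"

lemma symp_add_clique: "symp E \<Longrightarrow> symp (add_clique E K)"
  unfolding symp_def add_clique_def by blast

text \<open>Contracting each \<open>A k\<close> onto \<open>k\<close>, its only vertex in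
  \<open>V1\<close>, realises the torso as a minor; the clique edges come from the contacts between
  the sets \<open>A k\<close>.\<close>

lemma not_k5e_torso:
  assumes "symp E" "\<not> k5e V E" "V1 \<subseteq> V" "K \<subseteq> V1"
    and A: "\<And>k. k \<in> K \<Longrightarrow> conn_set E (A k) \<and> A k \<subseteq> V \<and> A k \<inter> V1 = {k}"
    and AA: "\<And>k l. k \<in> K \<Longrightarrow> l \<in> K \<Longrightarrow> k \<noteq> l \<Longrightarrow> A k \<inter> A l = {} \<and> touch E (A k) (A l)"
  shows "\<not> k5e V1 (add_clique E K)"
proof
  assume k: "k5e V1 (add_clique E K)"
  define \<phi> where "\<phi> v = (if v \<in> K then A v else {v})" for v
  have self: "v \<in> \<phi> v" for v using A[of v] by (auto simp: \<phi>_def)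
  have "k5e V E"
  proof (rule k5e_minor[OF assms(1) k, of \<phi>])
    fix v assume v: "v \<in> V1"
    show "conn_set E (\<phi> v)" using A[of v] by (simp add: \<phi>_def)
    show "\<phi> v \<subseteq> V" using A[of v] v assms(3) by (auto simp: \<phi>_def)
  next
    fix v w assume "v \<in> V1" "w \<in> V1" "v \<noteq> w"
    then show "\<phi> v \<inter> \<phi> w = {}" using A[of v] A[of w] AA[of v w] by (auto simp: \<phi>_def)
  next
    fix u v assume uv: "add_clique E K u v"
    show "touch E (\<phi> u) (\<phi> v)"
    proof (cases "E u v")
      case True then show ?thesis using self unfolding touch_def by blast
    next
      case False
      then show ?thesis using uv AA[of u v] by (auto simp: add_clique_def \<phi>_def)
    qed
  qed
  then show False using assms(2) by blast
qed

lemma not_k5e_torso2: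
  assumes "symp E" "\<not> k5e V E" "V1 \<subseteq> V" "p \<noteq> q" "conn_set E A" "conn_set E B" "A \<subseteq> V" "B \<subseteq> V"
    "A \<inter> V1 = {p}" "B \<inter> V1 = {q}" "A \<inter> B = {}" "touch E A B"
  shows "\<not> k5e V1 (add_clique E {p,q})"
  by (rule not_k5e_torso[OF assms(1-3), of _ "\<lambda>k. if k = p then A else B"])
    (use assms touch_sym[OF assms(1,12)] in auto)

lemma not_k5e_torso3:
  assumes "symp E" "\<not> k5e V E" "V1 \<subseteq> V" "a \<noteq> b" "a \<noteq> c" "b \<noteq> c"
    "conn_set E A" "conn_set E B" "conn_set E C" "A \<subseteq> V" "B \<subseteq> V" "C \<subseteq> V"
    "A \<inter> V1 = {a}" "B \<inter> V1 = {b}" "C \<inter> V1 = {c}" "A \<inter> B = {}" "A \<inter> C = {}" "B \<inter> C = {}"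
    "touch E A B" "touch E A C" "touch E B C"
  shows "\<not> k5e V1 (add_clique E {a,b,c})"
  by (rule not_k5e_torso[OF assms(1-3), of _ "\<lambda>k. if k = a then A else if k = b then B else C"])
    (use assms touch_sym[OF assms(1,19)] touch_sym[OF assms(1,20)] touch_sym[OF assms(1,21)] in auto)

lemma comp_nbrs:
  assumes "is_comp E S W" "S \<subseteq> V"
  shows "nbrs E (V - W) W = nbrs E (V - S) W"
  using is_compD(1,4)[OF assms(1)] unfolding nbrs_def by blast

text \<open>The graph of a minimal counterexample. By \<open>sep\<close>, a contradiction is reached by showing that both
  torsos of a separation of order at most three are minors.\<close>

locale min_k5e_free =
  fixes V :: "'a set" and E :: "'a \<Rightarrow> 'a \<Rightarrow> bool"
  assumes fin: "finite V" and sym: "symp E" and irr: "\<not> E v v" and nok: "\<not> k5e V E"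
    and big: "5 \<le> card V"
    and sep: "\<And>V1 V2. V1 \<union> V2 = V \<Longrightarrow> V1 \<noteq> V \<Longrightarrow> V2 \<noteq> V \<Longrightarrow> card (V1 \<inter> V2) \<le> 3 \<Longrightarrow>
      \<forall>u\<in>V1 - V2. \<forall>v\<in>V2 - V1. \<not> E u v \<Longrightarrow>
      k5e V1 (add_clique E (V1 \<inter> V2)) \<or> k5e V2 (add_clique E (V1 \<inter> V2))"
begin

abbreviation N :: "'a set \<Rightarrow> 'a set" where "N Z \<equiv> nbrs E (V - Z) Z"

lemma Esym: "E u v \<Longrightarrow> E v u"
  using sym by (rule sympD)

text \<open>The form in which \<open>sep\<close> is applied: the separation into
  \<open>Z \<union> N Z\<close> and \<open>V - Z\<close>, which meet in \<open>N Z\<close>.\<close>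

lemma sepN:
  assumes "Z \<subseteq> V" "Z \<noteq> {}" "Z \<union> N Z \<noteq> V" "card (N Z) \<le> 3" "\<not> k5e (Z \<union> N Z) (add_clique E (N Z))"
  shows "k5e (V - Z) (add_clique E (N Z))"
proof -
  have i: "(Z \<union> N Z) \<inter> (V - Z) = N Z" "Z \<union> N Z \<union> (V - Z) = V" using assms(1) unfolding nbrs_def by blast+
  have "V - Z \<noteq> V" using assms(1,2) by blast
  moreover have "\<forall>u\<in>(Z \<union> N Z) - (V - Z). \<forall>v\<in>(V - Z) - (Z \<union> N Z). \<not> E u v" unfolding nbrs_def by blast
  ultimately show ?thesis using sep[OF i(2) assms(3)] assms(4,5) i(1) by auto
qed

lemma finN: "finite (N Z)"
  by (rule finite_subset[OF _ fin]) (auto simp: nbrs_def)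

text \<open>A clique on at most one vertex has no edges, so both torsos are subgraphs.\<close>

lemma card_N_ge2:
  assumes "Z \<subseteq> V" "Z \<noteq> {}" "Z \<union> N Z \<noteq> V"
  shows "2 \<le> card (N Z)"
proof (rule ccontr)
  assume "\<not> ?thesis"
  then have c: "card (N Z) \<le> 1" by simp
  have one: "k = l" if "k \<in> N Z" "l \<in> N Z" for k l
    using c that finN by (metis card_le_Suc0_iff_eq One_nat_def)
  have *: "\<not> k5e V1 (add_clique E (N Z))" if "V1 \<subseteq> V" "N Z \<subseteq> V1" for V1
    by (rule not_k5e_torso[OF sym nok that, of "\<lambda>k. {k}"]) (use one that in auto)
  have "\<not> k5e (Z \<union> N Z) (add_clique E (N Z))" by (rule *) (use assms(1) in \<open>auto simp: nbrs_def\<close>)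
  moreover have "\<not> k5e (V - Z) (add_clique E (N Z))" by (rule *) (auto simp: nbrs_def)
  ultimately show False using sepN[OF assms] c by simp
qed

text \<open>Let the boundary be \<open>{p, q}\<close>. By \<open>card_N_ge2\<close> a component of
  either side sees both \<open>p\<close> and \<open>q\<close>; contracted onto \<open>p\<close>, it
  supplies the edge \<open>pq\<close> of the torso on the opposite side.\<close>

lemma card_N_ge3:
  assumes "Z \<subseteq> V" "Z \<noteq> {}" "Z \<union> N Z \<noteq> V"
  shows "3 \<le> card (N Z)"
proof (rule ccontr)
  assume "\<not> ?thesis"
  then have "card (N Z) = 2" using card_N_ge2[OF assms] by simp
  then obtain p q where pq: "N Z = {p,q}" "p \<noteq> q" by (meson card_2_iff)
  have pV: "p \<in> V - Z" "q \<in> V - Z" using pq(1) nbrs_subset[of E "V - Z" Z] by auto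
  have *: "\<not> k5e V1 (add_clique E {p,q})" if W: "is_comp E S W" "S \<inter> V1 = {}" "S \<subseteq> V"
    and V1: "p \<in> V1" "q \<in> V1" "V1 \<subseteq> V" and NS: "nbrs E (V - S) S \<subseteq> {p,q}" and ne: "\<not> V \<subseteq> S \<union> {p,q}" for S W V1
  proof -
    have Wd: "W \<subseteq> S" "conn_set E W" "W \<noteq> {}" using is_compD[OF W(1)] by auto
    have NW: "N W = nbrs E (V - S) W" by (rule comp_nbrs[OF W(1,3)])
    also have "\<dots> \<subseteq> nbrs E (V - S) S" by (rule nbrs_mono[OF Wd(1)])
    finally have NW: "N W \<subseteq> {p,q}" using NS by simp
    have "W \<subseteq> V" using Wd(1) W(3) by blast
    moreover have "W \<union> N W \<noteq> V" using NW ne Wd(1) by blast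
    ultimately have "2 \<le> card (N W)" using card_N_ge2 Wd(3) by blast
    then have "N W = {p,q}" using NW pq(2) by (metis card_2_iff card_seteq finite.emptyI finite_insert)
    then have "p \<in> N W" "q \<in> N W" by auto
    then have t: "touch E {p} W" "touch E W {q}" unfolding nbrs_def touch_def using Esym by blast+
    show ?thesis
    proof (rule not_k5e_torso2[OF sym nok V1(3) pq(2), of "insert p W" "{q}"])
      show "conn_set E (insert p W)" by (rule conn_set_insert[OF sym Wd(2) t(1)])
      show "touch E (insert p W) {q}" using t(2) unfolding touch_def by blast
    qed (use V1 pq(2) W Wd(1) in auto)
  qed
  have d: "Z \<inter> {p,q} = {}" using pV by auto
  obtain s where "s \<in> V - (Z \<union> N Z)" using assms(1,3) by (auto simp: nbrs_def)
  then obtain W where W: "is_comp E (V - (Z \<union> {p,q})) W" using is_comp_exists[OF sym] pq(1) by metis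
  have "\<not> k5e (Z \<union> {p,q}) (add_clique E {p,q})"
  proof (rule *[OF W])
    have "\<not> E z v" if "z \<in> V - (Z \<union> {p, q})" "v \<in> Z" for z v
      using that pq(1) Esym[of z v] unfolding nbrs_def by blast
    then show "nbrs E (V - (V - (Z \<union> {p, q}))) (V - (Z \<union> {p, q})) \<subseteq> {p, q}" unfolding nbrs_def by blast
    show "\<not> V \<subseteq> V - (Z \<union> {p, q}) \<union> {p, q}" using assms(1,2) d by blast
  qed (use assms(1) pV in auto)
  moreover obtain z where "z \<in> Z" using assms(2) by blast
  then obtain W' where W': "is_comp E Z W'" using is_comp_exists[OF sym] by metis
  have "\<not> k5e (V - Z) (add_clique E {p,q})"
  proof (rule *[OF W'])
    show "N Z \<subseteq> {p,q}" using pq(1) by simp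
    show "\<not> V \<subseteq> Z \<union> {p,q}" using assms(1,3) pq(1) pV by auto
  qed (use assms(1) pV in auto)
  ultimately show False using sepN[OF assms] pq by (simp add: card_insert_if)
qed

lemma degree_ge3: "v \<in> V \<Longrightarrow> 3 \<le> card (N {v})"
proof (cases "{v} \<union> N {v} = V")
  case True
  then have "card V \<le> card {v} + card (N {v})" by (metis card_Un_le)
  then show ?thesis using big by simp
next
  case False
  then show "v \<in> V \<Longrightarrow> ?thesis" using card_N_ge3[of "{v}"] by simp
qed

end

section \<open>Three-vertex cuts and triangles\<close>

lemma conn_split_touch:
  assumes "conn_set E Z" "P \<union> Q = Z" "P \<inter> Q = {}" "P \<noteq> {}" "Q \<noteq> {}"
  shows "touch E P Q"
proof -
  have h: "P \<subseteq> Z" "P \<noteq> {}" "P \<noteq> Z" using assms(2-5) by blast+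
  obtain u v where "u \<in> P" "v \<in> Z" "v \<notin> P" "E u v" by (rule conn_setE[OF assms(1) h])
  then show ?thesis using assms(2) unfolding touch_def by blast
qed

lemma comp_no_nbrs: "is_comp E S W \<Longrightarrow> nbrs E (S - W) W = {}"
  using is_compD(4)[of E S W] unfolding nbrs_def by blast

lemma touch_nbrs: "p \<in> nbrs E L D \<Longrightarrow> touch E D {p}"
  unfolding nbrs_def touch_def by blast

text \<open>The counts force a common element \<open>s\<close>. Later \<open>s\<close> stays a
  single vertex, while \<open>l\<close> and \<open>m\<close> absorb two connected parts that both
  see \<open>s\<close>.\<close>

lemma overlap_choice:
  assumes "A \<union> B = K" "card K = 3" "2 \<le> card A" "2 \<le> card B"
  obtains s l m where "s \<in> A" "s \<in> B" "l \<in> A" "m \<in> B" "s \<noteq> l" "s \<noteq> m" "l \<noteq> m" "K = {s, l, m}"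
proof -
  have fin: "finite A" "finite B" "finite K" using assms by (metis card.infinite finite_Un zero_neq_numeral)+
  have "card A + card B = card K + card (A \<inter> B)" using card_Un_Int[OF fin(1,2)] assms(1) by simp
  then have "A \<inter> B \<noteq> {}" using assms by auto
  then obtain s where s: "s \<in> A" "s \<in> B" by blast
  have "card (K - {s}) = 2" using assms s fin by auto
  then obtain u v where uv: "K - {s} = {u,v}" "u \<noteq> v" by (meson card_2_iff)
  have "A \<noteq> {s}" "B \<noteq> {s}" using assms by auto
  then obtain u' v' where u': "u' \<in> A" "u' \<noteq> s" "v' \<in> B" "v' \<noteq> s" using s by blast
  have K: "K = {s,u,v}" "s \<noteq> u" "s \<noteq> v" using uv s assms(1) by blast+
  show ?thesis
  proof (cases "u \<in> A \<and> v \<in> B")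
    case True
    then show ?thesis using that[of s u v] s K uv by simp
  next
    case False
    then have "v \<in> A \<and> u \<in> B" using u' K assms(1) uv(2) by blast
    moreover have "K = {s,v,u}" using K by blast
    ultimately show ?thesis using that[of s v u] s K(2,3) uv(2) by simp
  qed
qed

context min_k5e_free
begin

text \<open>The boundary of \<open>Y\<close> has at least three vertices by
  \<open>card_N_ge3\<close>, and all of them except possibly \<open>x\<close> lie in
  \<open>N Z\<close>.\<close>

lemma lab_card_ge2:
  assumes "Z \<subseteq> V" "Y \<subseteq> Z" "Y \<noteq> {}" "nbrs E (Z - Y) Y \<subseteq> {x}" "Y \<union> N Y \<noteq> V"
  shows "2 \<le> card (nbrs E (N Z) Y)"
proof -
  have "N Y \<subseteq> nbrs E (V - Z) Y \<union> nbrs E (Z - Y) Y" unfolding nbrs_def by blast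
  moreover have "nbrs E (V - Z) Y \<subseteq> nbrs E (N Z) Y" using assms(2) unfolding nbrs_def by blast
  ultimately have "N Y \<subseteq> insert x (nbrs E (N Z) Y)" using assms(4) by blast
  moreover have fL: "finite (nbrs E (N Z) Y)" by (rule finite_subset[OF nbrs_subset finN])
  ultimately have "card (N Y) \<le> card (insert x (nbrs E (N Z) Y))" by (intro card_mono) auto
  also have "\<dots> \<le> Suc (card (nbrs E (N Z) Y))" using fL by (simp add: card_insert_if)
  finally have "card (N Y) \<le> Suc (card (nbrs E (N Z) Y))" .
  moreover have "3 \<le> card (N Y)" using card_N_ge3[of Y] assms(1-3,5) by blast
  ultimately show ?thesis by simp
qed

text \<open>\<open>P\<close> is contracted onto \<open>l\<close> and \<open>Q\<close> onto
  \<open>m\<close>, with \<open>s\<close>, \<open>l\<close>, \<open>m\<close> from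
  \<open>overlap_choice\<close>: both parts see \<open>s\<close>, and they touch because
  \<open>Z\<close> is connected.\<close>

lemma torso_of_split:
  assumes Z: "Z \<subseteq> V" "conn_set E Z" "card (N Z) = 3"
    and PQ: "P \<union> Q = Z" "P \<inter> Q = {}" "conn_set E P" "conn_set E Q"
    and lab: "2 \<le> card (nbrs E (N Z) P)" "2 \<le> card (nbrs E (N Z) Q)"
  shows "\<not> k5e (V - Z) (add_clique E (N Z))"
proof -
  have "nbrs E (N Z) P \<union> nbrs E (N Z) Q = N Z" using PQ(1) unfolding nbrs_def by blast
  then obtain s l m where s: "s \<in> nbrs E (N Z) P" "s \<in> nbrs E (N Z) Q" "l \<in> nbrs E (N Z) P" "m \<in> nbrs E (N Z) Q"
    "s \<noteq> l" "s \<noteq> m" "l \<noteq> m" "N Z = {s,l,m}" using overlap_choice[OF _ Z(3) lab] by metis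
  have t: "touch E P {s}" "touch E Q {s}" "touch E P {l}" "touch E Q {m}" using touch_nbrs s(1-4) by metis+
  have tPQ: "touch E P Q" by (rule conn_split_touch[OF Z(2) PQ(1,2) conn_set_nonempty[OF PQ(3)] conn_set_nonempty[OF PQ(4)]])
  have out: "s \<in> V - Z" "l \<in> V - Z" "m \<in> V - Z" using s(8) nbrs_subset[of E "V - Z" Z] by auto
  have subs: "P \<subseteq> Z" "Q \<subseteq> Z" using PQ(1) by auto
  have "\<not> k5e (V - Z) (add_clique E {s,l,m})"
  proof (rule not_k5e_torso3[OF sym nok _ s(5-7), of _ "{s}" "insert l P" "insert m Q"])
    show "conn_set E (insert l P)" by (rule conn_set_insert[OF sym PQ(3) touch_sym[OF sym t(3)]])
    show "conn_set E (insert m Q)" by (rule conn_set_insert[OF sym PQ(4) touch_sym[OF sym t(4)]])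
    show "touch E {s} (insert l P)" using touch_sym[OF sym t(1)] unfolding touch_def by blast
    show "touch E {s} (insert m Q)" using touch_sym[OF sym t(2)] unfolding touch_def by blast
    show "touch E (insert l P) (insert m Q)" using tPQ unfolding touch_def by blast
    show "insert l P \<inter> insert m Q = {}" using PQ(2) subs out s(5-7) by auto
  qed (use out subs Z(1) s(5-7) in auto)
  then show ?thesis using s(8) by simp
qed

lemma nbrs_outside_comp:
  assumes "is_comp E (Z - {x}) Y"
  shows "nbrs E (Z - Y) Y \<subseteq> {x}"
  using is_compD(1,4)[OF assms] unfolding nbrs_def by blast

text \<open>In other words, \<open>Z\<close> can be contracted onto \<open>N Z\<close> so that \<open>N Z\<close> becomes a triangle.\<close>

lemma rooted_triangle:
  assumes Z: "Z \<subseteq> V" "conn_set E Z" "card (N Z) = 3" "Z \<union> N Z \<noteq> V" "2 \<le> card Z"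
  shows "\<not> k5e (V - Z) (add_clique E (N Z))"
proof (rule ccontr)
  assume neg: "\<not> ?thesis"
  let ?L = "nbrs E (N Z)"
  have finZ: "finite Z" using Z(1) fin finite_subset by blast
  have finL: "finite (?L D)" for D by (rule finite_subset[OF nbrs_subset finN])
  \<comment> \<open>\<open>neg\<close> excludes every partition of \<open>Z\<close> into two
    connected parts with two attachments each. This will make \<open>Z\<close> 2-connected and leave
    at most one attachment to each vertex.\<close>
  have no: "\<not> (2 \<le> card (?L P) \<and> 2 \<le> card (?L Q))"
    if "P \<union> Q = Z" "P \<inter> Q = {}" "conn_set E P" "conn_set E Q" for P Q
    using torso_of_split[OF Z(1-3) that] neg by blast
  obtain w where w: "w \<in> V" "w \<notin> Z" "w \<notin> N Z" using Z(1,4) by (auto simp: nbrs_def)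
  have ge2: "2 \<le> card (?L Y)" if "Y \<subseteq> Z" "Y \<noteq> {}" "nbrs E (Z - Y) Y \<subseteq> {x}" for Y x
  proof (rule lab_card_ge2[OF Z(1) that])
    have "w \<notin> Y \<union> N Y" using w that(1) unfolding nbrs_def by blast
    then show "Y \<union> N Y \<noteq> V" using w(1) by blast
  qed
  have ne: "Z - {x} \<noteq> {}" for x
    using Z(5) finZ by (metis Diff_eq_empty_iff card_mono card.empty card_insert_le_m1 finite.emptyI finite_insert is_singletonI is_singleton_altdef le_trans not_less_eq_eq numeral_2_eq_2 One_nat_def)
  have conn: "conn_set E (Z - {x})" if x: "x \<in> Z" for x
  proof (rule ccontr)
    assume "\<not> ?thesis"
    then obtain Y1 Y2 where Y: "is_comp E (Z - {x}) Y1" "is_comp E (Z - {x}) Y2" "Y1 \<inter> Y2 = {}"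
      using two_comps[OF sym ne] by metis
    have Q: "conn_set E (Z - Y1)" by (rule conn_set_minus_comp[OF sym Z(2) _ _ Y(1)]) (use x in auto)
    have s: "Y1 \<subseteq> Z" "Y2 \<subseteq> Z - Y1" "Y2 \<subseteq> Z" using is_compD(1)[OF Y(1)] is_compD(1)[OF Y(2)] Y(3) by blast+
    have "2 \<le> card (?L Y1)" by (rule ge2[OF s(1) is_compD(3)[OF Y(1)] nbrs_outside_comp[OF Y(1)]])
    moreover have "2 \<le> card (?L Y2)" by (rule ge2[OF s(3) is_compD(3)[OF Y(2)] nbrs_outside_comp[OF Y(2)]])
    then have "2 \<le> card (?L (Z - Y1))" using card_mono[OF finL nbrs_mono[OF s(2)]] by (rule order_trans)
    moreover have "Y1 \<union> (Z - Y1) = Z" "Y1 \<inter> (Z - Y1) = {}" using s(1) by auto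
    ultimately show False using no[OF _ _ is_compD(2)[OF Y(1)] Q] by blast
  qed
  have rest: "2 \<le> card (?L (Z - {x}))" if "x \<in> Z" for x
    by (rule ge2[OF _ ne, of _ x]) (auto simp: nbrs_def)
  have single: "\<not> 2 \<le> card (?L {x})" if "x \<in> Z" for x
  proof -
    have "{x} \<union> (Z - {x}) = Z" using that by blast
    then show ?thesis using no[of "{x}" "Z - {x}"] conn[OF that] rest[OF that] by auto
  qed
  have mono: "2 \<le> card (?L A) \<Longrightarrow> A \<subseteq> B \<Longrightarrow> 2 \<le> card (?L B)" for A B
    using card_mono[OF finL nbrs_mono, of A B] by (meson order_trans)
  obtain x0 where x0: "x0 \<in> Z" using conn_set_nonempty[OF Z(2)] by blast
  obtain D y z where D: "D \<subseteq> Z" "D \<noteq> Z" "conn_set E D" "conn_set E (Z - D)" "2 \<le> card (?L D)"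
    "y \<in> D" "z \<in> D" "y \<noteq> z" "touch E {y} (Z - D)" "touch E {z} (Z - D)"
    "conn_set E (D - {y})" "conn_set E (D - {z})" "\<not> 2 \<le> card (?L (D - {y}))" "\<not> 2 \<le> card (?L (D - {z}))"
    by (rule minimal_split[OF finZ sym conn mono x0 rest[OF x0] single])
  have uD: "?L D = ?L (D - {y}) \<union> ?L {y}" "?L D = ?L (D - {z}) \<union> ?L {z}"
    using D(6,7) unfolding nbrs_def by blast+
  have zs: "?L {z} \<subseteq> ?L (D - {y})" using D(7,8) unfolding nbrs_def by blast
  have le: "card (?L D) \<le> card (?L (D - {y})) + card (?L {y})" "card (?L D) \<le> card (?L (D - {z})) + card (?L {z})"
    using uD card_Un_le by metis+
  have y1: "y \<in> Z" "z \<in> Z" using D(1,6,7) by auto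
  \<comment> \<open>\<open>D\<close> drops below two attachments when \<open>y\<close> or
    \<open>z\<close> leaves, and no vertex has more than one. So \<open>D\<close> has exactly two:
    \<open>p\<close>, seen only from \<open>y\<close>, and \<open>q\<close>, seen from
    \<open>z\<close>. The third root \<open>r\<close> is seen from \<open>Z - D\<close>, and
    \<open>{y}\<close>, \<open>D - {y}\<close> and \<open>Z - D\<close> are contracted onto
    \<open>p\<close>, \<open>q\<close> and \<open>r\<close>.\<close>
  have cards: "card (?L (D - {y})) = 1" "card (?L {y}) = 1" "card (?L {z}) = 1" "card (?L D) = 2"
    using le D(5,13,14) single[OF y1(1)] single[OF y1(2)] by linarith+
  obtain p q where pq: "?L {y} = {p}" "?L (D - {y}) = {q}" using cards by (metis card_1_singletonE)
  then have "?L {z} = {q}" using zs cards(3) by (metis card_1_singletonE singleton_insert_inj_eq subset_singletonD insert_not_empty)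
  have LD: "?L D = {p,q}" using uD(1) pq by auto
  then have npq: "p \<noteq> q" using cards(4) by auto
  have K: "N Z = ?L D \<union> ?L (Z - D)" using D(1) unfolding nbrs_def by blast
  have "?L (Z - D) - {p,q} \<noteq> {}"
  proof
    assume "?L (Z - D) - {p,q} = {}"
    then have "N Z = ?L D" using K LD by blast
    then show False using Z(3) cards(4) by simp
  qed
  then obtain r where r: "r \<in> ?L (Z - D)" "r \<noteq> p" "r \<noteq> q" by blast
  have KK: "N Z = {p,q,r}"
  proof (rule card_seteq[OF finN, symmetric])
    show "{p,q,r} \<subseteq> N Z" using LD r(1) K by auto
    show "card (N Z) \<le> card {p,q,r}" using Z(3) npq r(2,3) by simp
  qed
  have out: "p \<in> V - Z" "q \<in> V - Z" "r \<in> V - Z" using KK nbrs_subset[of E "V - Z" Z] by auto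
  have t: "touch E {y} {p}" "touch E (D - {y}) {q}" "touch E (Z - D) {r}" using touch_nbrs pq r(1) by (metis singletonI)+
  have tyD: "touch E {y} (D - {y})"
    by (rule conn_split_touch[OF D(3)]) (use D(6,7,8) in auto)
  have "\<not> k5e (V - Z) (add_clique E {p,q,r})"
  proof (rule not_k5e_torso3[OF sym nok _ npq, of _ r "{p,y}" "insert q (D - {y})" "insert r (Z - D)"])
    show "conn_set E {p,y}" by (rule conn_set_insert[OF sym conn_set_singleton touch_sym[OF sym t(1)]])
    show "conn_set E (insert q (D - {y}))" by (rule conn_set_insert[OF sym D(11) touch_sym[OF sym t(2)]])
    show "conn_set E (insert r (Z - D))" by (rule conn_set_insert[OF sym D(4) touch_sym[OF sym t(3)]])
    show "touch E {p,y} (insert q (D - {y}))" using tyD unfolding touch_def by blast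
    show "touch E {p,y} (insert r (Z - D))" using D(9) unfolding touch_def by blast
    show "touch E (insert q (D - {y})) (insert r (Z - D))" using D(7,8,10) unfolding touch_def by blast
  qed (use out D(1,6,7) Z(1) r(2,3) npq in auto)
  then show False using neg KK by simp
qed

text \<open>Contracting \<open>Z\<close> as in \<open>rooted_triangle\<close> yields one torso. For
  the other, the rest of the graph is contracted in the same way if it is connected; otherwise two
  of its components, each of which sees all of \<open>N Z\<close>, are contracted onto two of these
  vertices.\<close>

lemma no_big_cut:
  assumes Z: "Z \<subseteq> V" "conn_set E Z" "card (N Z) = 3" "2 \<le> card Z" "2 \<le> card (V - Z - N Z)"
  shows False
proof -
  let ?K = "N Z" and ?R = "V - Z - N Z"
  have KV: "?K \<subseteq> V - Z" by (rule nbrs_subset)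
  have Zne: "Z \<noteq> {}" by (rule conn_set_nonempty[OF Z(2)])
  have Rne: "?R \<noteq> {}" using Z(5) by (metis card.empty not_numeral_le_zero)
  then have ZK: "Z \<union> ?K \<noteq> V" by blast
  have VR: "V - ?R = Z \<union> ?K" using Z(1) KV by blast
  have NW: "N W = ?K" if "W \<subseteq> ?R" "W \<noteq> {}" "nbrs E (?R - W) W = {}" for W
  proof (rule card_seteq[OF finN])
    have "\<not> E w z" if "w \<in> ?R" "z \<in> Z" for w z using that Esym[of w z] unfolding nbrs_def by blast
    then show s: "N W \<subseteq> ?K" using that(1,3) unfolding nbrs_def by blast
    have "W \<union> N W \<noteq> V" using s that(1) KV Zne Z(1) by blast
    then show "card ?K \<le> card (N W)" using card_N_ge3[of W] that(1,2) Z(3) by auto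
  qed
  have "\<not> k5e (Z \<union> ?K) (add_clique E ?K)"
  proof (cases "conn_set E ?R")
    case True
    have NR: "N ?R = ?K" by (rule NW[OF order_refl Rne]) (auto simp: nbrs_def)
    have "?R \<union> N ?R \<noteq> V" using NR KV Z(1) Zne by auto
    then have "\<not> k5e (V - ?R) (add_clique E (N ?R))"
      using rooted_triangle[of ?R] True NR Z(3,5) by auto
    then show ?thesis using NR VR by simp
  next
    case False
    then obtain W1 W2 where W: "is_comp E ?R W1" "is_comp E ?R W2" "W1 \<inter> W2 = {}"
      using two_comps[OF sym Rne] by metis
    have N12: "N W1 = ?K" "N W2 = ?K"
      by (rule NW[OF is_compD(1,3)[OF W(1)] comp_no_nbrs[OF W(1)]])
        (rule NW[OF is_compD(1,3)[OF W(2)] comp_no_nbrs[OF W(2)]])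
    obtain a b c where abc: "?K = {a,b,c}" "a \<noteq> b" "a \<noteq> c" "b \<noteq> c" using Z(3) by (metis card_3_iff)
    have "touch E W1 {a}" "touch E W1 {b}" "touch E W1 {c}" "touch E W2 {b}" "touch E W2 {c}"
      using touch_nbrs[of _ E "V - W1" W1] touch_nbrs[of _ E "V - W2" W2] N12 abc(1) by auto
    note t = this
    have s: "W1 \<subseteq> V" "W2 \<subseteq> V" "W1 \<inter> (Z \<union> {a,b,c}) = {}" "W2 \<inter> (Z \<union> {a,b,c}) = {}"
      using is_compD(1)[OF W(1)] is_compD(1)[OF W(2)] abc(1) by auto
    have abcV: "a \<in> V" "b \<in> V" "c \<in> V" "a \<notin> Z" "b \<notin> Z" "c \<notin> Z" using abc(1) KV by auto
    have "\<not> k5e (Z \<union> {a,b,c}) (add_clique E {a,b,c})"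
    proof (rule not_k5e_torso3[OF sym nok _ abc(2-4), of _ "insert a W1" "insert b W2" "{c}"])
      show "conn_set E (insert a W1)" by (rule conn_set_insert[OF sym is_compD(2)[OF W(1)] touch_sym[OF sym t(1)]])
      show "conn_set E (insert b W2)" by (rule conn_set_insert[OF sym is_compD(2)[OF W(2)] touch_sym[OF sym t(4)]])
      show "touch E (insert a W1) (insert b W2)" using t(2) unfolding touch_def by blast
      show "touch E (insert a W1) {c}" using t(3) unfolding touch_def by blast
      show "touch E (insert b W2) {c}" using t(5) unfolding touch_def by blast
    qed (use s abcV abc(2-4) Z(1) W(3) in auto)
    then show ?thesis using abc(1) by simp
  qed
  moreover have "\<not> k5e (V - Z) (add_clique E ?K)" by (rule rooted_triangle[OF Z(1-3) ZK Z(4)])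
  ultimately show False using sepN[OF Z(1) Zne ZK] Z(3) by simp
qed

text \<open>For a vertex \<open>x\<close> outside the triangle, a component of the rest of the graph without \<open>x\<close>
  which misses a vertex of the triangle would be cut off by \<open>x\<close> and the two other vertices.\<close>

lemma no_triangle:
  assumes abc: "a \<in> V" "b \<in> V" "c \<in> V" "E a b" "E a c" "E b c"
  shows False
proof -
  have d: "a \<noteq> b" "a \<noteq> c" "b \<noteq> c" using abc irr by auto
  define K where "K = {a,b,c}"
  define X where "X = V - K"
  have finK: "finite K" "card K = 3" "K \<subseteq> V" using abc d by (auto simp: K_def)
  have adjK: "E p q" if "p \<in> K" "q \<in> K" "p \<noteq> q" for p q
    using that abc Esym unfolding K_def by blast
  have finX: "finite X" "X \<subseteq> V" using fin by (auto simp: X_def)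
  have cX: "2 \<le> card X" unfolding X_def using card_Diff_subset[OF finK(1,3)] finK(2) big by simp
  then have Xne: "X \<noteq> {}" by auto
  let ?L = "nbrs E K"
  have LN: "?L Y = K" if "Y \<subseteq> X" "Y \<noteq> {}" "nbrs E (X - Y) Y = {}" for Y
  proof (rule ccontr)
    assume n: "?L Y \<noteq> K"
    have NY: "N Y = ?L Y" using that(1,3) finK(3) unfolding nbrs_def X_def by blast
    have s: "?L Y \<subseteq> K" by (rule nbrs_subset)
    then have "card (?L Y) < 3" using n psubset_card_mono[OF finK(1)] finK(2) by (metis psubsetI)
    moreover have "Y \<union> N Y \<noteq> V" using NY n s that(1) finK(3) unfolding X_def by blast
    then have "3 \<le> card (N Y)" using card_N_ge3[of Y] that(1,2) finX(2) by blast
    ultimately show False using NY by simp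
  qed
  \<comment> \<open>The three vertices of the triangle and two such sets are the branch sets of a
    model.\<close>
  have two: "False" if Y: "Y1 \<subseteq> X" "Y2 \<subseteq> X" "Y1 \<inter> Y2 = {}" "conn_set E Y1" "conn_set E Y2" "?L Y1 = K" "?L Y2 = K" for Y1 Y2
  proof -
    have t: "touch E Y1 {a}" "touch E Y1 {b}" "touch E Y1 {c}" "touch E Y2 {a}" "touch E Y2 {b}" "touch E Y2 {c}"
      using touch_nbrs[of _ E K Y1] touch_nbrs[of _ E K Y2] Y(6,7) by (auto simp: K_def)
    have "k5e V E"
      by (rule k5eI[of "{a}" "{b}" "{c}" Y1 Y2]) (use t Y abc d in \<open>auto simp: X_def K_def touch_def\<close>)
    then show False using nok by blast
  qed
  have connX: "conn_set E X"
  proof (rule ccontr)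
    assume "\<not> ?thesis"
    then obtain Y1 Y2 where Y: "is_comp E X Y1" "is_comp E X Y2" "Y1 \<inter> Y2 = {}" using two_comps[OF sym Xne] by metis
    have "?L Y1 = K" by (rule LN[OF is_compD(1,3)[OF Y(1)] comp_no_nbrs[OF Y(1)]])
    moreover have "?L Y2 = K" by (rule LN[OF is_compD(1,3)[OF Y(2)] comp_no_nbrs[OF Y(2)]])
    ultimately show False
      using two[OF is_compD(1)[OF Y(1)] is_compD(1)[OF Y(2)] Y(3) is_compD(2)[OF Y(1)] is_compD(2)[OF Y(2)]] by blast
  qed
  have LX: "?L X = K" by (rule LN[OF order_refl Xne]) (auto simp: nbrs_def)
  have VX: "V - X = K" using finK(3) by (auto simp: X_def)
  have NX: "N X = K" using LX VX by simp
  \<comment> \<open>\<open>p\<close>, \<open>q\<close> and \<open>D1\<close> become the triangle of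
    the model; \<open>r\<close> and \<open>D2\<close> become the non-adjacent pair.\<close>
  have rule: "False" if D: "D1 \<subseteq> X" "D2 \<subseteq> X" "D1 \<inter> D2 = {}" "conn_set E D1" "conn_set E D2" "touch E D1 D2"
    "?L D1 = K" "2 \<le> card (?L D2)" for D1 D2
  proof -
    obtain p q where pq: "p \<in> ?L D2" "q \<in> ?L D2" "p \<noteq> q"
      using D(8) by (meson card_2_iff' ex_card subsetD)
    have pK: "p \<in> K" "q \<in> K" using pq nbrs_subset[of E K D2] by blast+
    have "card (K - {p,q}) = 1" using finK(1,2) pK pq(3) by (simp add: card_Diff_subset)
    then obtain r where r: "K - {p,q} = {r}" by (meson card_1_singletonE)
    then have rK: "r \<in> K" "r \<noteq> p" "r \<noteq> q" by auto
    have t: "touch E D1 {p}" "touch E D1 {q}" "touch E D1 {r}" "touch E D2 {p}" "touch E D2 {q}"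
      using touch_nbrs[of _ E K D1] touch_nbrs[of _ E K D2] D(7) pq pK rK by auto
    have e: "E p q" "E r p" "E r q" using adjK pK rK pq(3) by auto
    have pV: "p \<in> V" "q \<in> V" "r \<in> V" "p \<notin> X" "q \<notin> X" "r \<notin> X" using pK rK finK(3) by (auto simp: X_def)
    have "k5e V E"
    proof (rule k5eI[of "{p}" "{q}" D1 "{r}" D2])
      show "touch E {p} D1" "touch E {q} D1" "touch E {r} D1" "touch E D2 D1"
        using t D(6) touch_sym[OF sym] by blast+
    qed (use e t D pV pq(3) rK finX(2) in \<open>auto simp: touch_def\<close>)
    then show False using nok by blast
  qed
  have compL: "?L Y = K" if x: "x \<in> X" and Y: "is_comp E (X - {x}) Y" for x Y
  proof (rule ccontr)
    assume n: "?L Y \<noteq> K"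
    have Yd: "Y \<subseteq> X" "x \<notin> Y" "Y \<noteq> {}" "conn_set E Y" using is_compD(1-3)[OF Y] by auto
    have NY: "N Y \<subseteq> insert x (?L Y)" using nbrs_outside_comp[OF Y] Yd(1) finK(3) unfolding nbrs_def X_def by blast
    obtain r where r: "r \<in> K" "r \<notin> ?L Y" using n nbrs_subset[of E K Y] by blast
    have "?L Y \<subseteq> K - {r}" using r nbrs_subset[of E K Y] by blast
    have cK: "card (K - {r}) = 2" using finK r by simp
    then obtain p q where pq: "K - {r} = {p,q}" "p \<noteq> q" by (meson card_2_iff)
    have sub: "N Y \<subseteq> {x,p,q}" using NY \<open>?L Y \<subseteq> K - {r}\<close> pq(1) by blast
    have xV: "x \<in> V" "x \<notin> K" using x by (auto simp: X_def)
    have pK: "p \<in> K" "q \<in> K" "r \<noteq> p" "r \<noteq> q" "p \<in> V" "q \<in> V" "r \<in> V" using pq r finK(3) by auto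
    have xd: "x \<noteq> p" "x \<noteq> q" "x \<noteq> r" using xV pK r by auto
    have rX: "r \<notin> X" "p \<notin> X" "q \<notin> X" using r pK by (auto simp: X_def)
    have rnot: "r \<notin> Y \<union> N Y" using sub rX Yd(1) xd pK by auto
    then have ne: "Y \<union> N Y \<noteq> V" using pK by blast
    have YV: "Y \<subseteq> V" using Yd(1) finX(2) by blast
    have NYe: "N Y = {x,p,q}"
      by (rule card_seteq[OF _ sub]) (use card_N_ge3[OF YV Yd(3) ne] xd pq(2) in auto)
    have tY: "touch E Y {x}" "touch E Y {p}" "touch E Y {q}" using touch_nbrs[of _ E "V - Y" Y] NYe by auto
    have epq: "E p q" "E r p" "E r q" using adjK pK r(1) pq(2) by auto
    have "\<not> k5e (V - Y) (add_clique E {x,p,q})"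
    proof (rule not_k5e_torso3[OF sym nok _ xd(1,2) pq(2), of _ "insert x Y" "{p}" "{q}"])
      show "conn_set E (insert x Y)" by (rule conn_set_insert[OF sym Yd(4) touch_sym[OF sym tY(1)]])
      show "touch E (insert x Y) {p}" "touch E (insert x Y) {q}" using tY unfolding touch_def by blast+
      show "touch E {p} {q}" using epq unfolding touch_def by blast
    qed (use xd pK xV Yd YV rX pq(2) in auto)
    \<comment> \<open>Above, \<open>Y\<close> was contracted onto \<open>x\<close>. Here the rest of
      \<open>X\<close> is contracted onto \<open>x\<close> together with \<open>r\<close>, which is
      adjacent to \<open>p\<close> and \<open>q\<close>.\<close>
    moreover have "\<not> k5e (Y \<union> {x,p,q}) (add_clique E {x,p,q})"
    proof (rule not_k5e_torso3[OF sym nok _ xd(1,2) pq(2), of _ "insert r (X - Y)" "{p}" "{q}"])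
      have cXY: "conn_set E (X - Y)" by (rule conn_set_minus_comp[OF sym connX _ _ Y]) (use x in auto)
      have "r \<in> ?L (X - Y)" using r LX unfolding nbrs_def by blast
      then show "conn_set E (insert r (X - Y))" using conn_set_insert[OF sym cXY] touch_sym[OF sym] touch_nbrs by metis
      show "touch E (insert r (X - Y)) {p}" "touch E (insert r (X - Y)) {q}" "touch E {p} {q}"
        using epq unfolding touch_def by blast+
    qed (use xd pK xV Yd YV rX pq(2) x finX(2) in auto)
    moreover have "card {x,p,q} \<le> 3" by (simp add: card_insert_if)
    ultimately show False using sepN[OF YV Yd(3) ne] NYe by simp
  qed
  have ne1: "X - {x} \<noteq> {}" for x
  proof
    assume "X - {x} = {}"
    then have "card X \<le> card {x}" by (intro card_mono) auto
    then show False using cX by simp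
  qed
  have conn: "conn_set E (X - {x})" if x: "x \<in> X" for x
  proof (rule ccontr)
    assume "\<not> ?thesis"
    then obtain Y1 Y2 where Y: "is_comp E (X - {x}) Y1" "is_comp E (X - {x}) Y2" "Y1 \<inter> Y2 = {}"
      using two_comps[OF sym ne1] by metis
    show False
      by (rule two[OF _ _ Y(3) is_compD(2)[OF Y(1)] is_compD(2)[OF Y(2)] compL[OF x Y(1)] compL[OF x Y(2)]])
        (use is_compD(1)[OF Y(1)] is_compD(1)[OF Y(2)] in auto)
  qed
  have rest: "?L (X - {x}) = K" if x: "x \<in> X" for x
    by (rule compL[OF x]) (use conn[OF x] in \<open>simp add: is_comp_def\<close>)
  have single: "\<not> 2 \<le> card (?L {x})" if x: "x \<in> X" for x
  proof
    assume "2 \<le> card (?L {x})"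
    moreover have "touch E (X - {x}) {x}" by (rule conn_split_touch[OF connX]) (use x ne1 in auto)
    ultimately show False using rule[of "X - {x}" "{x}"] conn[OF x] rest[OF x] x by auto
  qed
  have single3: "\<not> K \<subseteq> ?L {x}" if x: "x \<in> X" for x
  proof
    assume "K \<subseteq> ?L {x}"
    then have "card K \<le> card (?L {x})" by (rule card_mono[rotated]) (rule finite_subset[OF nbrs_subset finK(1)])
    then show False using single[OF x] finK(2) by simp
  qed
  have mono: "K \<subseteq> ?L A \<Longrightarrow> A \<subseteq> B \<Longrightarrow> K \<subseteq> ?L B" for A B
    using nbrs_mono[of A B E K] by blast
  obtain x0 where x0: "x0 \<in> X" using Xne by blast
  have r0: "K \<subseteq> ?L (X - {x0})" using rest[OF x0] by simp
  obtain D y z where D: "D \<subseteq> X" "D \<noteq> X" "conn_set E D" "conn_set E (X - D)" "K \<subseteq> ?L D"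
    "y \<in> D" "z \<in> D" "y \<noteq> z" "touch E {y} (X - D)" "touch E {z} (X - D)"
    "conn_set E (D - {y})" "conn_set E (D - {z})" "\<not> K \<subseteq> ?L (D - {y})" "\<not> K \<subseteq> ?L (D - {z})"
    by (rule minimal_split[OF finX(1) sym conn mono x0 r0 single3])
  \<comment> \<open>Within \<open>D\<close> only \<open>y\<close> sees \<open>p\<close> and only
    \<open>z\<close> sees \<open>q\<close>, whence \<open>p \<noteq> q\<close>. Since
    \<open>X\<close> minus any one vertex still sees all of \<open>K\<close>, both \<open>p\<close>
    and \<open>q\<close> are seen from \<open>X - D\<close>, and \<open>rule\<close> applies to
    \<open>D\<close> and \<open>X - D\<close>.\<close>
  obtain p where p: "p \<in> K" "p \<notin> ?L (D - {y})" using D(13) by blast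
  obtain q where q: "q \<in> K" "q \<notin> ?L (D - {z})" using D(14) by blast
  have "p \<in> ?L D" "q \<in> ?L D" using p(1) q(1) D(5) by auto
  then have pq: "E y p" "E z q" using p q unfolding nbrs_def by blast+
  have "p \<noteq> q"
  proof
    assume "p = q"
    then show False using p q pq D(6,7,8) unfolding nbrs_def by blast
  qed
  have yX: "y \<in> X" "z \<in> X" using D(1,6,7) by auto
  have "p \<in> ?L (X - {y})" "q \<in> ?L (X - {z})" using rest yX p(1) q(1) by auto
  then have "p \<in> ?L (X - D)" "q \<in> ?L (X - D)" using p q unfolding nbrs_def by blast+
  then have "card {p,q} \<le> card (?L (X - D))"
    by (intro card_mono) (auto intro: finite_subset[OF nbrs_subset finK(1)])
  then have "2 \<le> card (?L (X - D))" using \<open>p \<noteq> q\<close> by simp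
  moreover have "touch E D (X - D)" using D(9,6) unfolding touch_def by blast
  ultimately show False
    using rule[OF D(1) _ _ D(3,4)] D(5) nbrs_subset[of E K D] by blast
qed

end

section \<open>A nonseparating cycle\<close>

definition cyc :: "('a \<Rightarrow> 'a \<Rightarrow> bool) \<Rightarrow> 'a list \<Rightarrow> bool" where
  "cyc E xs \<longleftrightarrow> 3 \<le> length xs \<and> distinct xs \<and> successively E xs \<and> E (last xs) (hd xs)"

lemma cyc_rotate:
  assumes "cyc E (xs @ ys)"
  shows "cyc E (ys @ xs)"
proof (cases "xs = [] \<or> ys = []")
  case True then show ?thesis using assms by auto
next
  case False
  then show ?thesis using assms by (auto simp: cyc_def successively_append_iff)
qed

lemma successively_upto: "successively E (us @ v # ws) \<Longrightarrow> successively E (us @ [v])"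
  by (simp add: successively_append_iff)

lemma conn_set_path:
  assumes "symp E" "successively E xs" "xs \<noteq> []"
  shows "conn_set E (set xs)"
  using assms(2,3)
proof (induction xs rule: induct_list012)
  case (3 x y zs)
  have "conn_set E (set (y # zs))" using 3 by simp
  moreover have "touch E {x} (set (y # zs))" using 3 by (auto simp: touch_def)
  ultimately have "conn_set E (insert x (set (y # zs)))" by (rule conn_set_insert[OF assms(1)])
  then show ?case by simp
qed auto

lemma conn_path:
  assumes "conn_set E S" "a \<in> S" "b \<in> S"
  obtains xs where "xs \<noteq> []" "distinct xs" "successively E xs" "set xs \<subseteq> S" "hd xs = a" "last xs = b"
proof -
  define P where "P v xs \<longleftrightarrow> xs \<noteq> [] \<and> distinct xs \<and> successively E xs \<and> set xs \<subseteq> S \<and> hd xs = a \<and> last xs = v" for v xs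
  define A where "A = {v \<in> S. \<exists>xs. P v xs}"
  have aA: "a \<in> A" unfolding A_def P_def using assms(2) by (auto intro: exI[of _ "[a]"])
  have "A = S"
  proof (rule ccontr)
    assume "A \<noteq> S"
    moreover have "A \<subseteq> S" "A \<noteq> {}" using aA by (auto simp: A_def)
    ultimately obtain u v where uv: "u \<in> A" "v \<in> S" "v \<notin> A" "E u v" using conn_setE[OF assms(1), of A] by metis
    obtain xs where xs: "P u xs" using uv(1) by (auto simp: A_def)
    have "v \<notin> set xs"
    proof
      assume "v \<in> set xs"
      then obtain us ws where "xs = us @ v # ws" by (meson split_list)
      then have "P v (us @ [v])" using xs successively_upto[of E us v ws] unfolding P_def by (cases us) auto
      then show False using uv(2,3) by (auto simp: A_def)
    qed
    then have "P v (xs @ [v])" using xs uv(2,4) unfolding P_def by (auto simp: successively_append_iff)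
    then show False using uv(2,3) by (auto simp: A_def)
  qed
  then obtain xs where "P b xs" using assms(3) by (auto simp: A_def)
  then show ?thesis using that unfolding P_def by blast
qed

text \<open>All neighbours of the first vertex of a longest path lie on the path; one of them is not
  its successor and closes a cycle.\<close>

lemma cyc_exists:
  assumes "finite W" "W \<noteq> {}" "symp E" "\<And>v. \<not> E v v" and deg: "\<And>v. v \<in> W \<Longrightarrow> 2 \<le> card (nbrs E W {v})"
  obtains xs where "cyc E xs" "set xs \<subseteq> W"
proof -
  define P where "P xs \<longleftrightarrow> xs \<noteq> [] \<and> distinct xs \<and> successively E xs \<and> set xs \<subseteq> W" for xs
  obtain w where "w \<in> W" using assms(2) by blast
  then have "P [w]" by (simp add: P_def)
  moreover have "\<forall>xs. P xs \<longrightarrow> length xs < Suc (card W)"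
    unfolding P_def using card_mono[OF assms(1)] distinct_card by (metis le_imp_less_Suc)
  ultimately obtain xs where xs: "P xs" "\<And>ys. P ys \<Longrightarrow> length ys \<le> length xs"
    using ex_has_greatest_nat[of P "[w]" length "Suc (card W)"] by blast
  obtain v us where vus: "xs = v # us" using xs(1) by (cases xs) (auto simp: P_def)
  have vW: "v \<in> W" using xs(1) vus by (simp add: P_def)
  have nb: "nbrs E W {v} \<subseteq> set us"
  proof
    fix u assume u: "u \<in> nbrs E W {v}"
    then have "E v u" "u \<in> W" by (auto simp: nbrs_def)
    then have Euv: "E u v" "u \<noteq> v" using assms(3) sympD assms(4) by metis+
    show "u \<in> set us"
    proof (rule ccontr)
      assume "u \<notin> set us"
      then have "P (u # xs)" using xs(1) vus Euv \<open>u \<in> W\<close> by (simp add: P_def)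
      then show False using xs(2)[of "u # xs"] by simp
    qed
  qed
  have "\<not> nbrs E W {v} \<subseteq> {hd us}"
  proof
    assume "nbrs E W {v} \<subseteq> {hd us}"
    then have "card (nbrs E W {v}) \<le> card {hd us}" by (intro card_mono) auto
    then show False using deg[OF vW] by simp
  qed
  then obtain q where q: "q \<in> nbrs E W {v}" "q \<noteq> hd us" by blast
  then obtain as bs where us: "us = as @ q # bs" using nb by (meson split_list subsetD)
  then have "as \<noteq> []" using q(2) by auto
  moreover have "E q v" using q(1) assms(3) unfolding nbrs_def by (auto dest: sympD)
  ultimately have "cyc E (v # as @ [q])"
    using xs(1) us vus successively_upto[of E "v # as" q bs] unfolding P_def cyc_def
    by (cases as) auto
  moreover have "set (v # as @ [q]) \<subseteq> W" using xs(1) us vus unfolding P_def by auto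
  ultimately show ?thesis by (rule that)
qed

lemma split_two:
  assumes "p \<in> set ys" "q \<in> set ys" "p \<noteq> q"
  obtains (pq) u1 u2 u3 where "ys = u1 @ p # u2 @ q # u3" | (qp) u1 u2 u3 where "ys = u1 @ q # u2 @ p # u3"
proof -
  obtain as bs where ys: "ys = as @ p # bs" using assms(1) by (meson split_list)
  show ?thesis
  proof (cases "q \<in> set bs")
    case True
    then obtain cs ds where "bs = cs @ q # ds" by (meson split_list)
    then show ?thesis using ys pq by simp
  next
    case False
    then have "q \<in> set as" using assms(2,3) ys by auto
    then obtain cs ds where "as = cs @ q # ds" by (meson split_list)
    then show ?thesis using ys qp by simp
  qed
qed

text \<open>Iterated, this lists attachments in the order in which they occur along a cycle.\<close>

lemma split_first_label:
  assumes "Suc k \<le> card (T \<inter> set xs)"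
  obtains a p b where "xs = a @ p # b" "p \<in> T" "k \<le> card (T \<inter> set b)"
proof -
  have "T \<inter> set xs \<noteq> {}" using assms by auto
  then have "\<exists>x\<in>set xs. x \<in> T" by blast
  then obtain a p b where s: "xs = a @ p # b" "p \<in> T" "\<forall>y\<in>set a. y \<notin> T"
    using split_list_first_prop[of xs "\<lambda>x. x \<in> T"] by blast
  have "T \<inter> set xs \<subseteq> insert p (T \<inter> set b)" using s by auto
  then have "card (T \<inter> set xs) \<le> card (insert p (T \<inter> set b))" by (intro card_mono) auto
  also have "\<dots> \<le> Suc (card (T \<inter> set b))" by (simp add: card_insert_if)
  finally show ?thesis using that[OF s(1,2)] assms by simp
qed

context min_k5e_free
begin

text \<open>Consecutive arcs of the cycle touch. \<open>P\<close>, \<open>Q\<close> and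
  \<open>D1\<close> form the triangle of the model; \<open>R\<close> and \<open>D2\<close> are the
  non-adjacent pair.\<close>

lemma seg_k5e:
  assumes "cyc E (P @ Q @ R)" "P \<noteq> []" "Q \<noteq> []" "R \<noteq> []" "set (P @ Q @ R) \<subseteq> V - D1 - D2"
    "D1 \<inter> D2 = {}" "conn_set E D1" "conn_set E D2" "D1 \<subseteq> V" "D2 \<subseteq> V" "touch E D1 D2"
    "touch E D1 (set P)" "touch E D1 (set Q)" "touch E D1 (set R)" "touch E D2 (set P)" "touch E D2 (set Q)"
  shows False
proof -
  have PQR: "distinct (P @ Q @ R)" "successively E P" "successively E Q" "successively E R"
    "E (last P) (hd Q)" "E (last Q) (hd R)" "E (last R) (hd P)"
    using assms(1-4) by (auto simp: cyc_def successively_append_iff)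
  have t: "touch E (set P) (set Q)" "touch E (set R) (set P)" "touch E (set R) (set Q)"
    using PQR(5-7) assms(2-4) Esym unfolding touch_def by (meson hd_in_set last_in_set)+
  have c: "conn_set E (set P)" "conn_set E (set Q)" "conn_set E (set R)"
    using conn_set_path[OF sym] PQR(2-4) assms(2-4) by blast+
  have s: "touch E (set P) D1" "touch E (set Q) D1" "touch E (set R) D1" "touch E D2 D1"
    using assms(11-14) touch_sym[OF sym] by metis+
  have "k5e V E"
    by (rule k5eI[of "set P" "set Q" D1 "set R" D2])
      (use PQR(1) t c s assms(5-10,15,16) in auto)
  then show False using nok by blast
qed

text \<open>The cycle is cut into three arcs, each with an attachment of \<open>D1\<close>, so that
  two attachments \<open>s\<close> and \<open>s'\<close> of \<open>D2\<close> fall into different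
  arcs; then \<open>seg_k5e\<close> applies. The cycle is rotated to start at \<open>s\<close>,
  which puts \<open>s\<close> into the first arc.\<close>

lemma no_three_two:
  assumes cs: "cyc E cs" "set cs \<subseteq> V - D1 - D2"
    and D: "D1 \<inter> D2 = {}" "conn_set E D1" "conn_set E D2" "D1 \<subseteq> V" "D2 \<subseteq> V" "touch E D1 D2"
    and lab: "3 \<le> card (nbrs E (set cs) D1)" "2 \<le> card (nbrs E (set cs) D2)"
  shows False
proof -
  have seg: False if "cyc E (P @ Q @ R)" "set (P @ Q @ R) = set cs" "P \<noteq> []" "Q \<noteq> []" "R \<noteq> []"
      "touch E D1 (set P)" "touch E D1 (set Q)" "touch E D1 (set R)" "touch E D2 (set P)" "touch E D2 (set Q)" for P Q R
    by (rule seg_k5e[OF that(1,3-5) _ D that(6-10)]) (use that(2) cs(2) in simp)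
  obtain s s' where s: "s \<in> nbrs E (set cs) D2" "s' \<in> nbrs E (set cs) D2" "s \<noteq> s'"
    using lab(2) by (meson card_2_iff' ex_card subsetD)
  have sD: "touch E D2 S" if "s \<in> S" for S using s(1) that unfolding nbrs_def touch_def by blast
  have s'D: "touch E D2 S" if "s' \<in> S" for S using s(2) that unfolding nbrs_def touch_def by blast
  have "s \<in> set cs" using s(1) nbrs_subset by fast
  then obtain xs ys where xy: "cs = xs @ s # ys" by (meson split_list)
  define zs where "zs = s # ys @ xs"
  have zs: "cyc E zs" "set zs = set cs" "hd zs = s"
    using cyc_rotate[of E xs "s # ys"] cs(1) xy by (auto simp: zs_def)
  let ?T = "nbrs E (set cs) D1"
  have tD: "touch E D1 S" if "p \<in> ?T" "p \<in> S" for p S using that unfolding nbrs_def touch_def by blast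
  have "?T \<inter> set zs = ?T" using zs(2) nbrs_subset[of E "set cs" D1] by blast
  then have "Suc 2 \<le> card (?T \<inter> set zs)" using lab(1) by simp
  then obtain a p r1 where 1: "zs = a @ p # r1" "p \<in> ?T" "2 \<le> card (?T \<inter> set r1)" by (rule split_first_label)
  then have "Suc 1 \<le> card (?T \<inter> set r1)" by simp
  then obtain b q r2 where 2: "r1 = b @ q # r2" "q \<in> ?T" "1 \<le> card (?T \<inter> set r2)" by (rule split_first_label)
  then have "Suc 0 \<le> card (?T \<inter> set r2)" by simp
  then obtain c r d where 3: "r2 = c @ r # d" "r \<in> ?T" by (rule split_first_label)
  have zs': "zs = a @ p # b @ q # c @ r # d" using 1(1) 2(1) 3(1) by simp
  have s'z: "s' \<in> set zs" using s(2) nbrs_subset[of E "set cs" D2] zs(2) by blast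
  show False
  proof (cases "s' \<in> set (a @ [p])")
    case True
    \<comment> \<open>Both \<open>s\<close> and \<open>s'\<close> lie in the first arc. It is
      divided just before \<open>s'\<close>: its beginning, with \<open>s\<close>, joins the arc of
      \<open>r\<close>, and its end, with \<open>s'\<close> and \<open>p\<close>, becomes an arc of
      its own.\<close>
    then obtain e f where ef: "a @ [p] = e @ s' # f" by (meson split_list)
    have "hd (a @ [p]) = s" using zs(3) zs' by (cases a) auto
    then have e: "e \<noteq> []" "hd e = s" using ef s(3) by (cases e; auto)+
    have pf: "p \<in> set (s' # f)" using ef by (metis last_appendR last_in_set last_snoc list.discI)
    have "zs = (a @ [p]) @ b @ q # c @ r # d" using zs' by simp
    then have "zs = e @ (s' # f @ b @ q # c @ r # d)" using ef by simp
    have rot: "cyc E ((s' # f @ b @ q # c @ r # d) @ e)"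
      using cyc_rotate[of E e "s' # f @ b @ q # c @ r # d"] zs(1) \<open>zs = e @ _\<close> by simp
    have rot2: "cyc E ((r # d @ e) @ (s' # f @ b) @ (q # c))"
      using cyc_rotate[of E "s' # f @ b @ q # c" "r # d @ e"] rot by simp
    show False
    proof (rule seg[OF rot2])
      show "set ((r # d @ e) @ (s' # f @ b) @ q # c) = set cs"
        using zs(2) \<open>zs = e @ _\<close> by auto
      show "touch E D2 (set (r # d @ e))" by (rule sD) (use e in \<open>auto dest: hd_in_set\<close>)
      show "touch E D2 (set (s' # f @ b))" by (rule s'D) simp
      show "touch E D1 (set (r # d @ e))" by (rule tD[OF 3(2)]) simp
      show "touch E D1 (set (s' # f @ b))" by (rule tD[OF 1(2)]) (use pf in auto)
      show "touch E D1 (set (q # c))" by (rule tD[OF 2(2)]) simp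
    qed auto
  next
    case False
    have t1: "touch E D1 (set (a @ [p]))" by (rule tD[OF 1(2)]) simp
    have t2: "touch E D1 (set (b @ q # c))" by (rule tD[OF 2(2)]) simp
    have t3: "touch E D1 (set (r # d))" by (rule tD[OF 3(2)]) simp
    have ts: "touch E D2 (set (a @ [p]))" by (rule sD) (use zs(3) zs' in \<open>cases a; auto\<close>)
    have rot: "cyc E ((a @ [p]) @ (b @ q # c) @ (r # d))" using zs(1) zs' by simp
    show False
    proof (cases "s' \<in> set (b @ q # c)")
      case True
      show False by (rule seg[OF rot _ _ _ _ t1 t2 t3 ts s'D[OF True]]) (use zs(2) zs' in auto)
    next
      case f: False
      then have rd: "s' \<in> set (r # d)" using False s'z zs' by auto
      have rot2: "cyc E ((r # d) @ (a @ [p]) @ (b @ q # c))"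
        using cyc_rotate[of E "(a @ [p]) @ (b @ q # c)" "r # d"] rot by simp
      show False by (rule seg[OF rot2 _ _ _ _ t3 t1 t2 s'D[OF rd] ts]) (use zs(2) zs' in auto)
    qed
  qed
qed

text \<open>The complement of the cycle is a largest connected set which avoids some cycle.\<close>

lemma nonseparating_cycle:
  obtains cs where "cyc E cs" "set cs \<subseteq> V" "conn_set E (V - set cs)"
    "\<And>v. v \<in> set cs \<Longrightarrow> card (nbrs E (set cs) {v}) \<le> 2"
proof -
  define P where "P B \<longleftrightarrow> B \<subseteq> V \<and> conn_set E B \<and> (\<exists>cs. cyc E cs \<and> set cs \<subseteq> V - B)" for B
  have Vne: "V \<noteq> {}" using big by auto
  then obtain v where v: "v \<in> V" by blast
  have "\<exists>cs. cyc E cs \<and> set cs \<subseteq> V - {v}"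
  proof -
    have deg: "2 \<le> card (nbrs E (V - {v}) {w})" if w: "w \<in> V - {v}" for w
    proof -
      have "N {w} \<subseteq> insert v (nbrs E (V - {v}) {w})" unfolding nbrs_def by blast
      moreover have f: "finite (nbrs E (V - {v}) {w})" by (rule finite_subset[OF nbrs_subset]) (simp add: fin)
      ultimately have "card (N {w}) \<le> card (insert v (nbrs E (V - {v}) {w}))" by (intro card_mono) auto
      also have "\<dots> \<le> Suc (card (nbrs E (V - {v}) {w}))" using f by (simp add: card_insert_if)
      finally show ?thesis using degree_ge3[of w] w by simp
    qed
    have "V - {v} \<noteq> {}"
    proof
      assume "V - {v} = {}"
      then have "card V \<le> card {v}" by (intro card_mono) auto
      then show False using big by simp
    qed
    then obtain cs where "cyc E cs" "set cs \<subseteq> V - {v}"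
      using cyc_exists[of "V - {v}" E, OF _ _ sym irr deg] fin by blast
    then show ?thesis by blast
  qed
  then have "P {v}" using v by (simp add: P_def)
  moreover have "\<forall>B. P B \<longrightarrow> card B < Suc (card V)"
    unfolding P_def using card_mono[OF fin] by (metis le_imp_less_Suc)
  ultimately have "\<exists>B. P B \<and> (\<forall>B'. P B' \<longrightarrow> card B' \<le> card B)"
    by (intro ex_has_greatest_nat)
  then obtain B where B: "P B" "\<And>B'. P B' \<Longrightarrow> card B' \<le> card B" by metis
  have B1: "B \<subseteq> V" "conn_set E B" "B \<noteq> {}" using B(1) conn_set_nonempty unfolding P_def by auto
  have maxB: False if "B \<subseteq> B'" "B' \<subseteq> V" "B' \<noteq> B" "conn_set E B'" "cyc E xs" "set xs \<subseteq> V - B'" for B' xs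
  proof -
    have "P B'" unfolding P_def using that by blast
    then have "card B' \<le> card B" by (rule B(2))
    moreover have "finite B'" using that(2) fin finite_subset by blast
    then have "card B < card B'" using that(1,3) by (intro psubset_card_mono) auto
    ultimately show False by simp
  qed
  obtain cs0 where "cyc E cs0 \<and> set cs0 \<subseteq> V - B" using B(1) unfolding P_def by blast
  \<comment> \<open>Among the cycles that avoid \<open>B\<close> a shortest one is taken, to exclude
    chords.\<close>
  then have "\<exists>cs. (cyc E cs \<and> set cs \<subseteq> V - B) \<and> (\<forall>xs. cyc E xs \<and> set xs \<subseteq> V - B \<longrightarrow> length cs \<le> length xs)"
    by (rule ex_has_least_nat)
  then obtain cs where cs: "cyc E cs" "set cs \<subseteq> V - B"
    and least: "\<And>xs. cyc E xs \<Longrightarrow> set xs \<subseteq> V - B \<Longrightarrow> length cs \<le> length xs" by metis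
  define C where "C = set cs"
  have Cne: "C \<noteq> {}" using cs(1) unfolding C_def cyc_def by auto
  have ntouch: "\<not> touch E Z B" if Z: "is_comp E (V - B - C) Z" for Z
  proof
    assume t: "touch E Z B"
    have Zd: "Z \<subseteq> V - B - C" "conn_set E Z" "Z \<noteq> {}" using is_compD(1-3)[OF Z] by auto
    have "conn_set E (B \<union> Z)" by (rule conn_set_Un[OF sym B1(2) Zd(2)]) (use touch_sym[OF sym t] in simp)
    then show False using maxB[of "B \<union> Z" cs] Zd B1 cs unfolding C_def by blast
  qed
  have "V - B = C"
  proof (rule ccontr)
    assume ne: "V - B \<noteq> C"
    then obtain z where z: "z \<in> V - B - C" using cs(2) C_def by blast
    obtain Z where Z: "is_comp E (V - B - C) Z" using is_comp_exists[OF sym z] by metis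
    have Zd: "Z \<subseteq> V - B - C" "conn_set E Z" "Z \<noteq> {}" using is_compD(1-3)[OF Z] by auto
    have ZV: "Z \<subseteq> V" using Zd(1) by blast
    have NZ: "N Z \<subseteq> C" using ntouch[OF Z] comp_no_nbrs[OF Z] unfolding nbrs_def touch_def by blast
    have "Z \<union> N Z \<noteq> V" using NZ Zd(1) B1(1,3) cs(2) unfolding C_def by blast
    then have c3: "3 \<le> card (N Z)" using card_N_ge3[OF ZV Zd(3)] by blast
    have NB: "N B \<subseteq> C"
    proof
      fix n assume n: "n \<in> N B"
      show "n \<in> C"
      proof (rule ccontr)
        assume "n \<notin> C"
        then have nV: "n \<in> V - B - C" using n unfolding nbrs_def by blast
        obtain Z' where Z': "is_comp E (V - B - C) Z'" "n \<in> Z'" using is_comp_exists[OF sym nV] by metis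
        have "touch E B Z'" using n Z'(2) unfolding nbrs_def touch_def by blast
        then show False using ntouch[OF Z'(1)] touch_sym[OF sym] by metis
      qed
    qed
    have "N B \<noteq> {}"
    proof
      assume e: "N B = {}"
      then have "B \<union> N B \<noteq> V" using z by blast
      then have "3 \<le> card (N B)" by (rule card_N_ge3[OF B1(1,3)])
      then show False using e by simp
    qed
    \<comment> \<open>The vertex \<open>s\<close> is to be added to \<open>B\<close>. A path through
      \<open>Z\<close> between two neighbours of \<open>Z\<close> other than \<open>s\<close>,
      closed by the arc of the cycle that avoids \<open>s\<close>, is a cycle disjoint from
      \<open>insert s B\<close>, against the maximality of \<open>B\<close>.\<close>
    then obtain s where s: "s \<in> N B" "s \<in> C" using NB by blast
    then obtain as bs where ab: "cs = as @ s # bs" unfolding C_def by (meson split_list)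
    define ys where "ys = bs @ as"
    have ys: "cyc E (s # ys)" "set ys = C - {s}" "distinct ys"
      using cyc_rotate[of E as "s # bs"] cs(1) ab unfolding ys_def C_def cyc_def by auto
    have "\<not> card (N Z - {s}) \<le> 1" using c3 finN by (auto simp: card_Diff_singleton_if)
    then obtain p q where pq: "p \<in> N Z - {s}" "q \<in> N Z - {s}" "p \<noteq> q"
      by (metis card_le_Suc0_iff_eq One_nat_def finN finite_Diff)
    have main: False if y: "ys = u1 @ p # u2 @ q # u3" and pq: "p \<in> N Z" "q \<in> N Z" for p q u1 u2 u3
    proof -
      obtain p' q' where p': "p' \<in> Z" "E p' p" "q' \<in> Z" "E q' q" using pq unfolding nbrs_def by blast
      obtain zs where zs: "zs \<noteq> []" "distinct zs" "successively E zs" "set zs \<subseteq> Z" "hd zs = q'" "last zs = p'"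
        using conn_path[OF Zd(2) p'(3,1)] by metis
      have ysC: "set ys \<inter> Z = {}" "s \<notin> set ys" "s \<notin> Z" using ys(2) Zd(1) s(2) by auto
      have suc: "successively E ys" using ys(1) unfolding cyc_def by (cases ys) auto
      have cy: "cyc E (p # u2 @ q # zs)"
      proof -
        have "successively E ((p # u2) @ q # u3)" using suc y successively_append_iff[of E u1] by simp
        from successively_upto[OF this] have sp: "successively E (p # u2 @ [q])" by simp
        have "successively E ((p # u2 @ [q]) @ zs)"
          using sp zs(1,3,5) Esym[OF p'(4)] by (subst successively_append_iff) auto
        moreover have "distinct (p # u2 @ q # zs)" using ys(3) y zs(2,4) ysC(1) by auto
        moreover have "E (last (p # u2 @ q # zs)) (hd (p # u2 @ q # zs))" using zs(1,6) p'(2) by auto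
        moreover have "3 \<le> length (p # u2 @ q # zs)" using zs(1) by (cases zs) auto
        ultimately show ?thesis unfolding cyc_def by simp
      qed
      have "touch E {s} B" using s(1) touch_sym[OF sym touch_nbrs] by metis
      then have "conn_set E (insert s B)" by (rule conn_set_insert[OF sym B1(2)])
      moreover have "set (p # u2 @ q # zs) \<subseteq> set ys \<union> Z" using y zs(4) by auto
      then have "set (p # u2 @ q # zs) \<subseteq> V - insert s B"
        using ys(2) ysC(3) Zd(1) cs(2) unfolding C_def by blast
      ultimately show False using maxB[of "insert s B" "p # u2 @ q # zs"] cy s B1(1) cs(2) unfolding C_def by blast
    qed
    have mem: "p \<in> set ys" "q \<in> set ys" and mem': "p \<in> N Z" "q \<in> N Z" using pq NZ ys(2) by auto
    show False
    proof (rule split_two[OF mem pq(3)])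
      fix u1 u2 u3 assume "ys = u1 @ p # u2 @ q # u3"
      then show False by (rule main[OF _ mem'])
    next
      fix u1 u2 u3 assume "ys = u1 @ q # u2 @ p # u3"
      then show False by (rule main[OF _ mem'(2,1)])
    qed
  qed
  then have VC: "V - C = B" using B1(1) by blast
  \<comment> \<open>A chord at \<open>v\<close> would close a shorter cycle, so only the two
    vertices next to \<open>v\<close> on the cycle are its neighbours there.\<close>
  have chordless: "card (nbrs E (set cs) {v}) \<le> 2" if v: "v \<in> set cs" for v
  proof -
    obtain as bs where ab: "cs = as @ v # bs" using v by (meson split_list)
    define us where "us = bs @ as"
    have us: "cyc E (v # us)" "set (v # us) = set cs" "length (v # us) = length cs"
      using cyc_rotate[of E as "v # bs"] cs(1) ab unfolding us_def by auto
    have "nbrs E (set cs) {v} \<subseteq> {hd us, last us}"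
    proof
      fix q assume q: "q \<in> nbrs E (set cs) {v}"
      then have Eq: "E v q" "q \<in> set cs" by (auto simp: nbrs_def)
      then have "q \<in> set us" using us(2) irr[of v] by auto
      then obtain xs ys where xy: "us = xs @ q # ys" by (meson split_list)
      show "q \<in> {hd us, last us}"
      proof (cases "xs = [] \<or> ys = []")
        case True then show ?thesis using xy by auto
      next
        case False
        then have "cyc E (v # xs @ [q])"
          using us(1) xy Esym[OF Eq(1)] successively_upto[of E "v # xs" q ys] unfolding cyc_def
          by (cases xs) auto
        moreover have "set (v # xs @ [q]) \<subseteq> V - B" using us(2) xy cs(2) by auto
        ultimately have "length cs \<le> length (v # xs @ [q])" by (rule least)
        then have "length cs \<le> length xs + 2" by simp
        moreover have "length cs = length xs + length ys + 2" using us(3) xy by simp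
        ultimately have "length ys = 0" by linarith
        then show ?thesis using False by blast
      qed
    qed
    then have "card (nbrs E (set cs) {v}) \<le> card {hd us, last us}" by (intro card_mono) auto
    also have "\<dots> \<le> 2" by (simp add: card_insert_if)
    finally show ?thesis .
  qed
  show ?thesis
    by (rule that[OF cs(1) _ _ chordless]) (use cs(2) VC B1(2) C_def in auto)
qed

end

section \<open>Triangle-free graphs\<close>

context min_k5e_free
begin

text \<open>In the next two lemmas the 4-cycles \<open>p r p' q\<close> (respectively \<open>r p p' q\<close>) and \<open>y R z D\<close> are joined
  by the matching \<open>p y\<close>, \<open>p' z\<close>, \<open>q D\<close>, \<open>r R\<close>: a cube, and a cube with one twisted face.\<close>

lemma cube_k5e:
  assumes e: "E p r" "E r p'" "E p' q" "E q p" "E y p" "E z p'"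
    and D: "touch E D {q}" "touch E R {r}" "touch E {y} D" "touch E {z} D" "touch E R {y}" "touch E R {z}"
    "conn_set E D" "conn_set E R"
    and sub: "{p,p',q,r} \<inter> (insert y (insert z (D \<union> R))) = {}" "y \<notin> D" "z \<notin> D" "y \<notin> R" "z \<notin> R" "y \<noteq> z" "D \<inter> R = {}"
    "distinct [p,p',q,r]" "{p,p',q,r,y,z} \<union> D \<union> R \<subseteq> V"
  shows False
proof -
  have c1: "conn_set E {r,p'}" by (rule conn_set_insert[OF sym conn_set_singleton]) (use e in \<open>auto simp: touch_def\<close>)
  have c2: "conn_set E (insert q D)" by (rule conn_set_insert[OF sym D(7) touch_sym[OF sym D(1)]])
  have c3: "conn_set E (insert y R)" by (rule conn_set_insert[OF sym D(8) touch_sym[OF sym D(5)]])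
  have t: "touch E {r,p'} (insert q D)" "touch E {p} (insert q D)" "touch E {p} {r,p'}" "touch E {p} (insert y R)" "touch E {z} {r,p'}"
    using e Esym unfolding touch_def by blast+
  have t2: "touch E {r,p'} (insert y R)" "touch E (insert q D) (insert y R)" "touch E {z} (insert q D)" "touch E {z} (insert y R)"
    using D(2,3,4,6) Esym unfolding touch_def by blast+
  \<comment> \<open>\<open>p\<close> and \<open>z\<close> are opposite corners of the cube; each
    contracted edge joins a neighbour of \<open>p\<close> to a neighbour of
    \<open>z\<close>.\<close>
  have "k5e V E"
    by (rule k5eI[of "{r,p'}" "insert q D" "insert y R" "{p}" "{z}"])
      (use c1 c2 c3 t t2 sub in auto)
  then show False using nok by blast
qed

lemma twisted_k5e:
  assumes e: "E r p" "E p p'" "E p' q" "E q r" "E y p" "E z p'"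
    and D: "touch E D {q}" "touch E R {r}" "touch E {y} D" "touch E {z} D" "touch E R {y}" "touch E R {z}"
    "conn_set E D" "conn_set E R"
    and sub: "{p,p',q,r} \<inter> (insert y (insert z (D \<union> R))) = {}" "y \<notin> D" "z \<notin> D" "y \<notin> R" "z \<notin> R" "y \<noteq> z" "D \<inter> R = {}"
    "distinct [p,p',q,r]" "{p,p',q,r,y,z} \<union> D \<union> R \<subseteq> V"
  shows False
proof -
  have c1: "conn_set E {r,p}" by (rule conn_set_insert[OF sym conn_set_singleton]) (use e in \<open>auto simp: touch_def\<close>)
  have c2: "conn_set E {p',z}" by (rule conn_set_insert[OF sym conn_set_singleton]) (use e Esym in \<open>auto simp: touch_def\<close>)
  have c3: "conn_set E (insert y D)" by (rule conn_set_insert[OF sym D(7) D(3)])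
  have t: "touch E {r,p} {p',z}" "touch E {r,p} (insert y D)" "touch E {q} {r,p}" "touch E {q} {p',z}"
    using e Esym unfolding touch_def by blast+
  have t2: "touch E {p',z} (insert y D)" "touch E {q} (insert y D)" "touch E R {r,p}" "touch E R {p',z}" "touch E R (insert y D)"
    using D(1,2,4,5,6) Esym unfolding touch_def by blast+
  \<comment> \<open>Again three disjoint edges are contracted; the remaining \<open>q\<close> and
    \<open>R\<close> see all three.\<close>
  have "k5e V E"
    by (rule k5eI[of "{r,p}" "{p',z}" "insert y D" "{q}" R])
      (use c1 c2 c3 t t2 sub D(8) in auto)
  then show False using nok by blast
qed

text \<open>The complement \<open>X\<close> of the cycle is 2-connected: this follows from
  \<open>no_three_two\<close> and \<open>no_big_cut\<close>. If some vertex of \<open>X\<close> has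
  two attachments, then \<open>X\<close> has only two vertices and the bipartition can be read off.
  Otherwise a minimal split leads to a cube or a twisted cube, which is impossible.\<close>

lemma bipartite_3_3:
  obtains K T where "card K = 3" "card T = 3" "V = K \<union> T" "K \<inter> T = {}"
    "\<And>u v. u \<in> K \<Longrightarrow> v \<in> K \<Longrightarrow> \<not> E u v" "\<And>u v. u \<in> T \<Longrightarrow> v \<in> T \<Longrightarrow> \<not> E u v"
proof -
  obtain cs where cs: "cyc E cs" "set cs \<subseteq> V" "conn_set E (V - set cs)"
    "\<And>v. v \<in> set cs \<Longrightarrow> card (nbrs E (set cs) {v}) \<le> 2"
    by (rule nonseparating_cycle) (rule that)
  define C where "C = set cs"
  define X where "X = V - C"
  have CV: "C \<subseteq> V" "finite C" using cs(2) C_def by auto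
  have XV: "X \<subseteq> V" "finite X" "V - X = C" using fin CV(1) by (auto simp: X_def)
  have connX: "conn_set E X" using cs(3) by (simp add: X_def C_def)
  have Xne: "X \<noteq> {}" by (rule conn_set_nonempty[OF connX])
  let ?L = "nbrs E C"
  have finL: "finite (?L D)" for D by (rule finite_subset[OF nbrs_subset CV(2)])
  have NX: "N X = ?L X" using XV(3) by simp
  \<comment> \<open>The cycle accounts for at most two of the at least three neighbours of each of
    its vertices.\<close>
  have LX: "?L X = C"
  proof (rule antisym[OF nbrs_subset subsetI])
    fix c assume c: "c \<in> C"
    have cV: "c \<in> V" using c CV by blast
    show "c \<in> ?L X"
    proof (rule ccontr)
      assume n: "c \<notin> ?L X"
      have "N {c} \<subseteq> nbrs E (set cs) {c}"
        using n c XV(3) Esym unfolding nbrs_def C_def X_def by blast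
      then have "card (N {c}) \<le> card (nbrs E (set cs) {c})"
        by (rule card_mono[rotated]) (rule finite_subset[OF nbrs_subset], simp)
      then show False using degree_ge3[OF cV] cs(4)[of c] c C_def by simp
    qed
  qed
  obtain c0 c1 us where cs01: "cs = c0 # c1 # us" using cs(1) by (cases cs rule: remdups_adj.cases) (auto simp: cyc_def)
  have e01: "E c0 c1" "c0 \<in> C" "c1 \<in> C" using cs(1) cs01 by (auto simp: cyc_def C_def)
  have cardC: "card C = length cs" using cs(1) by (simp add: cyc_def C_def distinct_card)
  have m4: "4 \<le> card C"
  proof (rule ccontr)
    assume "\<not> ?thesis"
    then have "length cs = 3" using cs(1) cardC by (simp add: cyc_def)
    then obtain c2 where "us = [c2]" using cs01 by (cases us) auto
    then have "E c0 c1" "E c1 c2" "E c2 c0" "c2 \<in> C" using cs(1) cs01 by (auto simp: cyc_def C_def)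
    then show False using no_triangle[of c0 c1 c2] e01 CV Esym by blast
  qed
  have ne1: "X - {x} \<noteq> {}" for x
  proof
    assume "X - {x} = {}"
    then have "X = {x}" using Xne by blast
    then have "E x c0" "E x c1" "x \<in> V" using LX e01 XV unfolding nbrs_def by blast+
    then show False using no_triangle[of x c0 c1] e01 CV by blast
  qed
  have conn_rest_touch: "touch E D1 D2" if "D1 \<union> D2 = X" "D1 \<inter> D2 = {}" "conn_set E D1" "conn_set E D2" for D1 D2
    by (rule conn_split_touch[OF connX that(1,2) conn_set_nonempty[OF that(3)] conn_set_nonempty[OF that(4)]])
  have rule: "\<not> (3 \<le> card (?L D1) \<and> 2 \<le> card (?L D2))"
    if D: "D1 \<union> D2 = X" "D1 \<inter> D2 = {}" "conn_set E D1" "conn_set E D2" for D1 D2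
  proof
    assume l: "3 \<le> card (?L D1) \<and> 2 \<le> card (?L D2)"
    have s: "D1 \<subseteq> V" "D2 \<subseteq> V" "set cs \<subseteq> V - D1 - D2" using D(1) XV CV C_def X_def by auto
    show False using no_three_two[OF cs(1) s(3) D(2-4) s(1,2) conn_rest_touch[OF D]] l C_def by simp
  qed
  \<comment> \<open>The attachments of the two parts cover \<open>C\<close>, which has at least four
    vertices, while \<open>rule\<close> allows neither part a third one. So there are two and two,
    without overlap.\<close>
  have two_two: "card (?L D1) = 2 \<and> card (?L D2) = 2 \<and> card C = 4 \<and> ?L D1 \<inter> ?L D2 = {}"
    if D: "D1 \<union> D2 = X" "D1 \<inter> D2 = {}" "conn_set E D1" "conn_set E D2"
      and l: "2 \<le> card (?L D1)" "2 \<le> card (?L D2)" for D1 D2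
  proof -
    have D': "D2 \<union> D1 = X" "D2 \<inter> D1 = {}" using D by auto
    have c: "card (?L D1) = 2" "card (?L D2) = 2" using rule[OF D] rule[OF D' D(4,3)] l by linarith+
    have "?L D1 \<union> ?L D2 = C" using LX D(1) nbrs_Un[of E C D1 D2] by simp
    then have "card (?L D1) + card (?L D2) = card C + card (?L D1 \<inter> ?L D2)"
      using card_Un_Int[OF finL finL, of D1 D2] by simp
    then have "card C = 4" "card (?L D1 \<inter> ?L D2) = 0" using c m4 by linarith+
    then show ?thesis using c finL by simp
  qed
  have lab2: "2 \<le> card (?L Y)" if "Y \<subseteq> X" "Y \<noteq> {}" "nbrs E (X - Y) Y \<subseteq> {x}" "Y \<union> N Y \<noteq> V" for Y x
    using lab_card_ge2[OF XV(1) that] NX LX by simp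
  have NYsub: "N Y \<subseteq> insert x (?L Y)" if "Y \<subseteq> X" "nbrs E (X - Y) Y \<subseteq> {x}" for Y x
    using that CV(1) unfolding nbrs_def X_def by blast
  have LN: "?L Y \<subseteq> N Y" if "Y \<subseteq> X" for Y using that CV(1) unfolding nbrs_def X_def by blast
  have finsub: "finite Y" if "Y \<subseteq> X" for Y using that XV(2) finite_subset by blast
  \<comment> \<open>The boundary of \<open>Y\<close> is \<open>x\<close> with two vertices of
    \<open>C\<close>, and at least two more vertices of \<open>C\<close> lie beyond this cut. By
    \<open>no_big_cut\<close> nothing but a single vertex can be cut off.\<close>
  have small: "card Y = 1"
    if Y: "Y \<subseteq> X" "conn_set E Y" "nbrs E (X - Y) Y \<subseteq> {x}" "x \<in> X" "x \<notin> Y"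
      and l: "card (?L Y) = 2" "2 \<le> card (C - ?L Y)" for Y x
  proof (rule ccontr)
    assume n: "card Y \<noteq> 1"
    have "card Y \<noteq> 0" using conn_set_nonempty[OF Y(2)] finsub[OF Y(1)] by simp
    then have cY: "2 \<le> card Y" using n by simp
    have s: "N Y \<subseteq> insert x (?L Y)" by (rule NYsub[OF Y(1,3)])
    have d: "(C - ?L Y) \<inter> N Y = {}" using s Y(4) by (auto simp: X_def)
    have "C - ?L Y \<noteq> {}" using l(2) by (metis card.empty not_numeral_le_zero)
    then have "Y \<union> N Y \<noteq> V" using d Y(1) CV(1) by (auto simp: X_def)
    moreover have YV: "Y \<subseteq> V" using Y(1) XV(1) by blast
    ultimately have "3 \<le> card (N Y)" using card_N_ge3 conn_set_nonempty[OF Y(2)] by blast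
    moreover have "card (N Y) \<le> card (insert x (?L Y))" using s finL by (intro card_mono) auto
    moreover have "card (insert x (?L Y)) \<le> 3" using l(1) finL by (simp add: card_insert_if)
    ultimately have c3: "card (N Y) = 3" by simp
    have "C - ?L Y \<subseteq> V - Y - N Y" using d CV(1) Y(1) by (auto simp: X_def)
    then have "card (C - ?L Y) \<le> card (V - Y - N Y)" by (rule card_mono[rotated]) (simp add: fin)
    then show False using no_big_cut[OF YV Y(2) c3 cY] l(2) by simp
  qed
  have notV: "Y \<union> N Y \<noteq> V" if h: "Y \<inter> Y' = {}" "Y' \<subseteq> X - {x}" "Y' \<noteq> {}" "N Y \<subseteq> insert x (?L Y)" for Y Y' x
  proof -
    obtain v where v: "v \<in> Y'" using h(3) by blast
    then have "v \<in> X" "v \<noteq> x" "v \<notin> Y" using h(1,2) by blast+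
    moreover have "v \<notin> ?L Y" using \<open>v \<in> X\<close> by (simp add: X_def nbrs_def)
    ultimately have "v \<notin> Y \<union> N Y" "v \<in> V" using h(4) XV(1) by blast+
    then show ?thesis by blast
  qed
  have comp: "card Y = 1 \<and> card (?L Y) = 2 \<and> card (?L (X - Y)) = 2 \<and> ?L Y \<inter> ?L (X - Y) = {}"
    if x: "x \<in> X" and Y: "is_comp E (X - {x}) Y" "is_comp E (X - {x}) Y2" "Y \<inter> Y2 = {}" for x Y Y2
  proof -
    have Yd: "Y \<subseteq> X" "x \<notin> Y" "Y2 \<subseteq> X - Y" "Y2 \<subseteq> X" "Y2 \<noteq> {}" "Y \<noteq> {}"
      using is_compD(1,3)[OF Y(1)] is_compD(1,3)[OF Y(2)] Y(3) by auto
    have cQ: "conn_set E (X - Y)" by (rule conn_set_minus_comp[OF sym connX _ _ Y(1)]) (use x in auto)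
    have Ysub: "Y \<subseteq> X - {x}" "Y2 \<subseteq> X - {x}" using is_compD(1)[OF Y(1)] is_compD(1)[OF Y(2)] .
    have "Y \<union> N Y \<noteq> V"
      by (rule notV[OF Y(3) Ysub(2) Yd(5) NYsub[OF Yd(1) nbrs_outside_comp[OF Y(1)]]])
    moreover have "Y2 \<inter> Y = {}" using Y(3) by blast
    then have "Y2 \<union> N Y2 \<noteq> V"
      by (rule notV[OF _ Ysub(1) Yd(6) NYsub[OF Yd(4) nbrs_outside_comp[OF Y(2)]]])
    ultimately have l: "2 \<le> card (?L Y)" "2 \<le> card (?L Y2)"
      using lab2[OF Yd(1,6) nbrs_outside_comp[OF Y(1)]] lab2[OF Yd(4,5) nbrs_outside_comp[OF Y(2)]] by blast+
    have "card (?L Y2) \<le> card (?L (X - Y))" by (rule card_mono[OF finL nbrs_mono[OF Yd(3)]])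
    then have l2: "2 \<le> card (?L (X - Y))" using l(2) by simp
    have u: "Y \<union> (X - Y) = X" "Y \<inter> (X - Y) = {}" using Yd(1) by auto
    have tt: "card (?L Y) = 2 \<and> card (?L (X - Y)) = 2 \<and> card C = 4 \<and> ?L Y \<inter> ?L (X - Y) = {}"
      by (rule two_two[OF u is_compD(2)[OF Y(1)] cQ l(1) l2])
    have "card (C - ?L Y) = 2" using tt finL by (simp add: card_Diff_subset[OF finL nbrs_subset])
    then have "card Y = 1"
      using small[OF Yd(1) is_compD(2)[OF Y(1)] nbrs_outside_comp[OF Y(1)] x Yd(2)] tt by simp
    then show ?thesis using tt by blast
  qed
  \<comment> \<open>Two components at a cut vertex \<open>x\<close> are single vertices with
    disjoint pairs of attachments, and the complement of each has only the attachments of the other.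
    None are left for a third component or for \<open>x\<close>, so \<open>x\<close> has degree at
    most two.\<close>
  have conn: "conn_set E (X - {x})" if x: "x \<in> X" for x
  proof (rule ccontr)
    assume "\<not> ?thesis"
    then obtain Y1 Y2 where Y: "is_comp E (X - {x}) Y1" "is_comp E (X - {x}) Y2" "Y1 \<inter> Y2 = {}"
      using two_comps[OF sym ne1] by metis
    have Y': "Y2 \<inter> Y1 = {}" using Y(3) by blast
    note c1 = comp[OF x Y] and c2 = comp[OF x Y(2,1) Y']
    have Yd: "Y1 \<subseteq> X - {x}" "Y2 \<subseteq> X - {x}" using is_compD(1)[OF Y(1)] is_compD(1)[OF Y(2)] by auto
    have sub: "?L Y2 \<subseteq> ?L (X - Y1)" by (rule nbrs_mono) (use Yd Y(3) in blast)
    have eq: "?L Y2 = ?L (X - Y1)" by (rule card_subset_eq[OF finL sub]) (use c1 c2 in simp)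
    have all: "X = insert x (Y1 \<union> Y2)"
    proof (rule ccontr)
      assume "\<not> ?thesis"
      then obtain v where v: "v \<in> X - {x}" "v \<notin> Y1" "v \<notin> Y2" using Yd x by blast
      obtain Y3 where Y3: "is_comp E (X - {x}) Y3" "v \<in> Y3" using is_comp_exists[OF sym v(1)] by metis
      have "Y1 \<noteq> Y3" "Y2 \<noteq> Y3" using Y3(2) v by auto
      then have d: "Y1 \<inter> Y3 = {}" "Y2 \<inter> Y3 = {}" "Y3 \<inter> Y1 = {}" "Y3 \<subseteq> X - {x}"
        using is_comp_disjoint[OF Y(1) Y3(1)] is_comp_disjoint[OF Y(2) Y3(1)] is_compD(1)[OF Y3(1)] by auto
      have "card (?L Y3) = 2" using comp[OF x Y3(1) Y(1) d(3)] by blast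
      moreover have "?L Y3 \<subseteq> ?L (X - Y1)" "?L Y3 \<subseteq> ?L (X - Y2)" by (rule nbrs_mono, use d in blast)+
      then have "?L Y3 \<subseteq> {}" using eq c2 by blast
      ultimately show False by simp
    qed
    have "?L {x} \<subseteq> ?L (X - Y1)" "?L {x} \<subseteq> ?L (X - Y2)" by (rule nbrs_mono, use x Yd in blast)+
    then have "?L {x} = {}" using eq c2 by blast
    then have "N {x} \<subseteq> Y1 \<union> Y2" using all irr unfolding nbrs_def X_def by blast
    moreover have "finite (Y1 \<union> Y2)" using c1 c2 by (metis card_eq_0_iff finite_Un one_neq_zero)
    ultimately have "card (N {x}) \<le> card (Y1 \<union> Y2)" by (intro card_mono)
    also have "\<dots> \<le> 2" using card_Un_le[of Y1 Y2] c1 c2 by simp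
    finally show False using degree_ge3[of x] x XV(1) by auto
  qed
  show ?thesis
  proof (cases "\<exists>x\<in>X. 2 \<le> card (?L {x})")
    case True
    \<comment> \<open>The complement of \<open>x\<close> also has exactly two attachments and
      therefore is a single vertex \<open>y\<close>. The attachments of \<open>x\<close> and
      \<open>y\<close> are disjoint and there are no triangles, so the two parts exhibited below are
      independent.\<close>
    then obtain x where x: "x \<in> X" "2 \<le> card (?L {x})" by blast
    let ?Y = "X - {x}"
    have u: "{x} \<union> ?Y = X" "{x} \<inter> ?Y = {}" "?Y \<union> {x} = X" "?Y \<inter> {x} = {}" using x by auto
    have le2: "card (?L ?Y) \<le> 2" using rule[OF u(3,4) conn[OF x(1)] conn_set_singleton] x(2) by linarith
    have nY: "nbrs E (X - ?Y) ?Y \<subseteq> {x}" unfolding nbrs_def by blast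
    have "?L ?Y \<noteq> C" using le2 m4 by auto
    then have "?Y \<union> N ?Y \<noteq> V"
      using NYsub[OF _ nY] nbrs_subset[of E C ?Y] x(1) CV(1) unfolding X_def by blast
    then have "2 \<le> card (?L ?Y)" using lab2[OF _ ne1 nY] by blast
    note tt = two_two[OF u(1,2) conn_set_singleton conn[OF x(1)] x(2) this]
    have "card (C - ?L ?Y) = 2" using tt finL by (simp add: card_Diff_subset[OF finL nbrs_subset])
    then have "card ?Y = 1" using small[OF _ conn[OF x(1)] nY x(1)] tt by simp
    then obtain y where y: "?Y = {y}" by (meson card_1_singletonE)
    have Xxy: "X = {x,y}" "x \<noteq> y" "y \<in> X" using y x(1) by auto
    have LL: "?L {x} \<union> ?L {y} = C" using LX nbrs_Un[of E C "{x}" "{y}"] Xxy(1) by (metis insert_is_Un)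
    have dis: "?L {x} \<inter> ?L {y} = {}" "card (?L {x}) = 2" "card (?L {y}) = 2" using tt y by auto
    have nC: "x \<notin> C" "y \<notin> C" using x(1) Xxy(3) by (auto simp: X_def)
    have noE: "\<not> E u v" if "u \<in> ?L {w}" "v \<in> ?L {w}" "w \<in> X" for u v w
      using no_triangle[of w u v] that CV(1) XV(1) unfolding nbrs_def by blast
    have cross: "\<not> E u y" "\<not> E y u" if "u \<in> ?L {x}" for u
      using dis(1) that Esym unfolding nbrs_def by blast+
    have cross2: "\<not> E u x" "\<not> E x u" if "u \<in> ?L {y}" for u
      using dis(1) that Esym unfolding nbrs_def by blast+
    have nin: "y \<notin> ?L {x}" "x \<notin> ?L {y}" "x \<notin> ?L {x}" "y \<notin> ?L {y}" using nC nbrs_subset by fast+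
    show ?thesis
    proof (rule that[of "insert y (?L {x})" "insert x (?L {y})"])
      show "card (insert y (?L {x})) = 3" "card (insert x (?L {y})) = 3" using dis nin finL by simp_all
      show "V = insert y (?L {x}) \<union> insert x (?L {y})" using LL XV CV Xxy(1) unfolding X_def by blast
      show "insert y (?L {x}) \<inter> insert x (?L {y}) = {}" using dis(1) nin Xxy(2) by auto
      show "\<not> E u v" if "u \<in> insert y (?L {x})" "v \<in> insert y (?L {x})" for u v
        using that noE[OF _ _ x(1)] cross irr by blast
      show "\<not> E u v" if "u \<in> insert x (?L {y})" "v \<in> insert x (?L {y})" for u v
        using that noE[OF _ _ Xxy(3)] cross2 irr by blast
    qed
  next
    case False
    then have le1: "card (?L {x}) \<le> 1" if "x \<in> X" for x using that by fastforce
    have Qs: "\<not> 3 \<le> card (?L {x})" if "x \<in> X" for x using le1[OF that] by simp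
    have mono: "3 \<le> card (?L A) \<Longrightarrow> A \<subseteq> B \<Longrightarrow> 3 \<le> card (?L B)" for A B
      using card_mono[OF finL nbrs_mono, of A B] by (meson order_trans)
    have decomp: "?L D = ?L (D - {y}) \<union> ?L {y}" if "y \<in> D" for D y
      using that unfolding nbrs_def by blast
    obtain x0 where x0: "x0 \<in> X" using Xne by blast
    have "card C \<le> card (?L (X - {x0})) + card (?L {x0})" using decomp[OF x0] LX card_Un_le by metis
    then have r0: "3 \<le> card (?L (X - {x0}))" using m4 le1[OF x0] by simp
    \<comment> \<open>Here \<open>Q\<close> asks for three attachments. It will turn out that
      \<open>D\<close> sees exactly \<open>p\<close>, \<open>p'\<close> and \<open>r\<close>, where
      \<open>p\<close> is seen only from \<open>y\<close> and \<open>p'\<close> only from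
      \<open>z\<close>, and that \<open>X - D\<close> sees only the fourth vertex \<open>q\<close>
      of \<open>C\<close>.\<close>
    obtain D y z where D: "D \<subseteq> X" "D \<noteq> X" "conn_set E D" "conn_set E (X - D)" "3 \<le> card (?L D)"
      "y \<in> D" "z \<in> D" "y \<noteq> z" "touch E {y} (X - D)" "touch E {z} (X - D)"
      "conn_set E (D - {y})" "conn_set E (D - {z})" "\<not> 3 \<le> card (?L (D - {y}))" "\<not> 3 \<le> card (?L (D - {z}))"
      by (rule minimal_split[OF XV(2) sym conn mono x0 r0 Qs])
    have yX: "y \<in> X" "z \<in> X" using D(1,6,7) by auto
    have u: "D \<union> (X - D) = X" "D \<inter> (X - D) = {}" using D(1) by auto
    have q1: "card (?L (X - D)) \<le> 1" using rule[OF u D(3,4)] D(5) by linarith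
    have le: "card (?L D) \<le> card (?L (D - {y})) + card (?L {y})" "card (?L D) \<le> card (?L (D - {z})) + card (?L {z})"
      using decomp[OF D(6)] decomp[OF D(7)] card_Un_le by metis+
    have c: "card (?L D) = 3" "card (?L (D - {y})) = 2" "card (?L {y}) = 1" "card (?L (D - {z})) = 2" "card (?L {z}) = 1"
      using le D(5,13,14) le1[OF yX(1)] le1[OF yX(2)] by linarith+
    obtain p p' where p: "?L {y} = {p}" "?L {z} = {p'}" using c(3,5) by (meson card_1_singletonE)
    have pn: "p \<notin> ?L (D - {y})" "p' \<notin> ?L (D - {z})"
      using decomp[OF D(6)] decomp[OF D(7)] c p by (metis Un_insert_right insert_absorb numeral_eq_iff semiring_norm(88,89) sup_bot.right_neutral eval_nat_numeral n_not_Suc_n)+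
    have pp: "p \<noteq> p'"
    proof
      assume "p = p'"
      moreover have "?L {z} \<subseteq> ?L (D - {y})" using D(7,8) unfolding nbrs_def by blast
      ultimately show False using p pn by auto
    qed
    have pL: "p \<in> ?L D" "p' \<in> ?L D" using decomp[OF D(6)] decomp[OF D(7)] p by auto
    have "card (?L D - {p,p'}) = 1" using c(1) pp pL finL by (simp add: card_Diff_subset)
    then obtain r where r: "?L D - {p,p'} = {r}" by (meson card_1_singletonE)
    then have LD: "?L D = {p,p',r}" "r \<noteq> p" "r \<noteq> p'" using pL by auto
    have CU: "C = ?L D \<union> ?L (X - D)" using LX nbrs_Un[of E C D "X - D"] u(1) by simp
    then have "card C \<le> card (?L D) + card (?L (X - D))" using card_Un_le by metis
    then have q: "card (?L (X - D)) = 1" "card C = 4" using m4 q1 c(1) by linarith+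
    then obtain q where Lq: "?L (X - D) = {q}" by (meson card_1_singletonE)
    have Cq: "C = {p,p',r,q}" using CU LD(1) Lq by auto
    have qn: "q \<noteq> p" "q \<noteq> p'" "q \<noteq> r" using q(2) Cq pp LD(2,3) by (auto simp: card_insert_if split: if_splits)
    obtain w where w: "w \<in> D" "E w r" using LD(1) unfolding nbrs_def by blast
    have rC: "r \<in> C" using Cq by blast
    have wyz: "w \<noteq> y" "w \<noteq> z" using w rC p LD(2,3) unfolding nbrs_def by blast+
    have "w \<in> D - {y} - {z}" using w wyz by blast
    \<comment> \<open>\<open>R\<close> touches both \<open>y\<close> and \<open>z\<close>, as
      \<open>D - {y}\<close> and \<open>D - {z}\<close> are connected. So \<open>y\<close>,
      \<open>R\<close>, \<open>z\<close>, \<open>X - D\<close> form a 4-cycle, matched with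
      \<open>p\<close>, \<open>r\<close>, \<open>p'\<close>, \<open>q\<close> in this order.\<close>
    then obtain R where R: "is_comp E (D - {y} - {z}) R" "w \<in> R" using is_comp_exists[OF sym] by metis
    have Rd: "R \<subseteq> D - {y} - {z}" "conn_set E R" using is_compD(1,2)[OF R(1)] by auto
    have "touch E R {z}" by (rule comp_touch_core[OF sym D(11) _ _ R(1)]) (use D(7,8) in auto)
    moreover have "D - {y} - {z} = D - {z} - {y}" by blast
    then have "is_comp E (D - {z} - {y}) R" using R(1) by simp
    then have "touch E R {y}" by (rule comp_touch_core[OF sym D(12), rotated 2]) (use D(6,8) in auto)
    moreover have "touch E R {r}" using w R(2) unfolding touch_def by blast
    moreover have "touch E (X - D) {q}" using touch_nbrs Lq by (metis singletonI)
    ultimately have tR: "touch E (X - D) {q}" "touch E R {r}" "touch E R {y}" "touch E R {z}" by blast+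
    have eyz: "E y p" "E z p'" using p unfolding nbrs_def by blast+
    have XC: "X \<inter> C = {}" by (auto simp: X_def)
    have pqX: "p \<notin> X" "p' \<notin> X" "q \<notin> X" "r \<notin> X" using XC Cq by auto
    have sub1: "{p,p',q,r} \<inter> (insert y (insert z ((X - D) \<union> R))) = {}"
      using pqX yX Rd(1) D(1) by auto
    have sub2: "y \<notin> X - D" "z \<notin> X - D" "y \<notin> R" "z \<notin> R" "(X - D) \<inter> R = {}" using D(6,7) Rd(1) by auto
    have sub3: "{p,p',q,r,y,z} \<union> (X - D) \<union> R \<subseteq> V" using Cq CV(1) XV(1) yX D(1) Rd(1) by auto
    have dist: "distinct [p,p',q,r]" using pp qn LD(2,3) by auto
    \<comment> \<open>All depends on the vertex opposite to \<open>q\<close> on \<open>C\<close>: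
      \<open>r\<close> gives the cube, \<open>p\<close> and \<open>p'\<close> give the twisted
      cube.\<close>
    have cube: False if "E p r" "E r p'" "E p' q" "E q p"
      by (rule cube_k5e[OF that eyz tR(1,2) D(9,10) tR(3,4) D(4) Rd(2) sub1 sub2(1-4) D(8) sub2(5) dist sub3])
    have tw: False if "E r p" "E p p'" "E p' q" "E q r"
      by (rule twisted_k5e[OF that eyz tR(1,2) D(9,10) tR(3,4) D(4) Rd(2) sub1 sub2(1-4) D(8) sub2(5) dist sub3])
    have tw': False if "E r p'" "E p' p" "E p q" "E q r"
      by (rule twisted_k5e[OF that eyz(2,1) tR(1,2) D(10,9) tR(4,3) D(4) Rd(2) _ sub2(2,1,4,3) _ sub2(5)])
        (use sub1 D(8) dist sub3 in auto)
    have "q \<in> set cs" using Cq C_def by auto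
    then obtain as bs where ab: "cs = as @ q # bs" by (meson split_list)
    define ds where "ds = bs @ as"
    have ds: "cyc E (q # ds)" "set (q # ds) = C" using cyc_rotate[of E as "q # bs"] cs(1) ab by (auto simp: ds_def C_def)
    have "length ds = 3" using q(2) cardC ab by (simp add: ds_def)
    then obtain d1 d2 d3 where d: "ds = [d1,d2,d3]" by (auto simp: length_Suc_conv numeral_3_eq_3)
    have ed: "E q d1" "E d1 d2" "E d2 d3" "E d3 q" "distinct [q,d1,d2,d3]" using ds(1) d by (auto simp: cyc_def)
    have sd: "{d1,d2,d3} = {p,p',r}" using ds(2) d Cq qn ed(5) by auto
    have ed': "E d1 q" "E d2 d1" "E d3 d2" "E q d3" using ed Esym by blast+
    have "d1 \<in> {p,p',r}" "d2 \<in> {p,p',r}" "d3 \<in> {p,p',r}" using sd by auto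
    then show ?thesis
      using ed ed' cube tw tw' by (elim insertE emptyE) auto
  qed
qed

end

section \<open>Sums of cuts and clique sums\<close>

text \<open>The coordinate \<open>uv\<close> of a sum of cuts. Lists allow repeated cuts and a
  matching of the terms of two sums by position.\<close>

definition sepcount :: "'v set list \<Rightarrow> 'v \<Rightarrow> 'v \<Rightarrow> nat" where
  "sepcount Ss u v = length (filter (\<lambda>S. (u \<in> S) \<noteq> (v \<in> S)) Ss)"

lemma sepcount_simps [simp]:
  "sepcount [] u v = 0"
  "sepcount (xs @ ys) u v = sepcount xs u v + sepcount ys u v"
  "sepcount (replicate n S) u v = (if (u \<in> S) \<noteq> (v \<in> S) then n else 0)"
  by (simp_all add: sepcount_def filter_replicate)

lemma sepcount_same [simp]: "sepcount Ss u u = 0"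
  by (simp add: sepcount_def)

lemma sepcount_commute: "sepcount Ss u v = sepcount Ss v u"
  unfolding sepcount_def by (metis)

lemma sepcount_mset: "mset Ss = mset Ts \<Longrightarrow> sepcount Ss u v = sepcount Ts u v"
  unfolding sepcount_def by (metis mset_filter size_mset)

lemma sepcount_cong:
  assumes "length Ss = length Ts"
    and "\<And>i. i < length Ss \<Longrightarrow> ((u \<in> Ss ! i) \<noteq> (v \<in> Ss ! i)) = ((u \<in> Ts ! i) \<noteq> (v \<in> Ts ! i))"
  shows "sepcount Ss u v = sepcount Ts u v"
  unfolding sepcount_def length_filter_conv_card
  by (rule arg_cong[of _ _ card]) (use assms in auto)

text \<open>Invariant under complementation of \<open>S\<close>; for distinct \<open>a\<close>,
  \<open>b\<close>, \<open>c\<close> it names the one of the four cuts of the triangle that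
  \<open>S\<close> induces.\<close>

definition side_type :: "'v \<Rightarrow> 'v \<Rightarrow> 'v \<Rightarrow> 'v set \<Rightarrow> bool \<times> bool" where
  "side_type a b c S = ((a \<in> S) \<noteq> (b \<in> S), (a \<in> S) \<noteq> (c \<in> S))"

lemma reorder_to_match:
  assumes "mset (map f xs) = mset ys"
  obtains xs' where "mset xs' = mset xs" "map f xs' = ys"
proof -
  have "\<exists>xs'. mset xs' = mset xs \<and> map f xs' = ys"
    using assms
  proof (induction ys arbitrary: xs)
    case Nil then show ?case by auto
  next
    case (Cons y ys)
    have "y \<in> set (map f xs)" using Cons.prems by (metis list.set_intros(1) mset_eq_setD)
    then obtain x where x: "x \<in> set xs" "y = f x" by auto
    then obtain as bs where ab: "xs = as @ x # bs" by (meson split_list)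
    have "mset (map f (as @ bs)) = mset ys" using Cons.prems ab x(2) by simp
    from Cons.IH[OF this] obtain zs where zs: "mset zs = mset (as @ bs)" "map f zs = ys" by auto
    have "mset (x # zs) = mset xs \<and> map f (x # zs) = y # ys" using ab x(2) zs by simp
    then show ?case by (rule exI)
  qed
  then show ?thesis by (elim exE conjE) (rule that)
qed

text \<open>The integer points \<open>y\<close>, even on triangles, of the \<open>t\<close>-fold dilated metric polytope.\<close>

locale even_metric =
  fixes y :: "'v \<Rightarrow> 'v \<Rightarrow> int" and t :: nat
  assumes refl0: "y u u = 0" and comm: "y u v = y v u" and tri: "y u w \<le> y u v + y v w"
    and per: "y u v + y v w + y u w \<le> 2 * int t" and par: "even (y u v + y v w + y u w)"
begin

definition cut_sum :: "'v set \<Rightarrow> ('v \<Rightarrow> 'v \<Rightarrow> bool) \<Rightarrow> bool" where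
  "cut_sum V E \<longleftrightarrow> (\<exists>Ss. length Ss = t \<and> (\<forall>u\<in>V. \<forall>v\<in>V. E u v \<longrightarrow> int (sepcount Ss u v) = y u v))"

lemma cut_sumI:
  "length Ss = t \<Longrightarrow> (\<And>u v. u \<in> V \<Longrightarrow> v \<in> V \<Longrightarrow> E u v \<Longrightarrow> int (sepcount Ss u v) = y u v) \<Longrightarrow> cut_sum V E"
  unfolding cut_sum_def by blast

lemma cut_sum_mono:
  assumes "cut_sum V E" "V' \<subseteq> V" "\<And>u v. u \<in> V' \<Longrightarrow> v \<in> V' \<Longrightarrow> E' u v \<Longrightarrow> E u v"
  shows "cut_sum V' E'"
proof -
  obtain Ss where Ss: "length Ss = t" "\<And>u v. u \<in> V \<Longrightarrow> v \<in> V \<Longrightarrow> E u v \<Longrightarrow> int (sepcount Ss u v) = y u v"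
    using assms(1) unfolding cut_sum_def by blast
  show ?thesis by (rule cut_sumI[OF Ss(1)], rule Ss(2)) (use assms(2,3) in auto)
qed

lemma nonneg: "0 \<le> y u v"
  using tri[of u u v] comm[of v u] refl0[of u] by simp

lemma le_t: "y u v \<le> int t"
  using per[of u v v] refl0[of v] by simp

lemma cut_sum_four:
  assumes d: "distinct [a, b, c, d]"
  shows "cut_sum {a, b, c, d} E"
proof -
  obtain k1 where k1: "y a b + y b c + y a c = 2 * k1" by (rule evenE[OF par[of a b c]])
  obtain k2 where k2: "y a b + y b d + y a d = 2 * k2" by (rule evenE[OF par[of a b d]])
  obtain k3 where k3: "y a c + y c d + y a d = 2 * k3" by (rule evenE[OF par[of a c d]])
  obtain k4 where k4: "y b c + y c d + y b d = 2 * k4" by (rule evenE[OF par[of b c d]])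
  note k = k1 k2 k3 k4
  \<comment> \<open>The multiplicities of the eight cuts of \<open>K4\<close> are determined by the multiplicity \<open>t - q\<close> of the
    empty cut: those of the single vertices grow with \<open>q\<close>, those of the pairs decrease. So \<open>q\<close> is
    chosen as small as possible.\<close>
  define q where "q = max (max k1 k2) (max k3 k4)"
  have qge: "k1 \<le> q" "k2 \<le> q" "k3 \<le> q" "k4 \<le> q" by (auto simp: q_def)
  have q4: "q = k1 \<or> q = k2 \<or> q = k3 \<or> q = k4" by (auto simp: q_def max_def)
  note tris = tri[of a b c] tri[of a b d] tri[of a c b] tri[of a c d] tri[of a d b] tri[of a d c]
    tri[of b c a] tri[of b c d] tri[of b d a] tri[of b d c] tri[of c d a] tri[of c d b]
    comm[of b a] comm[of c a] comm[of d a] comm[of c b] comm[of d b] comm[of d c]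
  have qt: "q \<le> int t" using q4 k per[of a b c] per[of a b d] per[of a c d] per[of b c d] by linarith
  \<comment> \<open>As \<open>q\<close> is one of the four half-perimeters, each of these bounds
    becomes half of a triangle inequality.\<close>
  have nab: "0 \<le> k3 - y c d + k4 - q" using q4 k tris by (elim disjE) linarith+
  have nac: "0 \<le> k2 - y b d + k4 - q" using q4 k tris by (elim disjE) linarith+
  have nad: "0 \<le> k1 - y b c + k4 - q" using q4 k tris by (elim disjE) linarith+
  \<comment> \<open>A half-perimeter counts the terms that split the triangle, since each such term
    separates two of its pairs. The triangle \<open>bcd\<close> is left whole only by the empty cut
    and by \<open>{a}\<close>; hence \<open>k4 = t - n0 - na\<close>, and so on.\<close>
  define n0 na nb nc nd where "n0 = nat (int t - q)" and "na = nat (q - k4)" and "nb = nat (q - k3)"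
    and "nc = nat (q - k2)" and "nd = nat (q - k1)"
  then have n1: "int n0 = int t - q" "int na = q - k4" "int nb = q - k3" "int nc = q - k2" "int nd = q - k1"
    using qt qge by simp_all
  \<comment> \<open>The number of terms with \<open>a\<close> on one side and \<open>c\<close>,
    \<open>d\<close> on the other is \<open>k3 - y c d\<close>; these terms are the cuts
    \<open>{a}\<close> and \<open>{a, b}\<close>. Subtracting \<open>na\<close> gives
    \<open>mb\<close>, and the other two arise likewise.\<close>
  define mb mc md where "mb = nat (k3 - y c d + k4 - q)" and "mc = nat (k2 - y b d + k4 - q)"
    and "md = nat (k1 - y b c + k4 - q)"
  then have n2: "int mb = k3 - y c d + k4 - q" "int mc = k2 - y b d + k4 - q" "int md = k1 - y b c + k4 - q"
    using nab nac nad by simp_all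
  define Ss where "Ss = replicate n0 {} @ replicate na {a} @ replicate nb {b} @ replicate nc {c} @ replicate nd {d} @
    replicate mb {a, b} @ replicate mc {a, c} @ replicate md {a, d}"
  have "int (length Ss) = int n0 + int na + int nb + int nc + int nd + int mb + int mc + int md" by (simp add: Ss_def)
  then have "int (length Ss) = int t + 2 * k4 - (y b c + y c d + y b d)" unfolding n1 n2 by simp
  then have "int (length Ss) = int t" using k4 by linarith
  then have len: "length Ss = t" by simp
  have "int (sepcount Ss a b) = int na + int nb + int mc + int md"
    using d by (auto simp: Ss_def)
  also have "\<dots> = y a b" unfolding n1 n2 using k by linarith
  finally have sab: "int (sepcount Ss a b) = y a b" .
  have "int (sepcount Ss a c) = int na + int nc + int mb + int md"
    using d by (auto simp: Ss_def)
  also have "\<dots> = y a c" unfolding n1 n2 using k by linarith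
  finally have sac: "int (sepcount Ss a c) = y a c" .
  have "int (sepcount Ss a d) = int na + int nd + int mb + int mc"
    using d by (auto simp: Ss_def)
  also have "\<dots> = y a d" unfolding n1 n2 using k by linarith
  finally have sad: "int (sepcount Ss a d) = y a d" .
  have "int (sepcount Ss b c) = int nb + int nc + int mb + int mc"
    using d by (auto simp: Ss_def)
  also have "\<dots> = y b c" unfolding n1 n2 using k by linarith
  finally have sbc: "int (sepcount Ss b c) = y b c" .
  have "int (sepcount Ss b d) = int nb + int nd + int mb + int md"
    using d by (auto simp: Ss_def)
  also have "\<dots> = y b d" unfolding n1 n2 using k by linarith
  finally have sbd: "int (sepcount Ss b d) = y b d" .
  have "int (sepcount Ss c d) = int nc + int nd + int mc + int md"
    using d by (auto simp: Ss_def)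
  also have "\<dots> = y c d" unfolding n1 n2 using k by linarith
  finally have scd: "int (sepcount Ss c d) = y c d" .
  from sab sac sad sbc sbd scd have s: "int (sepcount Ss a b) = y a b" "int (sepcount Ss a c) = y a c" "int (sepcount Ss a d) = y a d"
    "int (sepcount Ss b c) = y b c" "int (sepcount Ss b d) = y b d" "int (sepcount Ss c d) = y c d"
    "int (sepcount Ss b a) = y b a" "int (sepcount Ss c a) = y c a" "int (sepcount Ss d a) = y d a"
    "int (sepcount Ss c b) = y c b" "int (sepcount Ss d b) = y d b" "int (sepcount Ss d c) = y d c"
    by (simp_all add: sepcount_commute[of Ss b a] sepcount_commute[of Ss c a] sepcount_commute[of Ss d a]
        sepcount_commute[of Ss c b] sepcount_commute[of Ss d b] sepcount_commute[of Ss d c]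
        comm[of b a] comm[of c a] comm[of d a] comm[of c b] comm[of d b] comm[of d c])
  show ?thesis by (rule cut_sumI[OF len]) (use s refl0 in auto)
qed

lemma cut_sum_three:
  assumes d: "distinct [a, b, c]"
  shows "cut_sum {a, b, c} E"
proof -
  obtain k where k: "y a b + y b c + y a c = 2 * k" by (rule evenE[OF par[of a b c]])
  note tris = tri[of a b c] tri[of a c b] tri[of b c a] comm[of b a] comm[of c a] comm[of c b]
  have "0 \<le> int t - k" "0 \<le> k - y b c" "0 \<le> k - y a c" "0 \<le> k - y a b"
    using per[of a b c] k tris by linarith+
  moreover define n0 na nb nc where "n0 = nat (int t - k)" and "na = nat (k - y b c)"
    and "nb = nat (k - y a c)" and "nc = nat (k - y a b)"
  ultimately have n: "int n0 = int t - k" "int na = k - y b c" "int nb = k - y a c" "int nc = k - y a b"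
    by simp_all
  define Ss where "Ss = replicate n0 {} @ replicate na {a} @ replicate nb {b} @ replicate nc {c}"
  have "int (length Ss) = int n0 + int na + int nb + int nc" by (simp add: Ss_def)
  then have "int (length Ss) = int t" using n k by linarith
  then have len: "length Ss = t" by simp
  have "int (sepcount Ss a b) = int na + int nb" "int (sepcount Ss a c) = int na + int nc" "int (sepcount Ss b c) = int nb + int nc"
    using d by (auto simp: Ss_def)
  then have "int (sepcount Ss a b) = y a b" "int (sepcount Ss a c) = y a c" "int (sepcount Ss b c) = y b c"
    using n k by linarith+
  then have s: "int (sepcount Ss a b) = y a b" "int (sepcount Ss a c) = y a c" "int (sepcount Ss b c) = y b c"
    "int (sepcount Ss b a) = y b a" "int (sepcount Ss c a) = y c a" "int (sepcount Ss c b) = y c b"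
    by (simp_all add: sepcount_commute[of Ss b a] sepcount_commute[of Ss c a] sepcount_commute[of Ss c b]
        comm[of b a] comm[of c a] comm[of c b])
  show ?thesis by (rule cut_sumI[OF len]) (use s refl0 in auto)
qed

lemma cut_sum_two: "cut_sum {a, b} E"
proof -
  define Ss where "Ss = replicate (nat (int t - y a b)) {} @ replicate (nat (y a b)) {a}"
  have n: "int (nat (int t - y a b)) = int t - y a b" "int (nat (y a b)) = y a b"
    using nonneg le_t by simp_all
  have "int (length Ss) = int t" unfolding Ss_def length_append length_replicate of_nat_add n by simp
  then have len: "length Ss = t" by simp
  have s: "int (sepcount Ss a b) = y a b" using n refl0 by (simp add: Ss_def)
  show ?thesis
    by (rule cut_sumI[OF len]) (use s refl0 comm[of b a] sepcount_commute[of Ss b a] in auto)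
qed

lemma cut_sum_small:
  assumes "finite V" "card V \<le> 4"
  shows "cut_sum V E"
proof -
  consider "card V = 0" | "card V = 1" | "card V = 2" | "card V = 3" | "card V = 4" using assms(2) by linarith
  then show ?thesis
  proof cases
    case 1
    then have "V = {}" using assms(1) by simp
    then show ?thesis using cut_sum_mono[OF cut_sum_two[of undefined undefined E]] by simp
  next
    case 2
    then obtain a where "V = {a}" by (meson card_1_singletonE)
    then show ?thesis using cut_sum_two[of a a E] by simp
  next
    case 3
    then show ?thesis using cut_sum_two by (metis card_2_iff)
  next
    case 4
    then obtain a b c where "V = {a,b,c}" "a \<noteq> b" "b \<noteq> c" "a \<noteq> c" by (metis card_3_iff)
    then show ?thesis using cut_sum_three[of a b c E] by simp
  next
    case 5
    then obtain a W where a: "V = insert a W" "a \<notin> W" "card W = 3"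
      by (metis card_Suc_eq eval_nat_numeral(2) semiring_norm(26,27) numeral_eq_Suc pred_numeral_simps(2))
    then obtain b c d where "W = {b,c,d}" "b \<noteq> c" "c \<noteq> d" "b \<noteq> d" by (metis card_3_iff)
    then show ?thesis using cut_sum_four[of a b c d E] a by simp
  qed
qed

text \<open>Four equations that can be solved for the numbers of terms of the four types; the length
  plays the part of the height coordinate.\<close>

lemma type_counts:
  "sepcount Ss a b = count (mset (map (side_type a b c) Ss)) (True, False) + count (mset (map (side_type a b c) Ss)) (True, True)"
  "sepcount Ss a c = count (mset (map (side_type a b c) Ss)) (False, True) + count (mset (map (side_type a b c) Ss)) (True, True)"
  "sepcount Ss b c = count (mset (map (side_type a b c) Ss)) (True, False) + count (mset (map (side_type a b c) Ss)) (False, True)"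
  "length Ss = count (mset (map (side_type a b c) Ss)) (True, False) + count (mset (map (side_type a b c) Ss)) (True, True)
     + count (mset (map (side_type a b c) Ss)) (False, True) + count (mset (map (side_type a b c) Ss)) (False, False)"
  by (induction Ss) (auto simp: sepcount_def side_type_def)

lemma types_agree:
  assumes "length Ss = length Ts" "sepcount Ss a b = sepcount Ts a b" "sepcount Ss a c = sepcount Ts a c"
    "sepcount Ss b c = sepcount Ts b c"
  shows "mset (map (side_type a b c) Ss) = mset (map (side_type a b c) Ts)" (is "?M = ?M'")
proof (rule multiset_eqI)
  note s = type_counts[where Ss = Ss and a = a and b = b and c = c]
    and t = type_counts[where Ss = Ts and a = a and b = b and c = c]
  have "count ?M (True, False) = count ?M' (True, False) \<and> count ?M (True, True) = count ?M' (True, True) \<and>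
    count ?M (False, True) = count ?M' (False, True) \<and> count ?M (False, False) = count ?M' (False, False)"
    using s t assms by (intro conjI; linarith)
  then show "count ?M x = count ?M' x" for x by (cases x; cases "fst x"; cases "snd x") auto
qed

text \<open>Terms that induce the same cut on \<open>K\<close> are paired and joined. The clique is
  kept in the conclusion, so that a further piece can be glued along the same
  \<open>K\<close>.\<close>

lemma cut_sum_glue:
  assumes 1: "cut_sum V1 (add_clique E K)" and 2: "cut_sum V2 (add_clique E K)"
    and K: "V1 \<inter> V2 = K" "finite K" "card K \<le> 3"
    and cross: "\<And>u v. u \<in> V1 - V2 \<Longrightarrow> v \<in> V2 - V1 \<Longrightarrow> \<not> E u v \<and> \<not> E v u"
  shows "cut_sum (V1 \<union> V2) (add_clique E K)"
proof -
  obtain S1 where S1: "length S1 = t" "\<And>u v. u \<in> V1 \<Longrightarrow> v \<in> V1 \<Longrightarrow> add_clique E K u v \<Longrightarrow> int (sepcount S1 u v) = y u v"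
    using 1 unfolding cut_sum_def by blast
  obtain S2 where S2: "length S2 = t" "\<And>u v. u \<in> V2 \<Longrightarrow> v \<in> V2 \<Longrightarrow> add_clique E K u v \<Longrightarrow> int (sepcount S2 u v) = y u v"
    using 2 unfolding cut_sum_def by blast
  have same: "sepcount S1 u v = sepcount S2 u v" if "u \<in> K" "v \<in> K" for u v
  proof (cases "u = v")
    case False
    then have "add_clique E K u v" using that by (simp add: add_clique_def)
    then have "int (sepcount S1 u v) = int (sepcount S2 u v)" using S1(2) S2(2) that K(1) by (metis IntD1 IntD2)
    then show ?thesis by simp
  qed simp
  \<comment> \<open>If \<open>K\<close> has fewer than three elements, some of \<open>a\<close>,
    \<open>b\<close>, \<open>c\<close> coincide, and for empty \<open>K\<close> all three are one
    arbitrary vertex. For equal vertices \<open>sepcount\<close> is 0 on both sides.\<close>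
  obtain a b c where abc: "K \<subseteq> {a,b,c}" "{a,b,c} \<subseteq> K \<or> (K = {} \<and> a = b \<and> b = c)"
  proof -
    consider "card K = 0" | "card K = 1" | "card K = 2" | "card K = 3" using K(3) by linarith
    then show ?thesis
    proof cases
      case 1
      then have "K = {}" using K(2) by simp
      then show ?thesis using that[of undefined undefined undefined] by simp
    next
      case 2
      then obtain a where "K = {a}" by (meson card_1_singletonE)
      then show ?thesis using that[of a a a] by simp
    next
      case 3
      then obtain a b where "K = {a,b}" by (meson card_2_iff)
      then show ?thesis using that[of a b b] by simp
    next
      case 4
      then obtain a b c where "K = {a,b,c}" by (metis card_3_iff)
      then show ?thesis using that[of a b c] by simp
    qed
  qed
  have same': "sepcount S1 a b = sepcount S2 a b" "sepcount S1 a c = sepcount S2 a c" "sepcount S1 b c = sepcount S2 b c"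
    using abc(2) same by auto
  let ?\<tau> = "side_type a b c"
  have "mset (map ?\<tau> S2) = mset (map ?\<tau> S1)"
    by (rule types_agree) (use S1(1) S2(1) same' in simp_all)
  then obtain S3 where S3: "mset S3 = mset S2" "map ?\<tau> S3 = map ?\<tau> S1" by (rule reorder_to_match)
  have len3: "length S3 = t" using S3(1) S2(1) by (metis size_mset)
  have S3y: "int (sepcount S3 u v) = y u v" if "u \<in> V2" "v \<in> V2" "add_clique E K u v" for u v
    using S2(2)[OF that] sepcount_mset[OF S3(1)] by simp
  have ty: "?\<tau> (S3 ! i) = ?\<tau> (S1 ! i)" if "i < t" for i
    using arg_cong[OF S3(2), of "\<lambda>xs. xs ! i"] that len3 S1(1) by simp
  \<comment> \<open>Equal types fix the trace on \<open>K\<close> up to complement; \<open>G\<close>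
    picks the shore that agrees at \<open>a\<close>, and hence on all of \<open>K\<close>.\<close>
  define G where "G A B = (if (a \<in> A) = (a \<in> B) then B else - B)" for A B :: "'v set"
  define Ss where "Ss = map2 (\<lambda>A B. (A \<inter> V1) \<union> (G A B \<inter> (V2 - V1))) S1 S3"
  have len: "length Ss = t" using len3 S1(1) by (simp add: Ss_def)
  have nth: "Ss ! i = (S1 ! i \<inter> V1) \<union> (G (S1 ! i) (S3 ! i) \<inter> (V2 - V1))" if "i < t" for i
    using that len3 S1(1) by (simp add: Ss_def)
  have in1: "u \<in> Ss ! i \<longleftrightarrow> u \<in> S1 ! i" if "i < t" "u \<in> V1" for u i
    using nth[OF that(1)] that(2) by simp
  have Gk: "u \<in> S1 ! i \<longleftrightarrow> u \<in> G (S1 ! i) (S3 ! i)" if "i < t" "u \<in> K" for u i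
    using ty[OF that(1)] abc(1) that(2) unfolding G_def side_type_def by auto
  have in2: "u \<in> Ss ! i \<longleftrightarrow> u \<in> G (S1 ! i) (S3 ! i)" if "i < t" "u \<in> V2" for u i
    using nth[OF that(1)] that Gk[OF that(1), of u] K(1) by auto
  have c1: "sepcount Ss u v = sepcount S1 u v" if "u \<in> V1" "v \<in> V1" for u v
    by (rule sepcount_cong) (use len S1(1) in1 that in auto)
  have c2: "sepcount Ss u v = sepcount S3 u v" if "u \<in> V2" "v \<in> V2" for u v
    by (rule sepcount_cong) (use len len3 in2 that in \<open>auto simp: G_def\<close>)
  show ?thesis
  proof (rule cut_sumI[OF len])
    fix u v assume uv: "u \<in> V1 \<union> V2" "v \<in> V1 \<union> V2" "add_clique E K u v"
    have "(u \<in> V1 \<and> v \<in> V1) \<or> (u \<in> V2 \<and> v \<in> V2)"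
    proof (cases "E u v")
      case True then show ?thesis using cross[of u v] cross[of v u] uv(1,2) by blast
    next
      case False then show ?thesis using uv(3) K(1) by (auto simp: add_clique_def)
    qed
    then show "int (sepcount Ss u v) = y u v" using c1 c2 S1(2) S3y uv(3) by metis
  qed
qed

text \<open>\<open>y\<close> stays fixed while \<open>V\<close> and \<open>E\<close> vary. As it has
  values on the clique edges too, the induction hypothesis applies to both torsos of a separation,
  and \<open>cut_sum_glue\<close> proves the assumption \<open>sep\<close> of the locale.\<close>

lemma cut_sum_if_not_k5e:
  assumes "finite V" "symp E" "\<And>v. \<not> E v v" "\<not> k5e V E"
  shows "cut_sum V E"
  using assms
proof (induction "card V" arbitrary: V E rule: less_induct)
  case less
  show ?case
  proof (rule ccontr)
    assume nd: "\<not> cut_sum V E"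
    interpret min_k5e_free V E
    proof
      show "finite V" "symp E" "\<not> E v v" "\<not> k5e V E" for v using less.prems by auto
      show "5 \<le> card V" using nd cut_sum_small[OF less.prems(1), of E] by linarith
      fix V1 V2
      assume V: "V1 \<union> V2 = V" "V1 \<noteq> V" "V2 \<noteq> V" "card (V1 \<inter> V2) \<le> 3" "\<forall>u\<in>V1 - V2. \<forall>v\<in>V2 - V1. \<not> E u v"
      let ?K = "V1 \<inter> V2"
      show "k5e V1 (add_clique E ?K) \<or> k5e V2 (add_clique E ?K)"
      proof (rule ccontr)
        assume n: "\<not> ?thesis"
        have fin: "finite V1" "finite V2" using V(1) less.prems(1) by auto
        have "V1 \<subset> V" "V2 \<subset> V" using V by auto
        then have lt: "card V1 < card V" "card V2 < card V" using less.prems(1) psubset_card_mono by blast+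
        have irr: "\<not> add_clique E ?K v v" for v using less.prems(3) by (simp add: add_clique_def)
        have d1: "cut_sum V1 (add_clique E ?K)"
          by (rule less.hyps[OF lt(1) fin(1) symp_add_clique[OF less.prems(2)] irr]) (use n in blast)
        have d2: "cut_sum V2 (add_clique E ?K)"
          by (rule less.hyps[OF lt(2) fin(2) symp_add_clique[OF less.prems(2)] irr]) (use n in blast)
        have "cut_sum (V1 \<union> V2) (add_clique E ?K)"
          by (rule cut_sum_glue[OF d1 d2 HOL.refl _ V(4)]) (use fin V(5) sympD[OF less.prems(2)] in auto)
        then have "cut_sum V E" by (rule cut_sum_mono) (use V(1) in \<open>auto simp: add_clique_def\<close>)
        then show False using nd by blast
      qed
    qed
    \<comment> \<open>With \<open>K\<close> made complete, two vertices of \<open>T\<close> may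
      already produce \<open>K5 - e\<close>, out of reach of the induction hypothesis. But each
      piece \<open>insert s K\<close> has at most four vertices, so the pieces are glued
      directly.\<close>
    obtain K T where KT: "card K = 3" "card T = 3" "V = K \<union> T" "K \<inter> T = {}"
      "\<And>u v. u \<in> K \<Longrightarrow> v \<in> K \<Longrightarrow> \<not> E u v" "\<And>u v. u \<in> T \<Longrightarrow> v \<in> T \<Longrightarrow> \<not> E u v"
      using bipartite_3_3 by metis
    obtain p q r where T: "T = {p,q,r}" "p \<noteq> q" "p \<noteq> r" "q \<noteq> r" using KT(2) by (metis card_3_iff)
    have finK: "finite K" using KT(1) by (metis card.infinite zero_neq_numeral)
    have pK: "p \<notin> K" "q \<notin> K" "r \<notin> K" using KT(4) T(1) by auto
    have one: "cut_sum (insert s K) (add_clique E K)" for s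
      by (rule cut_sum_small) (use finK KT(1) in \<open>auto simp: card_insert_if\<close>)
    have 2: "cut_sum (insert p K \<union> insert q K) (add_clique E K)"
      by (rule cut_sum_glue[OF one one _ finK]) (use pK T KT(1) KT(6)[of p q] KT(6)[of q p] in auto)
    have "cut_sum ((insert p K \<union> insert q K) \<union> insert r K) (add_clique E K)"
      by (rule cut_sum_glue[OF 2 one _ finK])
        (use pK T KT(1) KT(6)[of p r] KT(6)[of r p] KT(6)[of r q] KT(6)[of q r] in auto)
    then have "cut_sum V E" by (rule cut_sum_mono) (use KT(3) T(1) in \<open>auto simp: add_clique_def\<close>)
    then show False using nd by blast
  qed
qed

end

section \<open>Extending edge weights to all pairs\<close>

text \<open>Walks in the double cover in which changing the sheet along an edge \<open>uv\<close> costs \<open>t - x u v\<close>. The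
  odd cycle inequalities of the cut polytope say that changing the sheet along a closed walk costs at
  least \<open>t\<close>. The rule \<open>flip\<close> adds a loop of weight \<open>0\<close> at every vertex.\<close>

inductive signed_walk :: "('v \<Rightarrow> 'v \<Rightarrow> bool) \<Rightarrow> ('v \<Rightarrow> 'v \<Rightarrow> int) \<Rightarrow> int \<Rightarrow> 'v \<Rightarrow> 'v \<Rightarrow> bool \<Rightarrow> int \<Rightarrow> bool"
  for F x t where
  nil: "signed_walk F x t v v False 0"
| flip: "signed_walk F x t u v s k \<Longrightarrow> signed_walk F x t u v (\<not> s) (k + t)"
| step: "signed_walk F x t u v s k \<Longrightarrow> F v w \<Longrightarrow> signed_walk F x t u w (s \<noteq> b) (k + (if b then t - x v w else x v w))"

text \<open>Modulo 2 the weight \<open>x\<close> is the cut given by the vertices with odd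
  \<open>c\<close>, as it must be for a point of the lattice; \<open>c\<close> also prescribes the
  parity on pairs still to be added.\<close>

definition feasible :: "('v \<Rightarrow> 'v \<Rightarrow> bool) \<Rightarrow> ('v \<Rightarrow> 'v \<Rightarrow> int) \<Rightarrow> int \<Rightarrow> ('v \<Rightarrow> int) \<Rightarrow> bool" where
  "feasible F x t c \<longleftrightarrow> (\<forall>u v. F u v \<longrightarrow> F v u \<and> x u v = x v u \<and> 0 \<le> x u v \<and> x u v \<le> t \<and> even (x u v + c u + c v))
     \<and> (\<forall>v k. signed_walk F x t v v True k \<longrightarrow> t \<le> k)"

lemma feasibleD:
  assumes "feasible F x t c" "F u v"
  shows "F v u" "x u v = x v u" "0 \<le> x u v" "x u v \<le> t" "even (x u v + c u + c v)"
  using assms unfolding feasible_def by blast+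

lemma feasible_closed: "feasible F x t c \<Longrightarrow> signed_walk F x t v v True k \<Longrightarrow> t \<le> k"
  unfolding feasible_def by blast

lemma signed_walk_trans:
  assumes "signed_walk F x t v w s' k'" "signed_walk F x t u v s k"
  shows "signed_walk F x t u w (s \<noteq> s') (k + k')"
  using assms
proof (induction rule: signed_walk.induct)
  case (nil v) then show ?case by simp
next
  case (flip v w s' k')
  then have "signed_walk F x t u w (\<not> (s \<noteq> s')) (k + k' + t)" by (intro signed_walk.flip)
  then show ?case by (simp add: add.assoc)
next
  case (step v w s' k' z b)
  then have "signed_walk F x t u z ((s \<noteq> s') \<noteq> b) (k + k' + (if b then t - x w z else x w z))" by (intro signed_walk.step)
  then show ?case by (cases b) (simp_all add: add.assoc)
qed

lemma signed_walk_single: "F v w \<Longrightarrow> signed_walk F x t v w b (if b then t - x v w else x v w)"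
  using signed_walk.step[OF signed_walk.nil, of F v w x t b] by simp

lemma signed_walk_sym:
  assumes "feasible F x t c" "signed_walk F x t u v s k"
  shows "signed_walk F x t v u s k"
  using assms(2)
proof (induction rule: signed_walk.induct)
  case (nil v) then show ?case by (rule signed_walk.nil)
next
  case (flip u v s k) then show ?case by (intro signed_walk.flip)
next
  case (step u v s k w b)
  have "signed_walk F x t w v b (if b then t - x w v else x w v)" by (rule signed_walk_single) (rule feasibleD(1)[OF assms(1) step(2)])
  from signed_walk_trans[OF step(3) this] show ?case
    using feasibleD(2)[OF assms(1) step(2)] by (cases b) (simp_all add: add.commute)
qed

lemma signed_walk_nonneg:
  assumes "feasible F x t c" "0 \<le> t" "signed_walk F x t u v s k"
  shows "0 \<le> k"
  using assms(3)
proof (induction rule: signed_walk.induct)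
  case (step u v s k w b)
  then show ?case using feasibleD(3,4)[OF assms(1) step(2)] by (cases b) auto
qed (use assms(2) in auto)

lemma signed_walk_parity:
  assumes "feasible F x t c" "signed_walk F x t u v s k"
  shows "even (k + c u + c v + (if s then t else 0))"
  using assms(2)
proof (induction rule: signed_walk.induct)
  case (step u v s k w b)
  then show ?case using feasibleD(5)[OF assms(1) step(2)] by (cases b; cases s) auto
qed auto

text \<open>The interval of admissible values is bounded by lengths of walks, all of which have the
  parity prescribed by \<open>c\<close>; only the bound \<open>0 \<le> y\<close> may have the wrong parity, which is why
  \<open>0\<close> is replaced by the residue of \<open>c p + c q\<close>.\<close>

lemma admissible_value:
  assumes f: "feasible F x t c" and t: "1 \<le> t"
  obtains y where "0 \<le> y" "y \<le> t" "even (y + c p + c q)"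
    "\<And>k. signed_walk F x t p q False k \<Longrightarrow> y \<le> k" "\<And>k. signed_walk F x t p q True k \<Longrightarrow> t - y \<le> k"
proof -
  define r where "r = (c p + c q) mod 2"
  have r: "0 \<le> r" "r \<le> 1" "even (r + c p + c q)" unfolding r_def by (simp_all, presburger+)
  have t0: "0 \<le> t" using t by simp
  have up: "r \<le> k" if "signed_walk F x t p q False k" for k
  proof -
    have "even (k + c p + c q)" using signed_walk_parity[OF f that] by simp
    then have "even (k - r)" using r(3) by presburger
    moreover have "0 \<le> k" by (rule signed_walk_nonneg[OF f t0 that])
    ultimately show ?thesis using r(1,2) by presburger
  qed
  show ?thesis
  proof (cases "\<exists>k. signed_walk F x t p q True k")
    case False
    then show ?thesis using that[of r] r t up by auto
  next
    case True
    then obtain k0 where "signed_walk F x t p q True k0" by blast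
    then have "\<exists>b. signed_walk F x t p q True b \<and> (\<forall>k. signed_walk F x t p q True k \<longrightarrow> nat b \<le> nat k)"
      by (rule ex_has_least_nat)
    then obtain b where b: "signed_walk F x t p q True b" "\<And>k. signed_walk F x t p q True k \<Longrightarrow> nat b \<le> nat k" by blast
    have b0: "0 \<le> b" by (rule signed_walk_nonneg[OF f t0 b(1)])
    have le: "b \<le> k" if "signed_walk F x t p q True k" for k
      using b(2)[OF that] signed_walk_nonneg[OF f t0 that] b0 by simp
    have eb: "even (t - b + c p + c q)" using signed_walk_parity[OF f b(1)] by simp presburger
    \<comment> \<open>\<open>b\<close> is the least length of a walk from \<open>p\<close> to
      \<open>q\<close> that changes the sheet, so \<open>t - b\<close> is the largest lower bound.
      It lies below every upper bound \<open>k\<close>, since the two walks combine to a closed one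
      that changes the sheet.\<close>
    show ?thesis
    proof (rule that[of "max (t - b) r"])
      show "0 \<le> max (t - b) r" "max (t - b) r \<le> t" using r b0 t by auto
      show "even (max (t - b) r + c p + c q)" using eb r(3) by (simp add: max_def)
      show "t - max (t - b) r \<le> k" if "signed_walk F x t p q True k" for k using le[OF that] by simp
      show "max (t - b) r \<le> k" if "signed_walk F x t p q False k" for k
      proof -
        have "signed_walk F x t p p True (k + b)" using signed_walk_trans[OF signed_walk_sym[OF f b(1)] that] by simp
        then have "t \<le> k + b" by (rule feasible_closed[OF f])
        then show ?thesis using up[OF that] by simp
      qed
    qed
  qed
qed

section \<open>Adding one pair to a feasible weight\<close>

text \<open>A walk through the new edge \<open>pq\<close> can be replaced by one, not longer, which uses it at most once.\<close>

definition via :: "('v \<Rightarrow> 'v \<Rightarrow> bool) \<Rightarrow> ('v \<Rightarrow> 'v \<Rightarrow> int) \<Rightarrow> int \<Rightarrow> int \<Rightarrow> 'v \<Rightarrow> 'v \<Rightarrow> 'v \<Rightarrow> 'v \<Rightarrow> bool \<Rightarrow> int \<Rightarrow> bool" where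
  "via F x t y p q a d s k \<longleftrightarrow> (\<exists>b s1 k1 s2 k2. signed_walk F x t a p s1 k1 \<and> signed_walk F x t q d s2 k2 \<and>
     s = ((s1 \<noteq> b) \<noteq> s2) \<and> k1 + (if b then t - y else y) + k2 \<le> k)"

definition reduced_walk :: "('v \<Rightarrow> 'v \<Rightarrow> bool) \<Rightarrow> ('v \<Rightarrow> 'v \<Rightarrow> int) \<Rightarrow> int \<Rightarrow> int \<Rightarrow> 'v \<Rightarrow> 'v \<Rightarrow> 'v \<Rightarrow> 'v \<Rightarrow> bool \<Rightarrow> int \<Rightarrow> bool" where
  "reduced_walk F x t y p q a d s k \<longleftrightarrow> (\<exists>k'\<le>k. signed_walk F x t a d s k') \<or> via F x t y p q a d s k \<or> via F x t y q p a d s k"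

lemma via_extend:
  assumes "via F x t y p q a d s k" "signed_walk F x t d e s' k'"
  shows "via F x t y p q a e (s \<noteq> s') (k + k')"
proof -
  obtain b s1 k1 s2 k2 where v: "signed_walk F x t a p s1 k1" "signed_walk F x t q d s2 k2"
    "s = ((s1 \<noteq> b) \<noteq> s2)" "k1 + (if b then t - y else y) + k2 \<le> k"
    using assms(1) unfolding via_def by blast
  have "signed_walk F x t q e (s2 \<noteq> s') (k2 + k')" by (rule signed_walk_trans[OF assms(2) v(2)])
  moreover have "(s \<noteq> s') = ((s1 \<noteq> b) \<noteq> (s2 \<noteq> s'))" using v(3) by blast
  moreover have "k1 + (if b then t - y else y) + (k2 + k') \<le> k + k'" using v(4) by simp
  ultimately show ?thesis unfolding via_def using v(1) by blast
qed

lemma reduced_walk_extend: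
  assumes "reduced_walk F x t y p q a d s k" "signed_walk F x t d e s' k'"
  shows "reduced_walk F x t y p q a e (s \<noteq> s') (k + k')"
proof -
  consider k0 where "k0 \<le> k" "signed_walk F x t a d s k0" | "via F x t y p q a d s k" | "via F x t y q p a d s k"
    using assms(1) unfolding reduced_walk_def by blast
  then show ?thesis
  proof cases
    case 1
    have "signed_walk F x t a e (s \<noteq> s') (k0 + k')" by (rule signed_walk_trans[OF assms(2) 1(2)])
    moreover have "k0 + k' \<le> k + k'" using 1(1) by simp
    ultimately show ?thesis unfolding reduced_walk_def by blast
  next
    case 2 then show ?thesis using via_extend[OF 2 assms(2)] unfolding reduced_walk_def by blast
  next
    case 3 then show ?thesis using via_extend[OF 3 assms(2)] unfolding reduced_walk_def by blast
  qed
qed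

text \<open>If \<open>pq\<close> was used before, the walk from \<open>q\<close> back to
  \<open>p\<close> in between is removed with one of the two passages. When the sheet of the other
  passage has to be changed, assumption \<open>A\<close> shows that the removed length is at least
  \<open>t\<close>. If \<open>qp\<close> was used before, both passages and the closed walk at
  \<open>p\<close> are removed, possibly at the price of a \<open>flip\<close>; then either the
  closed walk or the two passages together cost at least \<open>t\<close>.\<close>

lemma reduced_walk_new_edge:
  assumes f: "feasible F x t c" and y: "0 \<le> y" "y \<le> t"
    and A: "\<And>s k. signed_walk F x t p q s k \<Longrightarrow> (if s then t - y else y) \<le> k"
    and n: "reduced_walk F x t y p q a p s k"
  shows "reduced_walk F x t y p q a q (s \<noteq> b) (k + (if b then t - y else y))"
proof -
  have t0: "0 \<le> t" using y by simp
  let ?l = "\<lambda>b. if b then t - y else y"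
  have l: "0 \<le> ?l b" "?l b \<le> t" for b using y by auto
  have lt: "?l (\<not> b) + ?l b = t" for b by simp
  consider (old) k0 where "k0 \<le> k" "signed_walk F x t a p s k0" | (pq) "via F x t y p q a p s k" | (qp) "via F x t y q p a p s k"
    using n unfolding reduced_walk_def by blast
  then show ?thesis
  proof cases
    case old
    have "via F x t y p q a q (s \<noteq> b) (k + ?l b)"
      unfolding via_def
      by (rule exI[of _ b], rule exI[of _ s], rule exI[of _ k0], rule exI[of _ False], rule exI[of _ 0])
        (use old signed_walk.nil[of F x t q] in auto)
    then show ?thesis unfolding reduced_walk_def by blast
  next
    case pq
    then obtain b1 s1 k1 s2 k2 where v: "signed_walk F x t a p s1 k1" "signed_walk F x t q p s2 k2"
      "s = ((s1 \<noteq> b1) \<noteq> s2)" "k1 + ?l b1 + k2 \<le> k" unfolding via_def by blast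
    have k2: "0 \<le> k2" by (rule signed_walk_nonneg[OF f t0 v(2)])
    define b' where "b' = (if s2 = b then b1 else \<not> b1)"
    have "(s \<noteq> b) = ((s1 \<noteq> b') \<noteq> False)" using v(3) by (auto simp: b'_def)
    moreover have "k1 + ?l b' + 0 \<le> k + ?l b"
    proof (cases "s2 = b")
      case True
      then show ?thesis using v(4) k2 l(1)[of b] by (simp add: b'_def)
    next
      case False
      have "?l s2 \<le> k2" by (rule A[OF signed_walk_sym[OF f v(2)]])
      moreover have "?l s2 + ?l b = t" using False by auto
      moreover have "?l b' \<le> t" by (rule l(2))
      ultimately show ?thesis using v(4) l(1)[of b1] by linarith
    qed
    ultimately have "via F x t y p q a q (s \<noteq> b) (k + ?l b)"
      unfolding via_def using v(1) signed_walk.nil[of F x t q] by blast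
    then show ?thesis unfolding reduced_walk_def by blast
  next
    case qp
    then obtain b1 s1 k1 s2 k2 where v: "signed_walk F x t a q s1 k1" "signed_walk F x t p p s2 k2"
      "s = ((s1 \<noteq> b1) \<noteq> s2)" "k1 + ?l b1 + k2 \<le> k" unfolding via_def by blast
    have k2: "0 \<le> k2" by (rule signed_walk_nonneg[OF f t0 v(2)])
    show ?thesis
    proof (cases "(b1 \<noteq> s2) = b")
      case True
      then have "(s \<noteq> b) = s1" using v(3) by blast
      moreover have "k1 \<le> k + ?l b" using v(4) k2 l(1)[of b] l(1)[of b1] by linarith
      ultimately show ?thesis unfolding reduced_walk_def using v(1) by blast
    next
      case False
      then have "(s \<noteq> b) = (\<not> s1)" using v(3) by blast
      moreover have "signed_walk F x t a q (\<not> s1) (k1 + t)" by (rule signed_walk.flip[OF v(1)])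
      moreover have "t \<le> ?l b1 + k2 + ?l b"
      proof (cases s2)
        case True
        then have "t \<le> k2" using feasible_closed[OF f, of p k2] v(2) by simp
        then show ?thesis using l(1)[of b] l(1)[of b1] by linarith
      next
        case s2: False
        then have "?l b1 + ?l b = t" using False by auto
        then show ?thesis using k2 by linarith
      qed
      then have "k1 + t \<le> k + ?l b" using v(4) by linarith
      ultimately show ?thesis unfolding reduced_walk_def by auto
    qed
  qed
qed

lemma reduced_walk_swap: "reduced_walk F x t y p q a d s k \<Longrightarrow> reduced_walk F x t y q p a d s k"
  unfolding reduced_walk_def by blast

text \<open>A closed walk may be assumed to use the new pair at most once. If it does so, the rest
  of it is an old walk between the ends of the pair, and its length was taken into account in
  \<open>admissible_value\<close>.\<close>

lemma feasible_add_pair: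
  assumes f: "feasible F x t c" and t: "1 \<le> t"
  obtains x' where "feasible (\<lambda>a b. F a b \<or> (a = p \<and> b = q) \<or> (a = q \<and> b = p)) x' t c" "\<And>a b. F a b \<Longrightarrow> x' a b = x a b"
proof (cases "F p q")
  case True
  then have "F q p" using feasibleD(1)[OF f] by blast
  then have "(\<lambda>a b. F a b \<or> (a = p \<and> b = q) \<or> (a = q \<and> b = p)) = F" using True by (intro ext) blast
  then show ?thesis using that[of x] f by simp
next
  case nF: False
  then have nF': "\<not> F q p" using feasibleD(1)[OF f] by blast
  obtain y where y: "0 \<le> y" "y \<le> t" "even (y + c p + c q)"
    "\<And>k. signed_walk F x t p q False k \<Longrightarrow> y \<le> k" "\<And>k. signed_walk F x t p q True k \<Longrightarrow> t - y \<le> k"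
    using admissible_value[OF f t] by metis
  have A: "(if s then t - y else y) \<le> k" if "signed_walk F x t p q s k" for s k using y(4,5) that by (cases s) auto
  have A': "(if s then t - y else y) \<le> k" if "signed_walk F x t q p s k" for s k by (rule A[OF signed_walk_sym[OF f that]])
  let ?F = "\<lambda>a b. F a b \<or> (a = p \<and> b = q) \<or> (a = q \<and> b = p)"
  define x' where "x' a b = (if (a = p \<and> b = q) \<or> (a = q \<and> b = p) then y else x a b)" for a b
  have old: "x' a b = x a b" if "F a b" for a b using that nF nF' by (auto simp: x'_def)
  have reduced_walk: "reduced_walk F x t y p q a d s k" if "signed_walk ?F x' t a d s k" for a d s k
    using that
  proof (induction rule: signed_walk.induct)
    case (nil v) then show ?case unfolding reduced_walk_def using signed_walk.nil[of F x t v] by auto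
  next
    case (flip u v s k)
    have "signed_walk F x t v v True t" using signed_walk.flip[OF signed_walk.nil[of F x t v]] by simp
    from reduced_walk_extend[OF flip(2) this] show ?case by simp
  next
    case (step u v s k w b)
    consider "F v w" | "\<not> F v w" "v = p" "w = q" | "\<not> F v w" "v = q" "w = p" using step(2) by blast
    then show ?case
    proof cases
      case 1
      have "signed_walk F x t v w b (if b then t - x v w else x v w)" by (rule signed_walk_single[of F, OF 1])
      from reduced_walk_extend[OF step(3) this] show ?thesis unfolding old[OF 1] .
    next
      case 2
      have "reduced_walk F x t y p q u q (s \<noteq> b) (k + (if b then t - y else y))"
        by (rule reduced_walk_new_edge[OF f y(1,2) A]) (use step(3) 2 in auto)
      moreover have "x' v w = y" using 2 by (simp add: x'_def)
      ultimately show ?thesis using 2(3) by metis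
    next
      case 3
      have "reduced_walk F x t y q p u p (s \<noteq> b) (k + (if b then t - y else y))"
        by (rule reduced_walk_new_edge[OF f y(1,2) A']) (use reduced_walk_swap[OF step(3)] 3 in auto)
      then have "reduced_walk F x t y p q u p (s \<noteq> b) (k + (if b then t - y else y))" by (rule reduced_walk_swap)
      moreover have "x' v w = y" using 3 by (simp add: x'_def)
      ultimately show ?thesis using 3(3) by metis
    qed
  qed
  have closed_via: "t \<le> k" if v: "via F x t y p' q' v v True k"
    and A: "\<And>s k. signed_walk F x t q' p' s k \<Longrightarrow> (if s then t - y else y) \<le> k" for p' q' v k
  proof -
    obtain b s1 k1 s2 k2 where w: "signed_walk F x t v p' s1 k1" "signed_walk F x t q' v s2 k2"
      "True = ((s1 \<noteq> b) \<noteq> s2)" "k1 + (if b then t - y else y) + k2 \<le> k"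
      using v unfolding via_def by blast
    have "(if (s2 \<noteq> s1) then t - y else y) \<le> k2 + k1" by (rule A[OF signed_walk_trans[OF w(1,2)]])
    moreover have "(s2 \<noteq> s1) = (\<not> b)" using w(3) by blast
    ultimately show ?thesis using w(4) by (cases b) auto
  qed
  have "t \<le> k" if wvv: "signed_walk ?F x' t v v True k" for v k
  proof -
    consider k0 where "k0 \<le> k" "signed_walk F x t v v True k0" | "via F x t y p q v v True k" | "via F x t y q p v v True k"
      using reduced_walk[OF wvv] unfolding reduced_walk_def by blast
    then show ?thesis
    proof cases
      case 1 then show ?thesis using feasible_closed[OF f 1(2)] by simp
    next
      case 2 then show ?thesis by (rule closed_via) (rule A')
    next
      case 3 then show ?thesis by (rule closed_via) (rule A)
    qed
  qed
  moreover have "?F v u \<and> x' u v = x' v u \<and> 0 \<le> x' u v \<and> x' u v \<le> t \<and> even (x' u v + c u + c v)" if "?F u v" for u v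
  proof (cases "F u v")
    case True
    then show ?thesis using feasibleD[OF f True] old[OF True] old[of v u] by simp
  next
    case False
    then have "(u = p \<and> v = q) \<or> (u = q \<and> v = p)" using that by blast
    then show ?thesis using y(1-3) by (auto simp: x'_def add.assoc add.commute add.left_commute)
  qed
  ultimately have "feasible ?F x' t c" unfolding feasible_def by blast
  then show ?thesis using that old by blast
qed

lemma feasible_add_pairs:
  assumes "finite Q" "feasible F x t c" "1 \<le> t"
  shows "\<exists>x'. feasible (\<lambda>a b. F a b \<or> (a, b) \<in> Q \<or> (b, a) \<in> Q) x' t c \<and> (\<forall>a b. F a b \<longrightarrow> x' a b = x a b)"
  using assms(1)
proof (induction rule: finite_induct)
  case empty
  then show ?case using assms(2) by auto
next
  case (insert e Q)
  obtain p q where e: "e = (p, q)" by (cases e)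
  let ?F = "\<lambda>a b. F a b \<or> (a, b) \<in> Q \<or> (b, a) \<in> Q"
  obtain x1 where x1: "feasible ?F x1 t c" "\<forall>a b. F a b \<longrightarrow> x1 a b = x a b" using insert.IH by blast
  obtain x2 where x2: "feasible (\<lambda>a b. ?F a b \<or> (a = p \<and> b = q) \<or> (a = q \<and> b = p)) x2 t c" "\<And>a b. ?F a b \<Longrightarrow> x2 a b = x1 a b"
    using feasible_add_pair[OF x1(1) assms(3)] by blast
  have "(\<lambda>a b. ?F a b \<or> (a = p \<and> b = q) \<or> (a = q \<and> b = p)) = (\<lambda>a b. F a b \<or> (a, b) \<in> insert e Q \<or> (b, a) \<in> insert e Q)"
    using e by (intro ext) auto
  then have "feasible (\<lambda>a b. F a b \<or> (a, b) \<in> insert e Q \<or> (b, a) \<in> insert e Q) x2 t c" using x2(1) by simp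
  moreover have "\<forall>a b. F a b \<longrightarrow> x2 a b = x a b" using x1(2) x2(2) by simp
  ultimately show ?case by blast
qed

text \<open>A triangle traversed with one change of sheet gives the triangle inequality, with three
  changes the perimeter inequality; a loop at \<open>u\<close> that changes the sheet forces
  \<open>y u u = 0\<close>.\<close>

lemma even_metric_of_feas:
  assumes f: "feasible (\<lambda>_ _. True) y (int t) c"
  shows "even_metric y t"
proof
  let ?w = "signed_walk (\<lambda>_ _. True) y (int t)"
  have w: "?w u v b (if b then int t - y u v else y u v)" for u v b by (rule signed_walk_single) simp
  have w0: "?w u v False (y u v)" and w1: "?w u v True (int t - y u v)" for u v
    using w[of u v False] w[of u v True] by simp_all
  show "y u u = 0" for u
    using feasible_closed[OF f w1[of u u]] feasibleD(3)[OF f, of u u] by simp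
  show "y u v = y v u" for u v by (rule feasibleD(2)[OF f]) simp
  show "y u w \<le> y u v + y v w" for u v w
  proof -
    have "?w u w False (y u v + y v w)" using signed_walk_trans[OF w0[of v w] w0[of u v]] by simp
    from signed_walk_trans[OF w1[of w u] this] have "int t \<le> y u v + y v w + (int t - y w u)"
      by (intro feasible_closed[OF f]) simp
    then show ?thesis using feasibleD(2)[OF f, of w u] by simp
  qed
  show "y u v + y v w + y u w \<le> 2 * int t" for u v w
  proof -
    have "?w u w False ((int t - y u v) + (int t - y v w))" using signed_walk_trans[OF w1[of v w] w1[of u v]] by simp
    from signed_walk_trans[OF w1[of w u] this] have "int t \<le> (int t - y u v) + (int t - y v w) + (int t - y w u)"
      by (intro feasible_closed[OF f]) simp
    then show ?thesis using feasibleD(2)[OF f, of w u] by simp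
  qed
  show "even (y u v + y v w + y u w)" for u v w
    using feasibleD(5)[OF f, of u v] feasibleD(5)[OF f, of v w] feasibleD(5)[OF f, of u w] by simp presburger
qed

text \<open>For a single cut of weight 1, a step costs 1 exactly if crossing the cut and changing
  the sheet disagree, and a flip costs 1. Exclusive or is subadditive, and the weighted sum over all
  cuts gives the bound. For closed walks it yields the odd cycle inequalities.\<close>

lemma signed_walk_cone_bound:
  fixes l :: "'i \<Rightarrow> real" and S :: "'i \<Rightarrow> 'v set"
  assumes "finite I" "\<And>i. i \<in> I \<Longrightarrow> 0 \<le> l i"
    and x: "\<And>u v. F u v \<Longrightarrow> real_of_int (x u v) = (\<Sum>i\<in>I. l i * of_bool ((u \<in> S i) \<noteq> (v \<in> S i)))"
    and t: "real_of_int t = (\<Sum>i\<in>I. l i)"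
    and w: "signed_walk F x t u v s k"
  shows "(\<Sum>i\<in>I. l i * of_bool (((u \<in> S i) \<noteq> (v \<in> S i)) \<noteq> s)) \<le> real_of_int k"
  using w
proof (induction rule: signed_walk.induct)
  case (nil v) then show ?case by simp
next
  case (flip u v s k)
  have "(\<Sum>i\<in>I. l i * of_bool (((u \<in> S i) \<noteq> (v \<in> S i)) \<noteq> (\<not> s))) \<le> (\<Sum>i\<in>I. l i)"
    by (rule sum_mono) (simp add: assms(2))
  moreover have "0 \<le> (\<Sum>i\<in>I. l i * of_bool (((u \<in> S i) \<noteq> (v \<in> S i)) \<noteq> s))"
    by (rule sum_nonneg) (simp add: assms(2))
  ultimately show ?case using flip.IH t by simp
next
  case (step u v s k w b)
  have len: "real_of_int (if b then t - x v w else x v w) = (\<Sum>i\<in>I. l i * of_bool (((v \<in> S i) \<noteq> (w \<in> S i)) \<noteq> b))"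
  proof (cases b)
    case True
    have "(\<Sum>i\<in>I. l i) - (\<Sum>i\<in>I. l i * of_bool ((v \<in> S i) \<noteq> (w \<in> S i))) = (\<Sum>i\<in>I. l i * of_bool (((v \<in> S i) \<noteq> (w \<in> S i)) \<noteq> True))"
      unfolding sum_subtractf[symmetric] by (rule sum.cong) auto
    then show ?thesis using True x[OF step(2)] t by simp
  next
    case False
    then show ?thesis using x[OF step(2)] by simp
  qed
  have "(\<Sum>i\<in>I. l i * of_bool (((u \<in> S i) \<noteq> (w \<in> S i)) \<noteq> (s \<noteq> b))) \<le>
     (\<Sum>i\<in>I. l i * of_bool (((u \<in> S i) \<noteq> (v \<in> S i)) \<noteq> s) + l i * of_bool (((v \<in> S i) \<noteq> (w \<in> S i)) \<noteq> b))"
    by (rule sum_mono) (use assms(2) in \<open>auto simp: of_bool_def\<close>)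
  also have "\<dots> \<le> real_of_int k + real_of_int (if b then t - x v w else x v w)"
    unfolding sum.distrib len using step.IH by simp
  finally show ?case by simp
qed

text \<open>Cone and lattice enter separately: the weights \<open>l\<close> provide the
  inequalities, the integers \<open>x\<close> with the potential \<open>c\<close> the
  parities.\<close>

lemma even_metric_extension:
  fixes l :: "'i \<Rightarrow> real" and S :: "'i \<Rightarrow> 'v::finite set"
  assumes I: "finite I" "\<And>i. i \<in> I \<Longrightarrow> 0 \<le> l i"
    and F: "\<And>u v. F u v \<Longrightarrow> F v u"
    and x: "\<And>u v. F u v \<Longrightarrow> real_of_int (x u v) = (\<Sum>i\<in>I. l i * of_bool ((u \<in> S i) \<noteq> (v \<in> S i)))"
    and t: "real t = (\<Sum>i\<in>I. l i)" "1 \<le> t"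
    and par: "\<And>u v. F u v \<Longrightarrow> even (x u v + c u + c v)"
  obtains y where "even_metric y t" "\<And>u v. F u v \<Longrightarrow> y u v = x u v"
proof -
  have "feasible F x (int t) c"
    unfolding feasible_def
  proof (intro conjI allI impI)
    fix u v assume uv: "F u v"
    show "F v u" by (rule F[OF uv])
    have "real_of_int (x u v) = real_of_int (x v u)"
      unfolding x[OF uv] x[OF F[OF uv]] by (rule sum.cong) auto
    then show "x u v = x v u" by simp
    have "0 \<le> real_of_int (x u v)" unfolding x[OF uv] by (rule sum_nonneg) (simp add: I(2))
    then show "0 \<le> x u v" by simp
    have "real_of_int (x u v) \<le> real t" unfolding x[OF uv] t(1) by (rule sum_mono) (simp add: I(2))
    then show "x u v \<le> int t" by linarith
    show "even (x u v + c u + c v)" by (rule par[OF uv])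
  next
    fix v k assume "signed_walk F x (int t) v v True k"
    then have "(\<Sum>i\<in>I. l i * of_bool (((v \<in> S i) \<noteq> (v \<in> S i)) \<noteq> True)) \<le> real_of_int k"
      by (intro signed_walk_cone_bound[of I l F x S "int t"]) (use I x t(1) in auto)
    then have "real t \<le> real_of_int k" using t(1) by simp
    then show "int t \<le> k" by linarith
  qed
  then obtain y where y: "feasible (\<lambda>a b. F a b \<or> (a, b) \<in> (UNIV :: ('v \<times> 'v) set) \<or> (b, a) \<in> (UNIV :: ('v \<times> 'v) set)) y (int t) c"
    "\<forall>a b. F a b \<longrightarrow> y a b = x a b"
    using feasible_add_pairs[of UNIV F x "int t" c] t(2) by auto
  then have "even_metric y t" by (intro even_metric_of_feas) simp
  then show ?thesis using that y(2) by blast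
qed

section \<open>From branch sets to minors, and the polytope\<close>

definition adj :: "'a graph \<Rightarrow> 'a \<Rightarrow> 'a \<Rightarrow> bool" where
  "adj G u v \<longleftrightarrow> {u, v} \<in> edges G"

lemma adj_sym: "symp (adj G)"
  unfolding symp_def adj_def by (simp add: insert_commute)

lemma adj_irrefl: "simple_graph G \<Longrightarrow> \<not> adj G v v"
  unfolding simple_graph_def adj_def by auto

lemma adj_verts: "simple_graph G \<Longrightarrow> adj G u v \<Longrightarrow> u \<in> verts G \<and> v \<in> verts G"
  unfolding simple_graph_def adj_def by auto

lemma finite_edges: "simple_graph G \<Longrightarrow> finite (edges G)"
  unfolding simple_graph_def by (rule finite_subset[of _ "Pow (verts G)"]) auto

lemma conn_set_image:
  assumes "conn_set E B" "\<And>a b. a \<in> B \<Longrightarrow> b \<in> B \<Longrightarrow> E a b \<Longrightarrow> r a \<noteq> r b \<Longrightarrow> E' (r a) (r b)"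
  shows "conn_set E' (r ` B)"
  unfolding conn_set_def
proof (intro conjI allI impI)
  show "r ` B \<noteq> {}" using conn_set_nonempty[OF assms(1)] by simp
  fix T assume T: "T \<subseteq> r ` B \<and> T \<noteq> {} \<and> T \<noteq> r ` B"
  have h: "{b \<in> B. r b \<in> T} \<subseteq> B" "{b \<in> B. r b \<in> T} \<noteq> {}" "{b \<in> B. r b \<in> T} \<noteq> B" using T by blast+
  obtain a b where ab: "a \<in> {b \<in> B. r b \<in> T}" "b \<in> B" "b \<notin> {b \<in> B. r b \<in> T}" "E a b"
    by (rule conn_setE[OF assms(1) h])
  then have "r a \<in> T" "r b \<notin> T" "a \<in> B" by auto
  moreover have "E' (r a) (r b)" by (rule assms(2)) (use ab calculation in auto)
  ultimately show "\<exists>u\<in>T. \<exists>v\<in>r ` B - T. E' u v" using ab(2) by blast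
qed

text \<open>Stated for a map \<open>r\<close> in order to cover both the deletion of a vertex, with
  \<open>r = id\<close>, and the contraction of an edge inside a branch set.\<close>

lemma k5e_model_image:
  assumes "k5e_model E A B C D F"
    and e: "\<And>a b. a \<in> A \<union> B \<union> C \<union> D \<union> F \<Longrightarrow> b \<in> A \<union> B \<union> C \<union> D \<union> F \<Longrightarrow> E a b \<Longrightarrow> r a \<noteq> r b \<Longrightarrow> E' (r a) (r b)"
    and d: "\<And>X Y. X \<in> {A, B, C, D, F} \<Longrightarrow> Y \<in> {A, B, C, D, F} \<Longrightarrow> X \<inter> Y = {} \<Longrightarrow> r ` X \<inter> r ` Y = {}"
  shows "k5e_model E' (r ` A) (r ` B) (r ` C) (r ` D) (r ` F)"
proof -
  let ?M = "{A, B, C, D, F}"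
  have sub: "X \<subseteq> A \<union> B \<union> C \<union> D \<union> F" if "X \<in> ?M" for X using that by auto
  have c: "conn_set E' (r ` X)" if "X \<in> ?M" for X
  proof (rule conn_set_image)
    have "\<forall>X\<in>?M. conn_set E X" using assms(1) unfolding k5e_model_def by (rule conjunct1)
    then show "conn_set E X" using that by (rule bspec)
    fix a b assume ab: "a \<in> X" "b \<in> X" "E a b" "r a \<noteq> r b"
    show "E' (r a) (r b)"
      by (rule e[OF subsetD[OF sub[OF that] ab(1)] subsetD[OF sub[OF that] ab(2)] ab(3,4)])
  qed
  have t: "touch E' (r ` X) (r ` Y)" if XY: "X \<in> ?M" "Y \<in> ?M" "X \<inter> Y = {}" "touch E X Y" for X Y
  proof -
    obtain a b where ab: "a \<in> X" "b \<in> Y" "E a b" using XY(4) unfolding touch_def by blast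
    have "r a \<noteq> r b" using d[OF XY(1-3)] ab(1,2) by blast
    then have "E' (r a) (r b)"
      by (rule e[OF subsetD[OF sub[OF XY(1)] ab(1)] subsetD[OF sub[OF XY(2)] ab(2)] ab(3)])
    then show ?thesis using ab unfolding touch_def by blast
  qed
  have dis: "A \<inter> B = {}" "A \<inter> C = {}" "A \<inter> D = {}" "A \<inter> F = {}" "B \<inter> C = {}" "B \<inter> D = {}"
     "B \<inter> F = {}" "C \<inter> D = {}" "C \<inter> F = {}" "D \<inter> F = {}" "D \<inter> A = {}" "D \<inter> B = {}" "D \<inter> C = {}"
     "F \<inter> A = {}" "F \<inter> B = {}" "F \<inter> C = {}"
    using assms(1) unfolding k5e_model_def by (simp_all add: Int_commute)
  have tt: "touch E A B" "touch E A C" "touch E B C" "touch E D A" "touch E D B" "touch E D C"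
     "touch E F A" "touch E F B" "touch E F C"
    using assms(1) unfolding k5e_model_def by simp_all
  show ?thesis
    unfolding k5e_model_def
    by (intro conjI; (rule d t; simp add: dis tt)?) (use c in simp)
qed

lemma reduces_to_trans:
  assumes "reduces_to H K" "reduces_to G H"
  shows "reduces_to G K"
  using assms by (induction rule: reduces_to.induct) (auto intro: reduces_to.intros)

lemma has_minor_step: "reduces_to G H \<Longrightarrow> has_minor H K \<Longrightarrow> has_minor G K"
  unfolding has_minor_def using reduces_to_trans by metis

lemma pairs_of_five:
  assumes "distinct [a, b, c, d, f]"
  shows "{e. e \<subseteq> {a, b, c, d, f} \<and> card e = 2} =
    {{a, b}, {a, c}, {b, c}, {d, a}, {d, b}, {d, c}, {f, a}, {f, b}, {f, c}, {d, f}}" (is "?L = ?R")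
proof
  show "?R \<subseteq> ?L" using assms by (auto simp: card_insert_if)
  show "?L \<subseteq> ?R"
  proof
    fix e assume "e \<in> ?L"
    then obtain p q where "e = {p, q}" "p \<noteq> q" "p \<in> {a, b, c, d, f}" "q \<in> {a, b, c, d, f}"
      by (auto simp: card_2_iff)
    then show "e \<in> ?R" by (elim insertE emptyE; simp add: insert_commute)
  qed
qed

lemma k5e_model_singletons_minor:
  assumes G: "simple_graph G" "verts G = {a, b, c, d, f}" "distinct [a, b, c, d, f]"
    and m: "k5e_model (adj G) {a} {b} {c} {d} {f}" and df: "{d, f} \<notin> edges G"
  shows "has_minor G K5_minus_edge"
proof -
  have e: "{a, b} \<in> edges G" "{a, c} \<in> edges G" "{b, c} \<in> edges G" "{d, a} \<in> edges G" "{d, b} \<in> edges G"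
    "{d, c} \<in> edges G" "{f, a} \<in> edges G" "{f, b} \<in> edges G" "{f, c} \<in> edges G"
    using m unfolding k5e_model_def touch_def adj_def by simp_all
  have "edges G \<subseteq> {e. e \<subseteq> {a, b, c, d, f} \<and> card e = 2}" using G(1,2) unfolding simple_graph_def by auto
  then have ten: "edges G \<subseteq> {{a, b}, {a, c}, {b, c}, {d, a}, {d, b}, {d, c}, {f, a}, {f, b}, {f, c}, {d, f}}"
    by (simp only: pairs_of_five[OF G(3)])
  have "edges G \<subseteq> {{a, b}, {a, c}, {b, c}, {d, a}, {d, b}, {d, c}, {f, a}, {f, b}, {f, c}}"
  proof
    fix e assume e: "e \<in> edges G"
    then have "e \<noteq> {d, f}" using df by auto
    moreover note subsetD[OF ten e]
    ultimately show "e \<in> {{a, b}, {a, c}, {b, c}, {d, a}, {d, b}, {d, c}, {f, a}, {f, b}, {f, c}}"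
      unfolding insert_iff empty_iff by argo
  qed
  then have E: "edges G = {{a, b}, {a, c}, {b, c}, {d, a}, {d, b}, {d, c}, {f, a}, {f, b}, {f, c}}"
    using e by (intro equalityI) simp_all
  have five: "{1..5::nat} = {1, 2, 3, 4, 5}" by auto
  have "{e. e \<subseteq> {1, 2, 3, 4, 5::nat} \<and> card e = 2} - {{4, 5}} =
    {{1, 2}, {1, 3}, {2, 3}, {4, 1}, {4, 2}, {4, 3}, {5, 1}, {5, 2}, {5, 3}}"
    by (subst pairs_of_five) (auto simp: doubleton_eq_iff)
  then have K: "edges K5_minus_edge = {{1, 2}, {1, 3}, {2, 3}, {4, 1}, {4, 2}, {4, 3}, {5, 1}, {5, 2}, {5, 3}}"
    "verts K5_minus_edge = {1, 2, 3, 4, 5}"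
    unfolding K5_minus_edge_def delete_edge_def complete_graph_def five by simp_all
  define h :: "'a \<Rightarrow> nat" where "h x = (if x = a then 1 else if x = b then 2 else if x = c then 3 else if x = d then 4 else 5)" for x
  have h: "h a = 1" "h b = 2" "h c = 3" "h d = 4" "h f = 5" using G(3) by (auto simp: h_def)
  have "bij_betw h (verts G) (verts K5_minus_edge)"
    unfolding bij_betw_def G(2) K(2) using G(3) h by (auto simp: inj_on_def)
  moreover have "edges K5_minus_edge = (\<lambda>e. h ` e) ` edges G" unfolding E K(1) by (simp add: h)
  ultimately have "graph_isomorphic G K5_minus_edge" unfolding graph_isomorphic_def by blast
  then show ?thesis unfolding has_minor_def using reduces_to.refl by blast
qed

lemma simple_delete_vertex: "simple_graph G \<Longrightarrow> simple_graph (delete_vertex G v)"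
  unfolding simple_graph_def delete_vertex_def by auto

lemma simple_delete_edge: "simple_graph G \<Longrightarrow> simple_graph (delete_edge G e)"
  unfolding simple_graph_def delete_edge_def by auto

lemma simple_contract_edge:
  assumes "simple_graph G" "u \<in> verts G" "u \<noteq> v"
  shows "simple_graph (contract_edge G u v)"
  unfolding simple_graph_def
proof (intro conjI ballI)
  show "finite (verts (contract_edge G u v))" using assms(1) by (simp add: simple_graph_def contract_edge_def)
next
  fix e assume "e \<in> edges (contract_edge G u v)"
  then obtain e0 where e0: "e0 \<in> edges G" "e = (\<lambda>x. if x = v then u else x) ` e0" and c: "card e = 2"
    unfolding contract_edge_def by auto
  have "e0 \<subseteq> verts G" using assms(1) e0(1) by (simp add: simple_graph_def)
  then show "e \<subseteq> verts (contract_edge G u v)" using assms(2,3) e0(2) by (auto simp: contract_edge_def)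
  show "card e = 2" by (rule c)
qed

lemma adj_contract_edge:
  assumes "adj G p q" "r = (\<lambda>x. if x = v then u else x)" "r p \<noteq> r q"
  shows "adj (contract_edge G u v) (r p) (r q)"
proof -
  have "r ` {p, q} \<in> (\<lambda>e. r ` e) ` edges G" using assms(1) unfolding adj_def by (rule imageI)
  moreover have "card (r ` {p, q}) = 2" using assms(3) by simp
  moreover have "edges (contract_edge G u v) = {e \<in> (\<lambda>e. r ` e) ` edges G. card e = 2}"
    by (simp only: contract_edge_def graph.simps assms(2))
  ultimately have "r ` {p, q} \<in> edges (contract_edge G u v)" by (simp only: mem_Collect_eq)
  then show ?thesis unfolding adj_def by (simp only: image_insert image_empty)
qed

lemma card_edges_contract:
  assumes "finite (edges G)"
  shows "card (edges (contract_edge G u v)) \<le> card (edges G)"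
proof -
  let ?I = "(\<lambda>e. (\<lambda>x. if x = v then u else x) ` e) ` edges G"
  have "edges (contract_edge G u v) \<subseteq> ?I" unfolding contract_edge_def by auto
  then have "card (edges (contract_edge G u v)) \<le> card ?I" by (rule card_mono[rotated]) (simp add: assms)
  also have "\<dots> \<le> card (edges G)" by (rule card_image_le[OF assms])
  finally show ?thesis .
qed

text \<open>A vertex outside the branch sets is deleted, an edge inside a branch set is contracted,
  and once all branch sets are singletons an edge between the last two is deleted. Edges are counted
  in the measure because of this last operation.\<close>

lemma has_minor_of_k5e_model:
  assumes "simple_graph G" "k5e_model (adj G) A B C D F" "A \<union> B \<union> C \<union> D \<union> F \<subseteq> verts G"
  shows "has_minor G K5_minus_edge"
  using assms
proof (induction "card (verts G) + card (edges G)" arbitrary: G A B C D F rule: less_induct)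
  case less
  note G = less.prems(1) and m = less.prems(2) and sub = less.prems(3)
  let ?U = "A \<union> B \<union> C \<union> D \<union> F" and ?M = "{A, B, C, D, F}"
  have finV: "finite (verts G)" using G by (simp add: simple_graph_def)
  have finE: "finite (edges G)" by (rule finite_edges[OF G])
  have dis: "X = Y \<or> X \<inter> Y = {}" if "X \<in> ?M" "Y \<in> ?M" for X Y
    using m that unfolding k5e_model_def by (elim insertE emptyE; simp add: Int_commute)
  consider (outside) v where "v \<in> verts G" "v \<notin> ?U"
    | (big) X where "X \<in> ?M" "\<nexists>x. X = {x}"
    | (single) "verts G = ?U" "\<And>X. X \<in> ?M \<Longrightarrow> \<exists>x. X = {x}"
    using sub by blast
  then show ?case
  proof cases
    case outside
    let ?H = "delete_vertex G v"
    have "card (verts ?H) < card (verts G)"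
      using outside(1) finV by (simp add: delete_vertex_def card_Diff1_less del: card_Diff_insert)
    moreover have "card (edges ?H) \<le> card (edges G)"
      using finE by (simp add: delete_vertex_def card_mono)
    ultimately have lt: "card (verts ?H) + card (edges ?H) < card (verts G) + card (edges G)" by linarith
    have "k5e_model (adj ?H) (id ` A) (id ` B) (id ` C) (id ` D) (id ` F)"
    proof (rule k5e_model_image[OF m])
      fix p q assume "p \<in> ?U" "q \<in> ?U" "adj G p q"
      then show "adj ?H (id p) (id q)" using outside(2) by (auto simp: adj_def delete_vertex_def)
    qed simp
    then have mH: "k5e_model (adj ?H) A B C D F" by simp
    have "?U \<subseteq> verts ?H" using sub outside(2) by (auto simp: delete_vertex_def)
    then have "has_minor ?H K5_minus_edge" by (rule less.hyps[OF lt simple_delete_vertex[OF G] mH])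
    then show ?thesis by (rule has_minor_step[OF reduces_to.delete_vertex[OF reduces_to.refl outside(1)]])
  next
    case big
    have "\<forall>X\<in>?M. conn_set (adj G) X" using m unfolding k5e_model_def by (rule conjunct1)
    then have cX: "conn_set (adj G) X" using big(1) by (rule bspec)
    obtain u where u: "u \<in> X" using conn_set_nonempty[OF cX] by blast
    have h: "{u} \<subseteq> X" "{u} \<noteq> {}" "{u} \<noteq> X" using u big(2) by auto
    obtain u' v where "u' \<in> {u}" "v \<in> X" "v \<notin> {u}" "adj G u' v" by (rule conn_setE[OF cX h])
    then have v: "v \<in> X" "v \<noteq> u" "adj G u v" by auto
    let ?H = "contract_edge G u v"
    define r where "r = (\<lambda>x. if x = v then u else x)"
    have XU: "X \<subseteq> ?U" using big(1) by auto
    then have uvV: "u \<in> verts G" "v \<in> verts G" using u v(1) sub by auto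
    have "card (verts ?H) < card (verts G)"
      using uvV(2) finV by (simp add: contract_edge_def card_Diff1_less del: card_Diff_insert)
    then have lt: "card (verts ?H) + card (edges ?H) < card (verts G) + card (edges G)"
      using card_edges_contract[OF finE, of u v] by linarith
    have same: "u \<in> Y \<longleftrightarrow> v \<in> Y" if "Y \<in> ?M" for Y using dis[OF big(1) that] u v(1) by blast
    have mH: "k5e_model (adj ?H) (r ` A) (r ` B) (r ` C) (r ` D) (r ` F)"
    proof (rule k5e_model_image[OF m])
      fix p q assume "adj G p q" "r p \<noteq> r q"
      then show "adj ?H (r p) (r q)" by (intro adj_contract_edge) (simp_all add: r_def)
    next
      fix Y Z assume YZ: "Y \<in> ?M" "Z \<in> ?M" "Y \<inter> Z = {}"
      have "r ` Y \<subseteq> Y" "r ` Z \<subseteq> Z" using same[OF YZ(1)] same[OF YZ(2)] by (auto simp: r_def)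
      then show "r ` Y \<inter> r ` Z = {}" using YZ(3) by blast
    qed
    have "r ` A \<union> r ` B \<union> r ` C \<union> r ` D \<union> r ` F \<subseteq> verts ?H"
      using sub uvV(1) v(2) by (auto simp: r_def contract_edge_def)
    then have "has_minor ?H K5_minus_edge"
      by (rule less.hyps[OF lt simple_contract_edge[OF G uvV(1) v(2)[symmetric]] mH])
    then show ?thesis
      by (rule has_minor_step[OF reduces_to.contract_edge[OF reduces_to.refl v(3)[unfolded adj_def]]])
  next
    case single
    obtain a b c d f where s: "A = {a}" "B = {b}" "C = {c}" "D = {d}" "F = {f}"
      using single(2)[of A] single(2)[of B] single(2)[of C] single(2)[of D] single(2)[of F] by auto
    have V: "verts G = {a, b, c, d, f}" using single(1) s by auto
    have dist: "distinct [a, b, c, d, f]" using m unfolding k5e_model_def s by auto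
    have m1: "k5e_model (adj G) {a} {b} {c} {d} {f}" using m s by simp
    show ?thesis
    proof (cases "{d, f} \<in> edges G")
      case False
      then show ?thesis by (rule k5e_model_singletons_minor[OF G V dist m1])
    next
      case True
      let ?H = "delete_edge G {d, f}"
      have "card (edges ?H) < card (edges G)"
        using True finE by (simp add: delete_edge_def card_Diff1_less del: card_Diff_insert)
      then have lt: "card (verts ?H) + card (edges ?H) < card (verts G) + card (edges G)" by (simp add: delete_edge_def)
      have "k5e_model (adj ?H) {a} {b} {c} {d} {f}"
        using m1 dist unfolding k5e_model_def touch_def adj_def delete_edge_def by (auto simp: doubleton_eq_iff)
      then have "has_minor ?H K5_minus_edge"
        by (rule less.hyps[OF lt simple_delete_edge[OF G]]) (simp add: V delete_edge_def)
      then show ?thesis by (rule has_minor_step[OF reduces_to.delete_edge[OF reduces_to.refl True]])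
    qed
  qed
qed

lemma not_k5e_of_minor_free:
  assumes "simple_graph G" "\<not> has_minor G K5_minus_edge"
  shows "\<not> k5e (verts G) (adj G)"
  using has_minor_of_k5e_model[OF assms(1)] assms(2) unfolding k5e_def by blast

section \<open>Lifted cut vectors and normality\<close>

lemma sum_list_eq_counts:
  fixes xs :: "'b::real_vector list"
  assumes "finite L" "set xs \<subseteq> L"
  shows "sum_list xs = (\<Sum>z\<in>L. real (count_list xs z) *\<^sub>R z)"
  using assms(2)
proof (induction xs)
  case (Cons x xs)
  have "(\<Sum>z\<in>L. real (count_list (x # xs) z) *\<^sub>R z) =
     (\<Sum>z\<in>L. (if z = x then z else 0) + real (count_list xs z) *\<^sub>R z)"
    by (rule sum.cong) (auto simp: scaleR_left_distrib)
  also have "\<dots> = x + sum_list xs"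
    using Cons assms(1) by (simp add: sum.distrib)
  finally show ?case by simp
qed simp

lemma fst_sum_list: "fst (sum_list xs) = sum_list (map fst xs)"
  by (induction xs) simp_all

lemma snd_sum_list: "snd (sum_list xs) = sum_list (map snd xs)"
  by (induction xs) simp_all

lemma sum_list_component: "sum_list xs $ e = sum_list (map (\<lambda>v. v $ e) xs)"
  by (induction xs) simp_all

lemma cut_vector_pair:
  assumes "u \<noteq> v"
  shows "cut_vector G S $ {u, v} = of_bool ({u, v} \<in> edges G \<and> (u \<in> S) \<noteq> (v \<in> S))"
proof -
  have "card (S \<inter> {u, v}) = 1 \<longleftrightarrow> (u \<in> S) \<noteq> (v \<in> S)"
    using assms by (cases "u \<in> S"; cases "v \<in> S") auto
  then show ?thesis by (simp add: cut_vector_def)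
qed

lemma finite_lifted: "finite (lifted_cut_vectors G)"
proof -
  have "lifted_cut_vectors G = (\<lambda>S. (cut_vector G S, 1)) ` Pow (verts G)"
    unfolding lifted_cut_vectors_def cut_vectors_def by auto
  then show ?thesis by simp
qed

lemma combinations_mono: "C \<subseteq> C' \<Longrightarrow> combinations C X \<subseteq> combinations C' X"
  unfolding combinations_def by blast

theorem theorem3p8:
  fixes G :: "'v::finite graph"
  assumes "simple_graph G"
    and "\<not> has_minor G K5_minus_edge"
  shows "cut_polytope_normal G"
proof -
  let ?L = "lifted_cut_vectors G"
  have finL: "finite ?L" by (rule finite_lifted)
  have "combinations \<nat> ?L \<subseteq> combinations \<int> ?L" by (rule combinations_mono) (rule Nats_subset_Ints)
  moreover have "combinations \<nat> ?L \<subseteq> combinations {q \<in> \<rat>. 0 \<le> q} ?L"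
    by (rule combinations_mono) (auto elim: Nats_cases)
  moreover have "p \<in> combinations \<nat> ?L"
    if pi: "p \<in> combinations \<int> ?L" and pq: "p \<in> combinations {q \<in> \<rat>. 0 \<le> q} ?L" for p
  proof -
    obtain c where c: "p = (\<Sum>z\<in>?L. c z *\<^sub>R z)" "\<forall>z\<in>?L. c z \<in> \<int>" using pi unfolding combinations_def by blast
    obtain d where d: "p = (\<Sum>z\<in>?L. d z *\<^sub>R z)" "\<forall>z\<in>?L. d z \<in> {q \<in> \<rat>. 0 \<le> q}" using pq unfolding combinations_def by blast
    have d0: "0 \<le> d z" if "z \<in> ?L" for z using d(2) that by blast
    have "\<forall>z\<in>?L. \<exists>S. z = (cut_vector G S, 1)" unfolding lifted_cut_vectors_def cut_vectors_def by blast
    then obtain S where S: "\<And>z. z \<in> ?L \<Longrightarrow> z = (cut_vector G (S z), 1)" by metis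
    define n where "n z = \<lfloor>c z\<rfloor>" for z
    have n: "c z = of_int (n z)" if "z \<in> ?L" for z using c(2) that by (simp add: n_def)
    have sndz: "snd z = 1" if "z \<in> ?L" for z using arg_cong[OF S[OF that], of snd] by (simp only: snd_conv)
    have snd_c: "snd p = (\<Sum>z\<in>?L. c z)" unfolding c(1) snd_sum by (rule sum.cong) (simp_all add: sndz)
    have snd_d: "snd p = (\<Sum>z\<in>?L. d z)" unfolding d(1) snd_sum by (rule sum.cong) (simp_all add: sndz)
    define T where "T = (\<Sum>z\<in>?L. n z)"
    have T: "snd p = of_int T" unfolding snd_c T_def of_int_sum by (rule sum.cong) (simp_all add: n)
    have T0: "0 \<le> T"
    proof -
      have "0 \<le> snd p" unfolding snd_d by (rule sum_nonneg) (rule d0)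
      then show ?thesis unfolding T by simp
    qed
    define t where "t = nat T"
    have t: "snd p = real t" unfolding T t_def using T0 by simp
    show ?thesis
    proof (cases "t = 0")
      \<comment> \<open>The extension requires \<open>1 \<le> t\<close>. At height 0 the nonnegative
        weights \<open>d\<close> vanish, hence \<open>p = 0\<close>.\<close>
      case True
      then have "(\<Sum>z\<in>?L. d z) = 0" using t snd_d by simp
      then have "\<forall>z\<in>?L. d z = 0" using sum_nonneg_eq_0_iff[of ?L d, OF finL d0] by blast
      then have "p = (\<Sum>z\<in>?L. 0 *\<^sub>R z)" unfolding d(1) by (intro sum.cong) simp_all
      then show ?thesis unfolding combinations_def by (intro CollectI exI[of _ "\<lambda>_. 0"]) simp
    next
      case False
      have ne: "u \<noteq> v" if "adj G u v" for u v using adj_irrefl[OF assms(1), of u] that by auto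
      have cut: "fst z $ {u, v} = of_bool ((u \<in> S z) \<noteq> (v \<in> S z))" if "z \<in> ?L" "adj G u v" for z u v
      proof -
        have "fst z = cut_vector G (S z)" using arg_cong[OF S[OF that(1)], of fst] by (simp only: fst_conv)
        then show ?thesis using cut_vector_pair[OF ne[OF that(2)], of G "S z"] that(2) by (simp add: adj_def)
      qed
      have comp: "fst (\<Sum>z\<in>?L. k z *\<^sub>R z) $ e = (\<Sum>z\<in>?L. k z * fst z $ e)" for k e
        unfolding fst_sum sum_component by (rule sum.cong) simp_all
      define x where "x u v = (\<Sum>z\<in>?L. n z * of_bool ((u \<in> S z) \<noteq> (v \<in> S z)))" for u v
      \<comment> \<open>The parity potential: for each cut the indicators of \<open>u\<close>, of
        \<open>v\<close> and of their separation add up to an even number.\<close>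
      define col where "col v = (\<Sum>z\<in>?L. n z * of_bool (v \<in> S z))" for v
      have xc: "fst p $ {u, v} = of_int (x u v)" if "adj G u v" for u v
        unfolding c(1) comp x_def of_int_sum by (rule sum.cong) (simp_all add: n cut that)
      \<comment> \<open>On edges the integers \<open>x\<close> can also be computed from the weights
        \<open>d\<close>, which brings in the cone; on other pairs the two representations may
        differ.\<close>
      have xd: "real_of_int (x u v) = (\<Sum>z\<in>?L. d z * of_bool ((u \<in> S z) \<noteq> (v \<in> S z)))" if "adj G u v" for u v
        unfolding xc[OF that, symmetric] d(1) comp by (rule sum.cong) (simp_all add: cut that)
      have even: "even (x u v + col u + col v)" for u v
        unfolding x_def col_def sum.distrib[symmetric] by (rule dvd_sum) auto
      have t1: "1 \<le> t" using False by simp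
      have td: "real t = (\<Sum>z\<in>?L. d z)" using t snd_d by simp
      obtain y where y: "even_metric y t" "\<And>u v. adj G u v \<Longrightarrow> y u v = x u v"
      proof (rule even_metric_extension[OF finL d0 sympD[OF adj_sym] xd td t1 even])
        fix y assume "even_metric y t" "\<And>u v. adj G u v \<Longrightarrow> y u v = x u v"
        then show thesis by (rule that)
      qed
      interpret even_metric y t by (rule y(1))
      have "finite (verts G)" by simp
      then have "cut_sum (verts G) (adj G)"
        by (rule cut_sum_if_not_k5e[OF _ adj_sym adj_irrefl[OF assms(1)] not_k5e_of_minor_free[OF assms]])
      then obtain Ss where Ss: "length Ss = t"
        "\<And>u v. u \<in> verts G \<Longrightarrow> v \<in> verts G \<Longrightarrow> adj G u v \<Longrightarrow> int (sepcount Ss u v) = y u v"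
        unfolding cut_sum_def by blast
      \<comment> \<open>The shores in \<open>Ss\<close> may contain elements of the type that are
        not vertices of \<open>G\<close>; the intersection does not affect the edges.\<close>
      define g where "g R = (cut_vector G (R \<inter> verts G), 1 :: real)" for R
      have gL: "set (map g Ss) \<subseteq> ?L" unfolding g_def lifted_cut_vectors_def cut_vectors_def by auto
      have "p = sum_list (map g Ss)"
      proof (rule prod_eqI)
        show "snd p = snd (sum_list (map g Ss))"
          unfolding t snd_sum_list using Ss(1) by (simp add: g_def comp_def sum_list_triv)
        show "fst p = fst (sum_list (map g Ss))"
        proof (rule vec_eq_iff[THEN iffD2, rule_format])
          fix e
          have r: "fst (sum_list (map g Ss)) $ e = sum_list (map (\<lambda>R. cut_vector G (R \<inter> verts G) $ e) Ss)"
            unfolding fst_sum_list sum_list_component by (simp add: g_def comp_def)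
          show "fst p $ e = fst (sum_list (map g Ss)) $ e"
          proof (cases "e \<in> edges G")
            case False
            have "fst z $ e = 0" if "z \<in> ?L" for z
            proof -
              have "fst z = cut_vector G (S z)" using arg_cong[OF S[OF that], of fst] by (simp only: fst_conv)
              then show ?thesis using False by (simp add: cut_vector_def)
            qed
            then have "fst p $ e = 0" unfolding c(1) comp by simp
            moreover have "cut_vector G R $ e = 0" for R using False by (simp add: cut_vector_def)
            ultimately show ?thesis unfolding r by simp
          next
            case True
            then have "card e = 2" using assms(1) by (simp add: simple_graph_def)
            then obtain u v where uv: "e = {u, v}" "u \<noteq> v" by (meson card_2_iff)
            have a: "adj G u v" using True uv(1) by (simp add: adj_def)
            have V: "u \<in> verts G" "v \<in> verts G" using adj_verts[OF assms(1) a] by auto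
            have "sum_list (map (\<lambda>R. cut_vector G (R \<inter> verts G) $ e) Ss) = real (sepcount Ss u v)"
              unfolding uv(1) cut_vector_pair[OF uv(2)] using True uv(1) V
              by (induction Ss) (auto simp: sepcount_def)
            also have "\<dots> = of_int (int (sepcount Ss u v))" by simp
            also have "\<dots> = of_int (x u v)" unfolding Ss(2)[OF V a] y(2)[OF a] ..
            also have "\<dots> = fst p $ e" using xc[OF a] uv(1) by simp
            finally show ?thesis unfolding r by simp
          qed
        qed
      qed
      then have "p = (\<Sum>z\<in>?L. real (count_list (map g Ss) z) *\<^sub>R z)"
        using sum_list_eq_counts[OF finL gL] by simp
      then show ?thesis unfolding combinations_def
        by (intro CollectI exI[of _ "\<lambda>z. real (count_list (map g Ss) z)"]) simp
    qed
  qed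
  ultimately show ?thesis unfolding cut_polytope_normal_def by blast
qed

end
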